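(* Let $\mathcal{C}$ be one of the classes $\mathcal{E}_3$, $\mathcal{E}_4$, $\mathcal{E}_5$, $\mathcal{E}_6$ or $\mathcal{E}$, and let $k \geq 2$ be an integer. Then a $3k$-vertex graph $G$ is in $\mathcal{C}$ if and only if $G$ is isomorphic to the strong product of a triangle and a path of length $k-1$ (that is, a path with $k$ vertices).
   Context: Graphs are finite and simple. The strong product $G\boxtimes H$ is the graph on $V(G)\times V(H)$ in which $(v,w)$ and $(v',w')$ are adjacent iff ($v=v'$ and $ww'\in E(H)$), or ($vv'\in E(G)$ and $w=w'$), or ($vv'\in E(G)$ and $ww'\in E(H)$). For a graph $G$, let $|G|$ be its simplicial $1$-complex as a topological space. A drawing of $G$ is a continuous map $\phi\colon |G| \to \mathbb{S}^2$ (the $2$-sphere) such that: for every vertex $v$ and every point $x\in|G|$, $\phi(v)=\phi(x)$ implies $x=v$; only finitely many points $x\in\mathbb{S}^2$ (the crossings) satisfy $|\phi^{-1}(x)|\ge 2$; each crossing has exactly two preimages, which are inner points of distinct edges (these two edges are said to cross); and for each crossing $x$ there is an open set $D\ni x$ such that for every open $D'\subseteq D$ with $x\in D'$, removing the image of one of the two edges involved in $x$ disconnects $D'$ such that multiple components contain image points of the other edge. A $1$-drawing is a drawing in which no edge is involved in more than one crossing; a drawing is simple if no two adjacent edges cross. A graph is $1$-planar if it has a $1$-drawing. A region is a connected component of $\mathbb{S}^2\setminus\phi(|G|)$; its boundary is its closure minus itself; a face of $\phi$ is a region whose boundary contains no crossing. A cycle $C\subseteq G$ is facial with respect to $\phi$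 if the boundary of some face equals $\phi(|C|)$. For a subgraph $H$ of $G$, $\phi\restriction H$ denotes the restriction of $\phi$ to $|H|$. Stitch: given $1$-planar graphs $H_1,H_2$, a graph $G$ is a stitch of $H_1$ and $H_2$ if there are a simple $1$-drawing $\phi$ of $G$ and proper subgraphs $G_1,G_2$ of $G$, isomorphic to $H_1$ and $H_2$ respectively, such that $G_1\cup G_2=G$ and $G_1\cap G_2$ is a triangle that is facial with respect to both $\phi\restriction G_1$ and $\phi\restriction G_2$. $G+H$ is the graph join (disjoint union plus all edges between the two parts), $\overline{G}$ the complement, $P_m$ and $C_m$ the path and cycle with $m$ vertices, $K_{2,2,2,2}$ the complete $4$-partite graph with parts of size $2$. The classes are defined recursively; throughout, $|V(H_i)|=3k_i+s_i$ with integers $k_i$ and $s_i\in\{0,1,2\}$ for $i\in\{1,2\}$. $\mathcal{E}_3$: every graph with at most two vertices; every graph isomorphic to one of $K_3,K_4,K_5,K_6,K_3+C_4,K_{2,2,2,2}$; every stitch of some $H_1,H_2\in\mathcal{E}_3\cup\{K_2+\overline{P_6}\}$ with $k_1,k_2\ge2$ and $s_1+s_2\le2$. $\mathcal{E}_4$: every graph with at most three vertices; every clique with at most six vertices; every graph isomorphic to $K_3+C_4$; every stitch of some $H_1,H_2\in\mathcal{E}_4$ with $k_1,k_2\ge1$ and $s_1=0$. $\mathcal{E}_5$: every graph with at most four vertices; every graph isomorphic to $K_5$ or $K_6$; every stitch of some $H_1,H_2\in\mathcal{E}_5$ with $k_1,k_2\ge1$ and $s_1=0$. $\mathcal{E}_6$: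 every graph with at most five vertices; every graph isomorphic to $K_6$; every stitch of some $H_1,H_2\in\mathcal{E}_6$ with $k_1,k_2\ge1$ and $s_1+s_2\le2$. $\mathcal{E}$: every clique with at most six vertices; every graph isomorphic to $K_3+C_4$; every stitch of some $H_1,H_2\in\mathcal{E}$ with $k_1,k_2\ge1$ and $s_1=0$. *)

theory Defs
  imports "HOL-Analysis.Analysis"
begin

section \<open>Finite simple graphs\<close>

record 'a graph =
  verts :: "'a set"
  edges :: "'a set set"

definition simple_graph :: "'a graph \<Rightarrow> bool" where
  "simple_graph G \<longleftrightarrow> finite (verts G) \<and> (\<forall>e\<in>edges G. e \<subseteq> verts G \<and> card e = 2)"

definition subgraph :: "'a graph \<Rightarrow> 'a graph \<Rightarrow> bool" where
  "subgraph H G \<longleftrightarrow> simple_graph H \<and> verts H \<subseteq> verts G \<and> edges H \<subseteq> edges G"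

definition proper_subgraph :: "'a graph \<Rightarrow> 'a graph \<Rightarrow> bool" where
  "proper_subgraph H G \<longleftrightarrow> subgraph H G \<and> H \<noteq> G"

definition graph_union :: "'a graph \<Rightarrow> 'a graph \<Rightarrow> 'a graph" where
  "graph_union G H = \<lparr>verts = verts G \<union> verts H, edges = edges G \<union> edges H\<rparr>"

definition graph_inter :: "'a graph \<Rightarrow> 'a graph \<Rightarrow> 'a graph" where
  "graph_inter G H = \<lparr>verts = verts G \<inter> verts H, edges = edges G \<inter> edges H\<rparr>"

definition isomorphic :: "'a graph \<Rightarrow> 'b graph \<Rightarrow> bool" where
  "isomorphic G H \<longleftrightarrow>
     (\<exists>f. bij_betw f (verts G) (verts H) \<and>
          (\<forall>u\<in>verts G. \<forall>v\<in>verts G. {u, v} \<in> edges G \<longleftrightarrow> {f u, f v} \<in> edges H))"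

definition complete_graph :: "nat \<Rightarrow> nat graph" where
  "complete_graph n = \<lparr>verts = {..<n}, edges = {{i, j} |i j. i < n \<and> j < n \<and> i \<noteq> j}\<rparr>"

definition path_graph :: "nat \<Rightarrow> nat graph" where
  "path_graph m = \<lparr>verts = {..<m}, edges = {{i, Suc i} |i. Suc i < m}\<rparr>"

text \<open>Only meaningful for \<open>m \<ge> 3\<close>.\<close>
definition cycle_graph :: "nat \<Rightarrow> nat graph" where
  "cycle_graph m = \<lparr>verts = {..<m}, edges = {{i, Suc i mod m} |i. i < m}\<rparr>"

text \<open>The complete multipartite graph with \<open>r\<close> parts of size \<open>t\<close>; the first component
  of a vertex names its part.\<close>
definition complete_multipartite :: "nat \<Rightarrow> nat \<Rightarrow> (nat \<times> nat) graph" where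
  "complete_multipartite r t =
     \<lparr>verts = {..<r} \<times> {..<t},
      edges = {{p, q} |p q. p \<in> {..<r} \<times> {..<t} \<and> q \<in> {..<r} \<times> {..<t} \<and> fst p \<noteq> fst q}\<rparr>"

definition complement :: "'a graph \<Rightarrow> 'a graph" where
  "complement G =
     \<lparr>verts = verts G,
      edges = {{u, v} |u v. u \<in> verts G \<and> v \<in> verts G \<and> u \<noteq> v \<and> {u, v} \<notin> edges G}\<rparr>"

definition graph_join :: "'a graph \<Rightarrow> 'b graph \<Rightarrow> ('a + 'b) graph" where
  "graph_join G H =
     \<lparr>verts = verts G <+> verts H,
      edges = (\<lambda>e. Inl ` e) ` edges G \<union> (\<lambda>e. Inr ` e) ` edges H
              \<union> {{Inl v, Inr w} |v w. v \<in> verts G \<and> w \<in> verts H}\<rparr>"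

definition strong_product :: "'a graph \<Rightarrow> 'b graph \<Rightarrow> ('a \<times> 'b) graph" where
  "strong_product G H =
     \<lparr>verts = verts G \<times> verts H,
      edges = {{(v, w), (v', w')} |v w v' w'.
                 v \<in> verts G \<and> v' \<in> verts G \<and> w \<in> verts H \<and> w' \<in> verts H \<and>
                 (v = v' \<and> {w, w'} \<in> edges H \<or>
                  {v, v'} \<in> edges G \<and> w = w' \<or>
                  {v, v'} \<in> edges G \<and> {w, w'} \<in> edges H)}\<rparr>"

definition is_cycle :: "'a graph \<Rightarrow> bool" where
  "is_cycle C \<longleftrightarrow> simple_graph C \<and> (\<exists>m\<ge>3. isomorphic C (cycle_graph m))"

definition is_triangle :: "'a graph \<Rightarrow> bool" where
  "is_triangle T \<longleftrightarrow> simple_graph T \<and> isomorphic T (complete_graph 3)"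


section \<open>The simplicial complex of a graph\<close>

text \<open>Points are given by barycentric coordinates: functions from the vertices to \<open>[0, 1]\<close> that
  sum up to \<open>1\<close> and are supported on a vertex or an edge. They live in \<open>'a \<Rightarrow> real\<close>, whose
  topology is the product topology; on the realization of a finite graph it induces the usual
  topology of the complex. The realization of a subgraph is a subset of that of the graph, so a
  drawing \<open>\<phi>\<close> and its restrictions to subgraphs are represented by the same function.\<close>

definition closed_cell :: "'a set \<Rightarrow> ('a \<Rightarrow> real) set" where
  "closed_cell s = {x. (\<forall>v. 0 \<le> x v) \<and> (\<forall>v. v \<notin> s \<longrightarrow> x v = 0) \<and> (\<Sum>v\<in>s. x v) = 1}"

definition open_cell :: "'a set \<Rightarrow> ('a \<Rightarrow> real) set" where
  "open_cell s = {x \<in> closed_cell s. \<forall>v\<in>s. 0 < x v}"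

definition vertex_point :: "'a \<Rightarrow> 'a \<Rightarrow> real" where
  "vertex_point v = (\<lambda>u. if u = v then 1 else 0)"

definition realization :: "'a graph \<Rightarrow> ('a \<Rightarrow> real) set" where
  "realization G = vertex_point ` verts G \<union> (\<Union>e\<in>edges G. closed_cell e)"


section \<open>Drawings\<close>

abbreviation S2 :: "(real ^ 3) set" where
  "S2 \<equiv> sphere 0 1"

definition crossings :: "'a graph \<Rightarrow> (('a \<Rightarrow> real) \<Rightarrow> real ^ 3) \<Rightarrow> (real ^ 3) set" where
  "crossings G \<phi> =
     {p \<in> S2. \<exists>x\<in>realization G. \<exists>y\<in>realization G. x \<noteq> y \<and> \<phi> x = p \<and> \<phi> y = p}"

text \<open>\<open>D\<close> and \<open>D'\<close> are open in the sphere. Which of the two edges is removed may depend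
  on \<open>D'\<close>.\<close>
definition transversal_at ::
  "(('a \<Rightarrow> real) \<Rightarrow> real ^ 3) \<Rightarrow> 'a set \<Rightarrow> 'a set \<Rightarrow> real ^ 3 \<Rightarrow> bool" where
  "transversal_at \<phi> e f p \<longleftrightarrow>
     (\<exists>D. openin (top_of_set S2) D \<and> p \<in> D \<and>
        (\<forall>D'. openin (top_of_set S2) D' \<and> D' \<subseteq> D \<and> p \<in> D' \<longrightarrow>
           (\<exists>(g, h) \<in> {(e, f), (f, e)}.
              \<exists>A\<in>components (D' - \<phi> ` closed_cell g). \<exists>B\<in>components (D' - \<phi> ` closed_cell g).
                A \<noteq> B \<and> A \<inter> \<phi> ` closed_cell h \<noteq> {} \<and> B \<inter> \<phi> ` closed_cell h \<noteq> {})))"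

definition drawing :: "'a graph \<Rightarrow> (('a \<Rightarrow> real) \<Rightarrow> real ^ 3) \<Rightarrow> bool" where
  "drawing G \<phi> \<longleftrightarrow>
     continuous_on (realization G) \<phi> \<and>
     \<phi> ` realization G \<subseteq> S2 \<and>
     (\<forall>v\<in>verts G. \<forall>x\<in>realization G. \<phi> (vertex_point v) = \<phi> x \<longrightarrow> x = vertex_point v) \<and>
     finite (crossings G \<phi>) \<and>
     (\<forall>p\<in>crossings G \<phi>.
        \<exists>e\<in>edges G. \<exists>f\<in>edges G. e \<noteq> f \<and>
          (\<exists>x\<in>open_cell e. \<exists>y\<in>open_cell f. {z \<in> realization G. \<phi> z = p} = {x, y}) \<and>
          transversal_at \<phi> e f p)"

definition involved ::
  "'a graph \<Rightarrow> (('a \<Rightarrow> real) \<Rightarrow> real ^ 3) \<Rightarrow> 'a set \<Rightarrow> real ^ 3 \<Rightarrow> bool" where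
  "involved G \<phi> e p \<longleftrightarrow> p \<in> crossings G \<phi> \<and> p \<in> \<phi> ` open_cell e"

definition one_drawing :: "'a graph \<Rightarrow> (('a \<Rightarrow> real) \<Rightarrow> real ^ 3) \<Rightarrow> bool" where
  "one_drawing G \<phi> \<longleftrightarrow>
     drawing G \<phi> \<and>
     (\<forall>e\<in>edges G. \<forall>p q. involved G \<phi> e p \<and> involved G \<phi> e q \<longrightarrow> p = q)"

definition edges_cross ::
  "'a graph \<Rightarrow> (('a \<Rightarrow> real) \<Rightarrow> real ^ 3) \<Rightarrow> 'a set \<Rightarrow> 'a set \<Rightarrow> bool" where
  "edges_cross G \<phi> e f \<longleftrightarrow> e \<noteq> f \<and> (\<exists>p. involved G \<phi> e p \<and> involved G \<phi> f p)"

definition simple_drawing :: "'a graph \<Rightarrow> (('a \<Rightarrow> real) \<Rightarrow> real ^ 3) \<Rightarrow> bool" where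
  "simple_drawing G \<phi> \<longleftrightarrow>
     drawing G \<phi> \<and>
     (\<forall>e\<in>edges G. \<forall>f\<in>edges G. e \<noteq> f \<and> e \<inter> f \<noteq> {} \<longrightarrow> \<not> edges_cross G \<phi> e f)"

definition one_planar :: "'a graph \<Rightarrow> bool" where
  "one_planar G \<longleftrightarrow> simple_graph G \<and> (\<exists>\<phi>. one_drawing G \<phi>)"

definition regions :: "'a graph \<Rightarrow> (('a \<Rightarrow> real) \<Rightarrow> real ^ 3) \<Rightarrow> (real ^ 3) set set" where
  "regions G \<phi> = components (S2 - \<phi> ` realization G)"

text \<open>As the sphere is closed, the closure in the ambient space is the closure in the sphere.\<close>
definition boundary :: "(real ^ 3) set \<Rightarrow> (real ^ 3) set" where
  "boundary R = closure R - R"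

definition faces :: "'a graph \<Rightarrow> (('a \<Rightarrow> real) \<Rightarrow> real ^ 3) \<Rightarrow> (real ^ 3) set set" where
  "faces G \<phi> = {F \<in> regions G \<phi>. boundary F \<inter> crossings G \<phi> = {}}"

definition facial :: "'a graph \<Rightarrow> (('a \<Rightarrow> real) \<Rightarrow> real ^ 3) \<Rightarrow> 'a graph \<Rightarrow> bool" where
  "facial G \<phi> C \<longleftrightarrow>
     is_cycle C \<and> subgraph C G \<and> (\<exists>F\<in>faces G \<phi>. boundary F = \<phi> ` realization C)"


section \<open>Stitches and the recursive classes\<close>

definition stitch :: "'a graph \<Rightarrow> 'b graph \<Rightarrow> 'c graph \<Rightarrow> bool" where
  "stitch H1 H2 G \<longleftrightarrow>
     one_planar H1 \<and> one_planar H2 \<and> simple_graph G \<and>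
     (\<exists>\<phi> G1 G2.
        one_drawing G \<phi> \<and> simple_drawing G \<phi> \<and>
        proper_subgraph G1 G \<and> proper_subgraph G2 G \<and>
        isomorphic G1 H1 \<and> isomorphic G2 H2 \<and>
        graph_union G1 G2 = G \<and>
        is_triangle (graph_inter G1 G2) \<and>
        facial G1 \<phi> (graph_inter G1 G2) \<and>
        facial G2 \<phi> (graph_inter G1 G2))"

text \<open>In the classes below the graphs \<open>H1\<close> and \<open>H2\<close> have the same vertex type as their stitch.
  This is no restriction: they are isomorphic to subgraphs of the stitch.\<close>

inductive_set class_E3 :: "'a graph set" where
  small: "\<lbrakk>simple_graph G; card (verts G) \<le> 2\<rbrakk> \<Longrightarrow> G \<in> class_E3"
| clique: "\<lbrakk>simple_graph G; n \<in> {3, 4, 5, 6}; isomorphic G (complete_graph n)\<rbrakk> \<Longrightarrow> G \<in> class_E3"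
| K3_C4: "\<lbrakk>simple_graph G; isomorphic G (graph_join (complete_graph 3) (cycle_graph 4))\<rbrakk>
    \<Longrightarrow> G \<in> class_E3"
| K2222: "\<lbrakk>simple_graph G; isomorphic G (complete_multipartite 4 2)\<rbrakk> \<Longrightarrow> G \<in> class_E3"
| stitch:
    "\<lbrakk>H1 \<in> class_E3 \<or>
        isomorphic H1 (graph_join (complete_graph 2) (complement (path_graph 6)));
      H2 \<in> class_E3 \<or>
        isomorphic H2 (graph_join (complete_graph 2) (complement (path_graph 6)));
      card (verts H1) = 3 * k1 + s1; s1 \<in> {0, 1, 2};
      card (verts H2) = 3 * k2 + s2; s2 \<in> {0, 1, 2};
      k1 \<ge> 2; k2 \<ge> 2; s1 + s2 \<le> 2;
      stitch H1 H2 G\<rbrakk> \<Longrightarrow> G \<in> class_E3"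

inductive_set class_E4 :: "'a graph set" where
  small: "\<lbrakk>simple_graph G; card (verts G) \<le> 3\<rbrakk> \<Longrightarrow> G \<in> class_E4"
| clique: "\<lbrakk>simple_graph G; n \<le> 6; isomorphic G (complete_graph n)\<rbrakk> \<Longrightarrow> G \<in> class_E4"
| K3_C4: "\<lbrakk>simple_graph G; isomorphic G (graph_join (complete_graph 3) (cycle_graph 4))\<rbrakk>
    \<Longrightarrow> G \<in> class_E4"
| stitch:
    "\<lbrakk>H1 \<in> class_E4; H2 \<in> class_E4;
      card (verts H1) = 3 * k1 + s1; s1 \<in> {0, 1, 2};
      card (verts H2) = 3 * k2 + s2; s2 \<in> {0, 1, 2};
      k1 \<ge> 1; k2 \<ge> 1; s1 = 0;
      stitch H1 H2 G\<rbrakk> \<Longrightarrow> G \<in> class_E4"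

inductive_set class_E5 :: "'a graph set" where
  small: "\<lbrakk>simple_graph G; card (verts G) \<le> 4\<rbrakk> \<Longrightarrow> G \<in> class_E5"
| clique: "\<lbrakk>simple_graph G; n \<in> {5, 6}; isomorphic G (complete_graph n)\<rbrakk> \<Longrightarrow> G \<in> class_E5"
| stitch:
    "\<lbrakk>H1 \<in> class_E5; H2 \<in> class_E5;
      card (verts H1) = 3 * k1 + s1; s1 \<in> {0, 1, 2};
      card (verts H2) = 3 * k2 + s2; s2 \<in> {0, 1, 2};
      k1 \<ge> 1; k2 \<ge> 1; s1 = 0;
      stitch H1 H2 G\<rbrakk> \<Longrightarrow> G \<in> class_E5"

inductive_set class_E6 :: "'a graph set" where
  small: "\<lbrakk>simple_graph G; card (verts G) \<le> 5\<rbrakk> \<Longrightarrow> G \<in> class_E6"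
| clique: "\<lbrakk>simple_graph G; isomorphic G (complete_graph 6)\<rbrakk> \<Longrightarrow> G \<in> class_E6"
| stitch:
    "\<lbrakk>H1 \<in> class_E6; H2 \<in> class_E6;
      card (verts H1) = 3 * k1 + s1; s1 \<in> {0, 1, 2};
      card (verts H2) = 3 * k2 + s2; s2 \<in> {0, 1, 2};
      k1 \<ge> 1; k2 \<ge> 1; s1 + s2 \<le> 2;
      stitch H1 H2 G\<rbrakk> \<Longrightarrow> G \<in> class_E6"

inductive_set class_E :: "'a graph set" where
  clique: "\<lbrakk>simple_graph G; n \<le> 6; isomorphic G (complete_graph n)\<rbrakk> \<Longrightarrow> G \<in> class_E"
| K3_C4: "\<lbrakk>simple_graph G; isomorphic G (graph_join (complete_graph 3) (cycle_graph 4))\<rbrakk>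
    \<Longrightarrow> G \<in> class_E"
| stitch:
    "\<lbrakk>H1 \<in> class_E; H2 \<in> class_E;
      card (verts H1) = 3 * k1 + s1; s1 \<in> {0, 1, 2};
      card (verts H2) = 3 * k2 + s2; s2 \<in> {0, 1, 2};
      k1 \<ge> 1; k2 \<ge> 1; s1 = 0;
      stitch H1 H2 G\<rbrakk> \<Longrightarrow> G \<in> class_E"

end

(* If a triangle T is facial, its image is a Jordan curve with the whole graph on one side. In the
   disc on that side two disjoint connected sets cannot both reach all three corners of T (theta
   curves), so any two vertex-disjoint "tripods" with ends in T contain a crossing. Crossings form
   a partial matching of the edges, and counting the tripods available in the strong product of a
   triangle and P_3 shows that a facial triangle of the strong product of a triangle and P_k is one
   of its two end layers. Hence a stitch of two such chains is again a chain; as a stitch with 3k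
   vertices has s_1 = s_2 = 0 and K_6 is the chain with k = 2, all members with 3k vertices are
   chains. Conversely, the drawing by nested triangles, with the two diagonals of each quadrangle
   crossing, exhibits a chain as a stitch of a shorter chain and K_6. *)

theory Submission
  imports Defs
begin

section \<open>Crossings of tripods at a triangle\<close>

text \<open>The drawing of a stitch is arbitrary, so little can be said about its geometry. Three
  facts are extracted and become the axioms of \<open>matching_crossings\<close> and
  \<open>tripod_crossings\<close>: an edge has at most one crossing partner, partners are disjoint,
  and disjoint tripods cross. Everything else about facial triangles is counting: many tripods that
  share few edges cannot all be crossed by the few edges of another one. The delicate position is a
  triangle with corners in two layers, where the argument depends on whether a third layer is
  attached to the layer with two corners or to the layer with one. For k = 2 there is nothing to
  exclude, since any triangle of K_6 can be declared an end layer. The converse needs a formula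
  whose crossings and regions can be computed. Directions of the form (1, 1, 1) + r e_j joined by
  great circle arcs treat the three columns alike, turn the equality of two image points into linear
  equations, and make the two sides of a layer the sign sets of the single function
  \<open>level\<close>.\<close>

locale matching_crossings =
  fixes cr :: "'a set \<Rightarrow> 'a set \<Rightarrow> bool"
  assumes cr_sym: "cr e f \<Longrightarrow> cr f e"
    and cr_unique: "cr e f \<Longrightarrow> cr e g \<Longrightarrow> f = g"
    and cr_disjoint: "cr e f \<Longrightarrow> e \<inter> f = {}"
begin

text \<open>Choose for each \<open>i\<close> an edge of \<open>A\<close> that crosses into
  \<open>R i\<close>. The choice is injective, because an edge of \<open>A\<close> has only one
  partner and this partner lies in at most one \<open>R i\<close>. All counting below is this
  pigeonhole argument.\<close>

lemma card_le_of_crossed: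
  assumes "finite A"
    and crossed: "\<And>i. i \<in> W \<Longrightarrow> \<exists>e\<in>A. \<exists>f\<in>R i. cr e f"
    and disj: "\<And>i j. i \<in> W \<Longrightarrow> j \<in> W \<Longrightarrow> i \<noteq> j \<Longrightarrow> R i \<inter> R j = {}"
  shows "card W \<le> card A"
proof -
  obtain g where g: "\<And>i. i \<in> W \<Longrightarrow> g i \<in> A \<and> (\<exists>f\<in>R i. cr (g i) f)"
    using crossed by metis
  have "inj_on g W"
  proof (rule inj_onI, rule ccontr)
    fix i j assume ij: "i \<in> W" "j \<in> W" "g i = g j" "i \<noteq> j"
    obtain f f' where "f \<in> R i" "f' \<in> R j" "cr (g i) f" "cr (g i) f'"
      using g ij by metis
    then show False using cr_unique disj ij by blast
  qed
  moreover have "g ` W \<subseteq> A" using g by auto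
  ultimately show ?thesis using assms(1) card_inj_on_le by blast
qed

end

text \<open>A tree with feet \<open>a\<close>, \<open>b\<close>, \<open>c\<close> and spine
  \<open>p\<close>, \<open>q\<close>, \<open>r\<close>. Spine vertices may coincide: the pair
  becomes a singleton, which is no edge and crosses nothing, so stars and bent tripods share one
  formula.\<close>

abbreviation tripod_edges :: "'a \<Rightarrow> 'a \<Rightarrow> 'a \<Rightarrow> 'a \<Rightarrow> 'a \<Rightarrow> 'a \<Rightarrow> 'a set set" where
  "tripod_edges a b c p q r \<equiv> {{p, a}, {q, b}, {r, c}, {p, q}, {q, r}}"

text \<open>The corners are not interchangeable, as \<open>b\<close> is attached to the middle of
  the spine; a triangle therefore yields one instance for each order of its corners.\<close>

locale tripod_crossings = matching_crossings cr
  for cr :: "'a set \<Rightarrow> 'a set \<Rightarrow> bool" +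
  fixes E :: "'a set set" and a b c :: 'a
  assumes T_distinct: "distinct [a, b, c]"
    and card_E: "e \<in> E \<Longrightarrow> card e = 2"
    and cr_edges: "cr e f \<Longrightarrow> e \<in> E"
    and tripods_cross:
      "\<lbrakk>{p, a} \<in> E; {q, b} \<in> E; {r, c} \<in> E; p = q \<or> {p, q} \<in> E; q = r \<or> {q, r} \<in> E;
        {p', a} \<in> E; {q', b} \<in> E; {r', c} \<in> E; p' = q' \<or> {p', q'} \<in> E; q' = r' \<or> {q', r'} \<in> E;
        {p, q, r} \<inter> {a, b, c} = {}; {p', q', r'} \<inter> {a, b, c} = {};
        {p, q, r} \<inter> {p', q', r'} = {}\<rbrakk> \<Longrightarrow>
       \<exists>e\<in>tripod_edges a b c p q r.
       \<exists>f\<in>tripod_edges a b c p' q' r'. cr e f"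
begin

section \<open>Counting tripods for the possible positions of a triangle\<close>

lemma not_cr_singleton [simp]: "\<not> cr {v} e" "\<not> cr e {v}"
  using cr_edges card_E cr_sym by fastforce+

text \<open>The star at \<open>v\<close> has three edges, one of them must cross the star at each
  \<open>w\<close>, and the stars of distinct \<open>w\<close> share no edge.\<close>

lemma common_neighbours:
  assumes "distinct [a, b, c, v]" and W: "W \<inter> {a, b, c, v} = {}"
    and v: "{v, a} \<in> E" "{v, b} \<in> E" "{v, c} \<in> E"
    and w: "\<And>w. w \<in> W \<Longrightarrow> {w, a} \<in> E \<and> {w, b} \<in> E \<and> {w, c} \<in> E"
  shows "card W \<le> 3"
proof -
  have "card W \<le> card {{v, a}, {v, b}, {v, c}}"
  proof (rule card_le_of_crossed[where R = "\<lambda>w. {{w, a}, {w, b}, {w, c}}"])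
    fix w assume "w \<in> W"
    then have "\<exists>e\<in>tripod_edges a b c v v v.
       \<exists>f\<in>tripod_edges a b c w w w. cr e f"
      using assms by (intro tripods_cross) auto
    then show "\<exists>e\<in>{{v, a}, {v, b}, {v, c}}. \<exists>f\<in>{{w, a}, {w, b}, {w, c}}. cr e f"
      by auto
  qed (use W in \<open>auto simp: doubleton_eq_iff\<close>)
  also have "\<dots> \<le> 3" by (simp add: card_insert_if)
  finally show ?thesis .
qed

text \<open>Here \<open>a\<close>, \<open>b\<close>, \<open>d\<close> is the layer with two corners,
  \<open>c\<close>, \<open>e\<close>, \<open>f\<close> the layer with the third one, and
  \<open>x\<close>, \<open>y\<close>, \<open>z\<close> a further layer next to the first. The four
  tripods with spine \<open>w\<close>, \<open>w\<close>, \<open>d\<close> for \<open>w\<close> in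
  \<open>{d, x, y, z}\<close> share only the edge \<open>{d, c}\<close>. The three edges of the star
  at \<open>e\<close> cannot treat them separately, so one of them crosses \<open>{d, c}\<close>;
  the same holds for \<open>f\<close>, which gives \<open>{d, c}\<close> two partners.\<close>

lemma no_attachment_two:
  assumes dist: "distinct [a, b, c, d, e, f, x, y, z]"
    and E: "\<And>u v. u \<in> {a, b, d} \<Longrightarrow> v \<in> {d, e, f, c, x, y, z} \<Longrightarrow> u \<noteq> v \<Longrightarrow> {u, v} \<in> E"
      "{e, c} \<in> E" "{f, c} \<in> E"
  shows False
proof -
  have "cr {d, c} {g, a} \<or> cr {d, c} {g, b}" if g: "g \<in> {e, f}" for g
  proof (rule ccontr)
    assume neg: "\<not> ?thesis"
    have "card {d, x, y, z} \<le> card {{g, a}, {g, b}, {g, c}}"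
    proof (rule card_le_of_crossed[where R = "\<lambda>w. {{w, a}, {w, b}, {w, d}}"])
      fix w assume w: "w \<in> {d, x, y, z}"
      have "\<exists>s\<in>tripod_edges a b c g g g.
         \<exists>t\<in>tripod_edges a b c w w d. cr s t"
        using g w dist E(2,3) E(1)[of a g] E(1)[of b g] E(1)[of a w] E(1)[of b w] E(1)[of d w]
          E(1)[of d c]
        by (intro tripods_cross) (auto simp: insert_commute)
      moreover have "\<not> cr {g, a} {d, c}" "\<not> cr {g, b} {d, c}" using neg cr_sym by blast+
      moreover have "\<not> cr {g, c} {d, c}" using cr_disjoint by blast
      ultimately show "\<exists>s\<in>{{g, a}, {g, b}, {g, c}}. \<exists>t\<in>{{w, a}, {w, b}, {w, d}}. cr s t"
        by auto
    qed (use dist in \<open>auto simp: doubleton_eq_iff\<close>)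
    moreover have "card {d, x, y, z} = 4" using dist by simp
    moreover have "card {{g, a}, {g, b}, {g, c}} \<le> 3" by (simp add: card_insert_if)
    ultimately show False by simp
  qed
  then have "\<exists>s\<in>{{e, a}, {e, b}}. cr {d, c} s" "\<exists>s\<in>{{f, a}, {f, b}}. cr {d, c} s" by auto
  then obtain s t where st: "cr {d, c} s" "s \<in> {{e, a}, {e, b}}" "cr {d, c} t" "t \<in> {{f, a}, {f, b}}"
    by metis
  have "s = t" using st cr_unique by blast
  then show False using st(2,4) dist by (auto simp: doubleton_eq_iff)
qed

text \<open>The routes from \<open>e\<close> to \<open>c\<close> are indexed by their inner vertex \<open>w\<close>; the index \<open>w = e\<close>
  stands for the edge \<open>{e, c}\<close>, as \<open>{e, e}\<close> is not an edge.\<close>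

lemma no_attachment_one_aux:
  assumes dist: "distinct [a, b, c, d, e, f, x, y, z]"
    and E: "\<And>u v. u \<in> {c, e, f} \<Longrightarrow> v \<in> {a, b, c, d, e, f, x, y, z} \<Longrightarrow> u \<noteq> v \<Longrightarrow> {u, v} \<in> E"
      "{d, a} \<in> E" "{d, b} \<in> E"
    and d_e: "\<exists>s\<in>{{d, a}, {d, b}, {d, c}}. \<exists>t\<in>{{e, a}, {e, b}}. cr s t"
    and d_f: "\<exists>s\<in>{{d, a}, {d, b}, {d, c}}. \<exists>t\<in>{{f, a}, {f, b}}. cr s t"
    and ea_fb: "cr {e, a} {f, b}"
  shows False
proof -
  have fb_ea: "cr {f, b} {e, a}" using ea_fb cr_sym by blast
  \<comment> \<open>The partner of \<open>{e, a}\<close> is \<open>{f, b}\<close>, so the crossing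
    granted by \<open>d_e\<close> has to use \<open>{e, b}\<close>; in the same way the one granted
    by \<open>d_f\<close> has to use \<open>{f, a}\<close>.\<close>
  obtain s where s: "s \<in> {{d, a}, {d, b}, {d, c}}" "cr {e, b} s"
  proof -
    obtain s t where st: "s \<in> {{d, a}, {d, b}, {d, c}}" "t \<in> {{e, a}, {e, b}}" "cr t s"
      using d_e cr_sym by meson
    have "s \<noteq> {f, b}" using st(1) dist by (auto simp: doubleton_eq_iff)
    then have "t \<noteq> {e, a}" using st(3) ea_fb cr_unique by blast
    then show ?thesis using that st by blast
  qed
  obtain s' where s': "s' \<in> {{d, a}, {d, b}, {d, c}}" "cr {f, a} s'"
  proof -
    obtain s t where st: "s \<in> {{d, a}, {d, b}, {d, c}}" "t \<in> {{f, a}, {f, b}}" "cr t s"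
      using d_f cr_sym by meson
    have "s \<noteq> {e, a}" using st(1) dist by (auto simp: doubleton_eq_iff)
    then have "t \<noteq> {f, b}" using st(3) fb_ea cr_unique by blast
    then show ?thesis using that st by blast
  qed
  have route: "{g, a} \<in> E" "{g, b} \<in> E" "{w, c} \<in> E" "g = w \<or> {g, w} \<in> E"
    if "g \<in> {e, f}" "w \<in> {g, x, y, z}" for g w
    using that dist E(1)[of g a] E(1)[of g b] E(1)[of c w] E(1)[of g w] by (auto simp: insert_commute)
  define R where "R g w = {{g, w}, {w, c}}" for g w :: 'a
  have eb: "\<not> cr {e, b} t" if "t \<notin> {{d, a}, {d, b}, {d, c}}" for t
    using s that cr_unique by blast
  \<comment> \<open>The partner of \<open>{f, a}\<close> belongs to the star at \<open>d\<close>,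
    but it is not \<open>{d, a}\<close>, which shares the end \<open>a\<close>.\<close>
  have fa: "\<not> cr t {f, a}" if "t \<notin> {{d, b}, {d, c}}" for t
  proof
    assume "cr t {f, a}"
    then have "s' = t" "t \<inter> {f, a} = {}" using s' cr_unique cr_sym cr_disjoint by blast+
    then show False using s' that by auto
  qed
  have fb: "\<not> cr t {f, b}" if "t \<noteq> {e, a}" for t
    using fb_ea cr_unique cr_sym that by blast
  \<comment> \<open>Two edges cross at most two of the four disjoint routes from \<open>f\<close> to
    \<open>c\<close>, so some route is crossed neither by \<open>{d, a}\<close> nor by
    \<open>{d, e}\<close>.\<close>
  have "\<exists>v\<in>{f, x, y, z}. \<not> (\<exists>s\<in>{{d, a}, {d, e}}. \<exists>t\<in>R f v. cr s t)"
  proof (rule ccontr)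
    assume *: "\<not> ?thesis"
    have "card {f, x, y, z} \<le> card {{d, a}, {d, e}}"
    proof (rule card_le_of_crossed[where R = "R f"])
      fix v assume "v \<in> {f, x, y, z}"
      then show "\<exists>s\<in>{{d, a}, {d, e}}. \<exists>t\<in>R f v. cr s t" using * by blast
    qed (use dist in \<open>auto simp: R_def doubleton_eq_iff\<close>)
    then show False using dist by (simp add: card_insert_if split: if_splits)
  qed
  then obtain v where v: "v \<in> {f, x, y, z}"
    "\<not> (\<exists>s\<in>{{d, a}, {d, e}}. \<exists>t\<in>R f v. cr s t)" by blast
  \<comment> \<open>Compare the tripods with spines \<open>d\<close>, \<open>e\<close>,
    \<open>w\<close> and \<open>f\<close>, \<open>f\<close>, \<open>v\<close>. The edges
    \<open>{e, b}\<close>, \<open>{f, a}\<close>, \<open>{f, b}\<close> have their partners outside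
    the opposite tripod, and \<open>v\<close> was chosen against \<open>{d, a}\<close> and
    \<open>{d, e}\<close>. What remains is that the two edges of the route of \<open>v\<close> meet
    at least three disjoint routes from \<open>e\<close>.\<close>
  have "card ({e, x, y, z} - {v}) \<le> card (R f v)"
  proof (rule card_le_of_crossed[where R = "R e"])
    fix w assume w: "w \<in> {e, x, y, z} - {v}"
    then have wv: "w \<notin> {a, b, c, d, f}" "v \<notin> {a, b, c, d, e}" using v(1) dist by auto
    have E': "{d, e} \<in> E" "{e, b} \<in> E" "{w, c} \<in> E" "e = w \<or> {e, w} \<in> E"
      "{f, a} \<in> E" "{f, b} \<in> E" "{v, c} \<in> E" "f = v \<or> {f, v} \<in> E"
      using route[of e w] route[of f v] w v(1) E(1)[of e d] dist by (auto simp: insert_commute)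
    have disj: "{d, e, w} \<inter> {a, b, c} = {}" "{f, f, v} \<inter> {a, b, c} = {}" "{d, e, w} \<inter> {f, f, v} = {}"
      using w wv v(1) dist by auto
    have "\<exists>s\<in>tripod_edges a b c d e w.
       \<exists>t\<in>tripod_edges a b c f f v. cr s t"
      by (rule tripods_cross) (use E' E(2) disj in simp_all)
    then obtain s t where st: "s \<in> tripod_edges a b c d e w"
       "t \<in> tripod_edges a b c f f v" "cr s t" by blast
    have "t \<noteq> {f, f}" using st(3) by auto
    moreover have "t \<noteq> {f, a}"
    proof
      assume "t = {f, a}"
      then have "d \<in> s" "a \<notin> s" "e \<notin> s" using fa[of s] st(3) dist by auto
      then show False using st(1) wv dist by auto
    qed
    moreover have "t \<noteq> {f, b}"
    proof
      assume "t = {f, b}"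
      then have "a \<in> s" "d \<notin> s" using fb[of s] st(3) dist by auto
      then show False using st(1) wv dist by auto
    qed
    ultimately have t: "t \<in> R f v" using st(2) by (auto simp: R_def)
    have "s \<noteq> {e, b}"
    proof
      assume "s = {e, b}"
      then have "d \<in> t" using eb[of t] st(3) by blast
      then show False using t wv dist by (auto simp: R_def)
    qed
    moreover have "s \<notin> {{d, a}, {d, e}}" using v(2) t st(3) by blast
    ultimately have "s \<in> R e w" using st(1) by (auto simp: R_def)
    then show "\<exists>t\<in>R f v. \<exists>s\<in>R e w. cr t s" using t st(3) cr_sym by blast
  qed (use dist in \<open>auto simp: R_def doubleton_eq_iff\<close>)
  moreover have "card (R f v) \<le> 2" by (simp add: R_def card_insert_if)
  moreover have "card ({e, x, y, z} - {v}) \<ge> 3"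
    using dist card_Diff_singleton_if[of "{e, x, y, z}" v] by (simp split: if_splits)
  ultimately show False by simp
qed

text \<open>The further layer \<open>x\<close>, \<open>y\<close>, \<open>z\<close> is now next to
  the layer \<open>c\<close>, \<open>e\<close>, \<open>f\<close> of the single corner, so
  \<open>e\<close> and \<open>f\<close> each reach \<open>c\<close> by four routes without common
  edges. The star at \<open>d\<close> cannot cross all four, hence it crosses a leg of
  \<open>e\<close> to \<open>a\<close> or \<open>b\<close>, and likewise one of \<open>f\<close>. If
  no leg of \<open>e\<close> crosses a leg of \<open>f\<close>, the routes through \<open>x\<close>,
  \<open>y\<close>, \<open>z\<close> have to cross one another too often at the edges ending in
  \<open>c\<close>; otherwise \<open>no_attachment_one_aux\<close> applies.\<close>

lemma no_attachment_one:
  assumes dist: "distinct [a, b, c, d, e, f, x, y, z]"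
    and E: "\<And>u v. u \<in> {c, e, f} \<Longrightarrow> v \<in> {a, b, c, d, e, f, x, y, z} \<Longrightarrow> u \<noteq> v \<Longrightarrow> {u, v} \<in> E"
      "{d, a} \<in> E" "{d, b} \<in> E"
  shows False
proof -
  have route: "{g, a} \<in> E" "{g, b} \<in> E" "{w, c} \<in> E" "g = w \<or> {g, w} \<in> E"
    if "g \<in> {e, f}" "w \<in> {g, x, y, z}" for g w
    using that dist E(1)[of g a] E(1)[of g b] E(1)[of c w] E(1)[of g w] by (auto simp: insert_commute)
  define R where "R g w = {{g, w}, {w, c}}" for g w :: 'a
  have R_disj: "R g w \<inter> R g w' = {}"
    if "g \<in> {e, f}" "w \<in> {g, x, y, z}" "w' \<in> {g, x, y, z}" "w \<noteq> w'" for g w w'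
    using that dist by (auto simp: R_def doubleton_eq_iff)
  have d: "\<exists>s\<in>{{d, a}, {d, b}, {d, c}}. \<exists>t\<in>{{g, a}, {g, b}}. cr s t" if g: "g \<in> {e, f}" for g
  proof (rule ccontr)
    assume neg: "\<not> ?thesis"
    have "card {g, x, y, z} \<le> card {{d, a}, {d, b}, {d, c}}"
    proof (rule card_le_of_crossed[where R = "R g"])
      fix w assume w: "w \<in> {g, x, y, z}"
      have "\<exists>s\<in>tripod_edges a b c d d d.
         \<exists>t\<in>tripod_edges a b c g g w. cr s t"
        using g w dist E(2,3) E(1)[of g a] E(1)[of g b] E(1)[of c w] E(1)[of g w] E(1)[of c d]
        by (intro tripods_cross) (auto simp: insert_commute)
      then show "\<exists>s\<in>{{d, a}, {d, b}, {d, c}}. \<exists>t\<in>R g w. cr s t"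
        using neg by (auto simp: R_def)
    qed (use R_disj[OF g] in auto)
    moreover have "card {g, x, y, z} = 4" using dist g by auto
    moreover have "card {{d, a}, {d, b}, {d, c}} \<le> 3" by (simp add: card_insert_if)
    ultimately show False by simp
  qed
  have "cr {e, a} {f, b} \<or> cr {f, a} {e, b}"
  proof (rule ccontr)
    assume neg: "\<not> ?thesis"
    \<comment> \<open>The routes from \<open>h\<close> that no leg of \<open>g\<close> crosses. One
      of the two legs is spent on the star at \<open>d\<close>, so at most one of the four routes is
      lost.\<close>
    define good where "good g h = {w \<in> {h, x, y, z}. \<not> (\<exists>s\<in>{{g, a}, {g, b}}. \<exists>t\<in>R h w. cr s t)}"
      for g h
    have good3: "3 \<le> card (good g h)" if gh: "(g, h) \<in> {(e, f), (f, e)}" for g h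
    proof -
      obtain s t where st: "s \<in> {{d, a}, {d, b}, {d, c}}" "t \<in> {{g, a}, {g, b}}" "cr t s"
        using d[of g] gh cr_sym by blast
      have "card ({h, x, y, z} - good g h) \<le> card ({{g, a}, {g, b}} - {t})"
      proof (rule card_le_of_crossed[where R = "R h"])
        fix w assume w: "w \<in> {h, x, y, z} - good g h"
        then obtain s' t' where st': "s' \<in> {{g, a}, {g, b}}" "t' \<in> R h w" "cr s' t'"
          by (auto simp: good_def)
        have "d \<in> s" "\<forall>r\<in>R h w. d \<notin> r" using st(1) w gh dist by (auto simp: R_def)
        then have "s \<notin> R h w" by blast
        then have "s' \<noteq> t" using st' st(3) cr_unique by blast
        then show "\<exists>s\<in>{{g, a}, {g, b}} - {t}. \<exists>t\<in>R h w. cr s t" using st' by blast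
      qed (use R_disj[of h] gh in auto)
      also have "\<dots> \<le> 1" using st(2) by (auto simp: card_insert_if)
      finally have "card ({h, x, y, z} - good g h) \<le> 1" .
      moreover have "card {h, x, y, z} = 4" using dist gh by auto
      moreover have "card {h, x, y, z} - card (good g h) \<le> card ({h, x, y, z} - good g h)"
        by (rule diff_card_le_card_Diff) (simp add: good_def)
      ultimately show ?thesis by linarith
    qed
    \<comment> \<open>Two legs do not cross, by \<open>neg\<close> or because they share a foot, and
      good routes are not crossed by the opposite legs. Only a crossing between the two routes is
      left.\<close>
    have routes: "\<exists>s\<in>R g w. \<exists>t\<in>R h v. cr s t"
      if gh: "(g, h) \<in> {(e, f), (f, e)}" and w: "w \<in> good h g" and v: "v \<in> good g h" and "w \<noteq> v"
      for g h v w
    proof -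
      have wv: "w \<in> {g, x, y, z}" "v \<in> {h, x, y, z}" using w v by (auto simp: good_def)
      have "g \<in> {e, f}" "h \<in> {e, f}" "g \<noteq> h" using gh dist by auto
      then have E': "{g, a} \<in> E" "{g, b} \<in> E" "{w, c} \<in> E" "g = w \<or> {g, w} \<in> E"
        "{h, a} \<in> E" "{h, b} \<in> E" "{v, c} \<in> E" "h = v \<or> {h, v} \<in> E"
        using route[of g w] route[of h v] wv by blast+
      have disj: "{g, g, w} \<inter> {a, b, c} = {}" "{h, h, v} \<inter> {a, b, c} = {}" "{g, g, w} \<inter> {h, h, v} = {}"
        using \<open>g \<in> {e, f}\<close> \<open>h \<in> {e, f}\<close> \<open>g \<noteq> h\<close> wv \<open>w \<noteq> v\<close> dist by auto
      have "\<exists>s\<in>tripod_edges a b c g g w.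
         \<exists>t\<in>tripod_edges a b c h h v. cr s t"
        by (rule tripods_cross) (use E' disj in simp_all)
      then obtain s t where st: "s \<in> {{g, a}, {g, b}} \<union> R g w" "t \<in> {{h, a}, {h, b}} \<union> R h v" "cr s t"
        by (auto simp: R_def)
      have "\<not> (s \<in> {{g, a}, {g, b}} \<and> t \<in> R h v)" using v st(3) by (auto simp: good_def)
      moreover have "\<not> (s \<in> R g w \<and> t \<in> {{h, a}, {h, b}})"
        using w cr_sym[OF st(3)] by (auto simp: good_def)
      moreover have "\<not> (s \<in> {{g, a}, {g, b}} \<and> t \<in> {{h, a}, {h, b}})"
        using neg gh st(3) cr_sym[OF st(3)] cr_disjoint[OF st(3)] by auto
      ultimately show ?thesis using st by (metis UnE)
    qed
    \<comment> \<open>The direct route of \<open>h\<close> has the single edge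
      \<open>{h, c}\<close>, yet at least three routes of \<open>g\<close> would have to cross it.
      The bound 2 also counts the singleton \<open>{h, h}\<close>.\<close>
    have no_direct: "h \<notin> good g h" if gh: "(g, h) \<in> {(e, f), (f, e)}" for g h
    proof
      assume h: "h \<in> good g h"
      have "card (good h g) \<le> card (R h h)"
      proof (rule card_le_of_crossed[where R = "R g"])
        fix w assume w: "w \<in> good h g"
        then have "w \<noteq> h" using gh dist by (auto simp: good_def)
        then show "\<exists>s\<in>R h h. \<exists>t\<in>R g w. cr s t" using routes[OF gh w h] cr_sym by blast
      next
        show "finite (R h h)" by (simp add: R_def)
      qed (use gh R_disj[of g] in \<open>auto simp: good_def\<close>)
      also have "\<dots> \<le> 2" by (simp add: R_def card_insert_if)
      finally show False using good3[of h g] gh by auto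
    qed
    have good: "good g h = {x, y, z}" if gh: "(g, h) \<in> {(e, f), (f, e)}" for g h
    proof (rule card_subset_eq)
      show "good g h \<subseteq> {x, y, z}" using no_direct[OF gh] by (auto simp: good_def)
      then have "card (good g h) \<le> card {x, y, z}" by (intro card_mono) auto
      then show "card (good g h) = card {x, y, z}" using good3[OF gh] dist by simp
    qed simp
    \<comment> \<open>The route of \<open>g\<close> through \<open>x\<close> crosses the routes of
      \<open>h\<close> through \<open>y\<close> and through \<open>z\<close>. The edge
      \<open>{g, x}\<close> can serve only one of them, and \<open>{x, c}\<close> cannot cross
      another edge at \<open>c\<close>. Exchanging \<open>e\<close> and \<open>f\<close> then gives
      \<open>{x, c}\<close> a partner at each of them.\<close>
    have cx: "\<exists>t\<in>{{h, y}, {h, z}}. cr {x, c} t" if gh: "(g, h) \<in> {(e, f), (f, e)}" for g h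
    proof (rule ccontr)
      assume neg: "\<not> ?thesis"
      have "card {y, z} \<le> card {{g, x}}"
      proof (rule card_le_of_crossed[where R = "R h"])
        fix v assume v: "v \<in> {y, z}"
        then obtain s t where st: "s \<in> R g x" "t \<in> R h v" "cr s t"
          using routes[OF gh, of x v] good[of g h] good[of h g] gh dist by auto
        have "s \<noteq> {x, c}"
        proof
          assume "s = {x, c}"
          moreover have "t \<noteq> {v, c}" using cr_disjoint[OF st(3)] \<open>s = {x, c}\<close> by auto
          ultimately show False using st neg v by (auto simp: R_def)
        qed
        then show "\<exists>s\<in>{{g, x}}. \<exists>t\<in>R h v. cr s t" using st by (auto simp: R_def)
      qed (use R_disj[of h] gh in auto)
      then show False using dist by simp
    qed
    obtain s t where "s \<in> {{f, y}, {f, z}}" "cr {x, c} s" "t \<in> {{e, y}, {e, z}}" "cr {x, c} t"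
      using cx[of e f] cx[of f e] by blast
    then show False using cr_unique dist by (auto simp: doubleton_eq_iff)
  qed
  then show False
  proof
    assume ef: "cr {e, a} {f, b}"
    show False by (rule no_attachment_one_aux[OF dist E d[of e] d[of f] ef]) blast+
  next
    assume fe: "cr {f, a} {e, b}"
    have "distinct [a, b, c, d, f, e, x, y, z]" using dist by auto
    moreover have "{u, v} \<in> E" if "u \<in> {c, f, e}" "v \<in> {a, b, c, d, f, e, x, y, z}" "u \<noteq> v" for u v
      by (rule E(1)) (use that in blast)+
    ultimately show False
      by (rule no_attachment_one_aux[OF _ _ E(2,3) d[of f] d[of e] fe]) blast+
  qed
qed

end

section \<open>Theta curves in the plane\<close>

text \<open>The chord \<open>c\<close> halves the disc bounded by \<open>c1\<close> and
  \<open>c2\<close>, and \<open>Y\<close> lies in one half. The half at \<open>c2\<close> is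
  impossible: its closure meets \<open>c1\<close> only in \<open>a\<close> and \<open>b\<close>,
  while \<open>Y\<close> accumulates at the inner point \<open>s\<close> of
  \<open>c1\<close>.\<close>

lemma theta_side:
  fixes c1 c2 c :: "real \<Rightarrow> complex"
  assumes c1: "arc c1" "pathstart c1 = a" "pathfinish c1 = b"
    and c2: "arc c2" "pathstart c2 = a" "pathfinish c2 = b"
    and c: "arc c" "pathstart c = a" "pathfinish c = b"
    and c1c2: "path_image c1 \<inter> path_image c2 = {a, b}"
    and c1c: "path_image c1 \<inter> path_image c = {a, b}"
    and c2c: "path_image c2 \<inter> path_image c = {a, b}"
    and c_inside: "path_image c \<inter> inside (path_image c1 \<union> path_image c2) \<noteq> {}"
    and Y: "connected Y" "Y \<subseteq> inside (path_image c1 \<union> path_image c2)" "Y \<inter> path_image c = {}"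
    and s: "s \<in> closure Y" "s \<in> path_image c1" "s \<notin> {a, b}"
  shows "Y \<subseteq> inside (path_image c1 \<union> path_image c)"
    and "Y \<inter> inside (path_image c2 \<union> path_image c) = {}"
proof -
  let ?I = "inside (path_image c1 \<union> path_image c2)"
  let ?I1 = "inside (path_image c1 \<union> path_image c)"
  let ?I2 = "inside (path_image c2 \<union> path_image c)"
  have "a \<noteq> b" using c1 arc_distinct_ends by blast
  obtain disj: "?I1 \<inter> ?I2 = {}" and cover: "?I1 \<union> ?I2 \<union> (path_image c - {a, b}) = ?I"
    by (rule split_inside_simple_closed_curve[OF arc_imp_simple_path[OF c1(1)] c1(2,3)
          arc_imp_simple_path[OF c2(1)] c2(2,3) arc_imp_simple_path[OF c(1)] c(2,3)
          \<open>a \<noteq> b\<close> c1c2 c1c c2c c_inside])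
  have cl: "closed (path_image c1 \<union> path_image c)" "closed (path_image c2 \<union> path_image c)"
    using c1 c2 c by (auto intro!: closed_Un closed_arc_image)
  have "?I1 \<inter> Y = {} \<or> ?I2 \<inter> Y = {}"
    using Y cover disj cl by (intro connectedD[of Y]) (auto intro: open_inside)
  moreover have "?I1 \<inter> Y \<noteq> {}"
  proof
    assume "?I1 \<inter> Y = {}"
    then have "Y \<subseteq> ?I2" using Y cover by blast
    then have "s \<in> path_image c2 \<union> path_image c \<union> ?I2"
      using s(1) closure_mono closure_inside_subset[OF cl(2)] by blast
    moreover have "?I2 \<subseteq> ?I" using cover by blast
    ultimately show False using s(2,3) c1c2 c1c inside_no_overlap[of "path_image c1 \<union> path_image c2"] by blast
  qed
  ultimately show "Y \<inter> ?I2 = {}" by blast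
  then show "Y \<subseteq> ?I1" using Y cover by blast
qed

text \<open>A connected set with more than one point has no isolated points, and removing finitely
  many points keeps all limit points.\<close>

lemma endpoints_in_closure_arc_interior:
  fixes g :: "real \<Rightarrow> 'a::real_normed_vector"
  assumes "arc g"
  shows "{pathstart g, pathfinish g} \<subseteq> closure (path_image g - {pathstart g, pathfinish g})"
proof -
  have "x islimpt path_image g - {pathstart g, pathfinish g}" if "x \<in> path_image g" for x
  proof -
    have "x islimpt path_image g"
    proof (rule connected_imp_perfect)
      show "connected (path_image g)" using assms by (simp add: connected_arc_image)
      show "path_image g \<noteq> {y}" for y
        using arc_distinct_ends[OF assms] pathstart_in_path_image[of g] pathfinish_in_path_image[of g]
        by force
    qed (rule that)
    moreover have "path_image g = {pathstart g, pathfinish g} \<union> (path_image g - {pathstart g, pathfinish g})"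
      by auto
    ultimately show ?thesis by (metis finite.emptyI finite_insert islimpt_Un_finite)
  qed
  then show ?thesis by (auto simp: closure_def)
qed

text \<open>An arc \<open>p\<close> in \<open>X\<close> from \<open>a\<close> to \<open>b\<close>
  and an arc \<open>k\<close> in \<open>X\<close> from \<open>c\<close> to a point \<open>m\<close>
  of \<open>p\<close> cut the disc into three parts, each of which is out of reach of one corner.
  \<open>Y\<close> lies in one part and accumulates at all corners. The two path-connected sets for
  \<open>X\<close> ensure that \<open>p\<close> avoids \<open>c\<close> and that \<open>k\<close>
  avoids \<open>a\<close> and \<open>b\<close>.\<close>

lemma no_disjoint_tripods:
  fixes ab bc ca :: "real \<Rightarrow> complex"
  assumes ab: "arc ab" "pathstart ab = a" "pathfinish ab = b"
    and bc: "arc bc" "pathstart bc = b" "pathfinish bc = c"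
    and ca: "arc ca" "pathstart ca = c" "pathfinish ca = a"
    and meets: "path_image ab \<inter> path_image bc = {b}" "path_image bc \<inter> path_image ca = {c}"
      "path_image ca \<inter> path_image ab = {a}"
    and J: "J = path_image ab \<union> path_image bc \<union> path_image ca"
    and X: "X \<subseteq> inside J" "path_connected (X \<union> {a, b})" "path_connected (X \<union> {c})" "X \<noteq> {}"
    and Y: "Y \<subseteq> inside J" "connected Y" "{a, b, c} \<subseteq> closure Y"
    and disj: "X \<inter> Y = {}"
  shows False
proof -
  have abc: "a \<noteq> b" "b \<noteq> c" "c \<noteq> a" 
    using arc_distinct_ends[OF ab(1)] arc_distinct_ends[OF bc(1)] arc_distinct_ends[OF ca(1)] ab bc ca
    by auto
  have ends: "a \<in> path_image ab" "b \<in> path_image ab" "b \<in> path_image bc" "c \<in> path_image bc"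
    "c \<in> path_image ca" "a \<in> path_image ca"
    using pathstart_in_path_image[of ab] pathfinish_in_path_image[of ab]
      pathstart_in_path_image[of bc] pathfinish_in_path_image[of bc]
      pathstart_in_path_image[of ca] pathfinish_in_path_image[of ca] ab bc ca by simp_all
  have JX: "J \<inter> X = {}" "J \<inter> Y = {}" using X(1) Y(1) inside_no_overlap by blast+
  obtain p where p: "arc p" "path_image p \<subseteq> X \<union> {a, b}" "pathstart p = a" "pathfinish p = b"
    using X(2) abc unfolding path_connected_arcwise by (metis UnI2 insertCI)
  have pab: "a \<in> path_image p" "b \<in> path_image p"
    using pathstart_in_path_image[of p] pathfinish_in_path_image[of p] p by simp_all
  have pX: "path_image p \<inter> X \<noteq> {}"
  proof
    assume "path_image p \<inter> X = {}"
    then have *: "path_image p - {pathstart p, pathfinish p} = {}" using p by blast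
    show False using endpoints_in_closure_arc_interior[OF p(1)] unfolding * by simp
  qed
  define acb where "acb = reversepath ca +++ reversepath bc"
  have acb: "arc acb" "pathstart acb = a" "pathfinish acb = b" "path_image acb = path_image bc \<union> path_image ca"
    unfolding acb_def using bc ca meets
    by (auto simp: arc_join_eq arc_reversepath path_image_join)
  obtain x where x: "x \<in> path_image p" "x \<in> X" using pX by blast
  then have "c \<noteq> x" using JX ends J by blast
  then obtain k0 where k0: "arc k0" "path_image k0 \<subseteq> X \<union> {c}" "pathstart k0 = c" "pathfinish k0 = x"
    using X(3) x unfolding path_connected_arcwise by (metis UnI1 UnI2 insertCI)
  have cp: "c \<notin> path_image p" using p(2) abc JX ends J by blast
  obtain k m where k: "arc k" "pathstart k = c" "pathfinish k = m" "path_image k \<subseteq> X \<union> {c}"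
    "path_image k \<inter> path_image p = {m}"
  proof -
    have "closed (path_image p)" using p by (simp add: closed_arc_image)
    have "path k0" using k0 by (simp add: arc_imp_path)
    have start: "pathstart k0 \<in> - path_image p" using k0 cp by auto
    have "pathfinish k0 \<notin> - path_image p" using k0 x by auto
    then have "\<exists>u. 0 \<le> u \<and> u \<le> 1 \<and> (\<forall>z. 0 \<le> z \<and> z < u \<longrightarrow> k0 z \<in> interior (- path_image p)) \<and>
      k0 u \<notin> interior (- path_image p)"
      by (rule subpath_to_frontier_explicit[OF \<open>path k0\<close>]) auto
    then obtain u where u: "0 \<le> u" "u \<le> 1" "\<And>z. 0 \<le> z \<and> z < u \<Longrightarrow> k0 z \<in> interior (- path_image p)"
      "k0 u \<notin> interior (- path_image p)" by blast
    have int: "interior (- path_image p) = - path_image p"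
      using \<open>closed (path_image p)\<close> by (simp add: open_Compl interior_open)
    have "u \<noteq> 0" using u(4) int start by (metis pathstart_def)
    show ?thesis
    proof (rule that[of "subpath 0 u k0" "k0 u"])
      show "arc (subpath 0 u k0)" using u \<open>u \<noteq> 0\<close> k0(1) by (intro arc_subpath_arc) auto
      show "path_image (subpath 0 u k0) \<subseteq> X \<union> {c}"
        using k0(2) path_image_subpath_subset[of 0 u k0] u by auto
      show "path_image (subpath 0 u k0) \<inter> path_image p = {k0 u}"
        using u int by (force simp: path_image_subpath)
    qed (use k0(3) in \<open>simp_all add: pathstart_def subpath_def pathfinish_def\<close>)
  qed
  have m: "m \<in> path_image p" "m \<in> X" "m \<notin> {a, b, c}" "m \<notin> J"
  proof -
    have "m \<in> path_image k" "m \<in> path_image p" using k(5) by blast+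
    moreover from this have "m \<noteq> c" using cp by blast
    ultimately show "m \<in> path_image p" "m \<in> X" using k(4) by blast+
    then show "m \<notin> {a, b, c}" "m \<notin> J" using JX J ends by blast+
  qed
  have ca_ab: "c \<notin> path_image ab" "b \<notin> path_image ca" "a \<notin> path_image bc"
    using meets ends abc by blast+
  have "J \<inter> path_image p \<subseteq> {a, b}" using p(2) JX(1) by blast
  moreover have "a \<in> J" "b \<in> J" using J ends by auto
  ultimately have p_J: "path_image p \<inter> J = {a, b}" using pab by auto
  have "path_image acb \<inter> path_image ab = {a, b}"
    unfolding acb(4) Int_Un_distrib2 meets(2,3) using meets(1) by auto
  moreover have "path_image acb \<inter> path_image p = {a, b}" "path_image ab \<inter> path_image p = {a, b}"
  proof -
    have "path_image acb \<subseteq> J" "path_image ab \<subseteq> J" "{a, b} \<subseteq> path_image acb" "{a, b} \<subseteq> path_image ab"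
      using J acb(4) ends by auto
    then show "path_image acb \<inter> path_image p = {a, b}" "path_image ab \<inter> path_image p = {a, b}"
      using p_J by auto
  qed
  ultimately have theta: "path_image acb \<inter> path_image ab = {a, b}"
    "path_image acb \<inter> path_image p = {a, b}" "path_image ab \<inter> path_image p = {a, b}" .
  have inJ: "inside (path_image acb \<union> path_image ab) = inside J"
    by (simp add: J acb Un_ac)
  have p_in: "path_image p \<inter> inside (path_image acb \<union> path_image ab) \<noteq> {}"
    using pX X inJ by blast
  have c: "c \<in> path_image acb" "c \<notin> {a, b}" using acb(4) ends abc by auto
  note theta_p = theta_side(1)[OF acb(1-3) ab p(1,3,4) theta p_in, unfolded inJ]
  have "Y \<inter> path_image p = {}" using p(2) disj JX J ends by blast
  moreover have "c \<in> closure Y" using Y(3) by simp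
  ultimately have Y_sub: "Y \<subseteq> inside (path_image acb \<union> path_image p)"
    using theta_p Y(1,2) c by metis
  \<comment> \<open>\<open>theta_side\<close> applies to the open arc \<open>K\<close> as it does to
    \<open>Y\<close>: both accumulate at \<open>c\<close>, so both lie on the same side of
    \<open>p\<close>.\<close>
  define K where "K = path_image k - {c, m}"
  have "connected K" "c \<in> closure K"
    using k endpoints_in_closure_arc_interior[OF k(1)]
      connected_simple_path_endless[OF arc_imp_simple_path[OF k(1)]] by (auto simp: K_def)
  moreover have "K \<inter> path_image p = {}" using k(5) unfolding K_def by blast
  moreover have "K \<subseteq> inside J" using k(4) X(1) unfolding K_def by blast
  ultimately have K_sub: "K \<subseteq> inside (path_image acb \<union> path_image p)"
    using theta_p c by metis
  obtain t where t: "0 \<le> t" "t \<le> 1" "p t = m" using m(1) by (auto simp: path_image_def)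
  have t01: "t \<noteq> 0" "t \<noteq> 1" using t m(3) p by (auto simp: pathstart_def pathfinish_def)
  define pa where "pa = subpath 0 t p"
  define pb where "pb = subpath 1 t p"
  have pa: "arc pa" "pathstart pa = a" "pathfinish pa = m" "path_image pa = p ` {0..t}"
    and pb: "arc pb" "pathstart pb = b" "pathfinish pb = m" "path_image pb = p ` {t..1}"
    using arc_subpath_arc[OF p(1), of 0 t] arc_subpath_arc[OF p(1), of 1 t] t t01 p(3,4)
    by (simp_all add: pa_def pb_def path_image_subpath)
      (simp_all add: pathstart_def pathfinish_def subpath_def)
  have inj: "inj_on p {0..1}" using p(1) by (simp add: arc_def)
  have pab_Un: "path_image pa \<union> path_image pb = path_image p"
  proof -
    have "{0..t} \<union> {t..1} = {0..1}" using t by auto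
    then show ?thesis unfolding pa(4) pb(4) path_image_def[of p] image_Un[symmetric] by simp
  qed
  have pab_Int: "path_image pa \<inter> path_image pb = {m}"
  proof -
    have "p ` {0..t} \<inter> p ` {t..1} = p ` ({0..t} \<inter> {t..1})"
      using inj t by (intro inj_on_image_Int[symmetric, of p "{0..1}"]) auto
    then show ?thesis using t by (simp add: pa pb Int_atLeastAtMost)
  qed
  have pab_ends: "a \<in> path_image pa" "b \<in> path_image pb"
    using pathstart_in_path_image[of pa] pathstart_in_path_image[of pb] pa pb by simp_all
  then have pab_not: "b \<notin> path_image pa" "a \<notin> path_image pb" using pab_Int m(3) by auto
  have p_parts: "path_image ca \<inter> path_image pa = {a}" "path_image bc \<inter> path_image pb = {b}"
    "path_image ca \<inter> path_image pb = {}" "path_image bc \<inter> path_image pa = {}"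
  proof -
    have "J \<inter> path_image pa \<subseteq> {a, b}" "J \<inter> path_image pb \<subseteq> {a, b}" using p_J pab_Un by auto
    then have "J \<inter> path_image pa \<subseteq> {a}" "J \<inter> path_image pb \<subseteq> {b}" using pab_not by auto
    moreover have "path_image ca \<subseteq> J" "path_image bc \<subseteq> J" using J by auto
    ultimately show "path_image ca \<inter> path_image pa = {a}" "path_image bc \<inter> path_image pb = {b}"
      "path_image ca \<inter> path_image pb = {}" "path_image bc \<inter> path_image pa = {}"
      using ends ca_ab pab_ends by auto
  qed
  \<comment> \<open>The side of \<open>p\<close> at \<open>c\<close> is again bounded by two arcs
    with common ends, now \<open>c\<close> and \<open>m\<close>, and \<open>k\<close> is a chord of
    it.\<close>
  define da where "da = ca +++ pa"
  define db where "db = reversepath bc +++ pb"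
  have da: "arc da" "pathstart da = c" "pathfinish da = m" "path_image da = path_image ca \<union> path_image pa"
    unfolding da_def using ca pa p_parts(1) by (auto simp: arc_join_eq path_image_join)
  have db: "arc db" "pathstart db = c" "pathfinish db = m" "path_image db = path_image bc \<union> path_image pb"
    unfolding db_def using bc pb p_parts(2)
    by (auto simp: arc_join_eq arc_reversepath path_image_join)
  have "path_image da \<union> path_image db = path_image acb \<union> path_image p"
    using da(4) db(4) acb(4) pab_Un by auto
  then have sub: "Y \<subseteq> inside (path_image da \<union> path_image db)" "K \<subseteq> inside (path_image da \<union> path_image db)"
    using Y_sub K_sub by simp_all
  have dadb: "path_image da \<inter> path_image db = {c, m}"
    unfolding da(4) db(4) Int_Un_distrib Int_Un_distrib2 using meets(2) pab_Int p_parts(3,4) by auto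
  have k_ends: "c \<in> path_image k" "m \<in> path_image k"
    using pathstart_in_path_image[of k] pathfinish_in_path_image[of k] k by simp_all
  have kJ: "path_image k \<inter> J = {c}"
  proof -
    have "path_image k \<inter> J \<subseteq> {c}" using k(4) JX(1) by auto
    moreover have "c \<in> J" using J ends by auto
    ultimately show ?thesis using k_ends(1) by auto
  qed
  have kda: "path_image da \<inter> path_image k = {c, m}" and kdb: "path_image db \<inter> path_image k = {c, m}"
  proof -
    have "path_image k \<inter> path_image ca = {c}" "path_image k \<inter> path_image bc = {c}"
      using kJ J ends by auto
    moreover have "path_image k \<inter> path_image pa = {m}" "path_image k \<inter> path_image pb = {m}"
      using k(5) pab_Un pab_Int by auto
    ultimately show "path_image da \<inter> path_image k = {c, m}" "path_image db \<inter> path_image k = {c, m}"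
      unfolding da(4) db(4) by auto
  qed
  have "K \<noteq> {}" using \<open>c \<in> closure K\<close> by auto
  then have k_in: "path_image k \<inter> inside (path_image da \<union> path_image db) \<noteq> {}"
    using sub(2) by (auto simp: K_def)
  have Yk: "Y \<inter> path_image k = {}"
  proof -
    have "c \<notin> Y" using JX(2) J ends by auto
    then show ?thesis using k(4) disj by auto
  qed
  have "a \<in> path_image da" "b \<in> path_image db" using da(4) db(4) ends by auto
  moreover have "a \<notin> {c, m}" "b \<notin> {c, m}" using abc m(3) by auto
  moreover have "a \<in> closure Y" "b \<in> closure Y" using Y(3) by auto
  \<comment> \<open>The limit point \<open>a\<close> on \<open>da\<close> keeps \<open>Y\<close> out
    of the half at \<open>db\<close>, and the limit point \<open>b\<close> on \<open>db\<close>
    forces \<open>Y\<close> into it.\<close>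
  ultimately have "Y \<inter> inside (path_image db \<union> path_image k) = {}"
    "Y \<subseteq> inside (path_image db \<union> path_image k)"
    using theta_side(2)[OF da(1-3) db(1-3) k(1-3) dadb kda kdb k_in Y(2) sub(1) Yk, of a]
      theta_side(1)[OF db(1-3) da(1-3) k(1-3) dadb[unfolded Int_commute[of "path_image da"]] kdb kda
        k_in[unfolded Un_commute[of "path_image da"]] Y(2) sub(1)[unfolded Un_commute[of "path_image da"]] Yk, of b]
    by metis+
  then have "Y = {}" by blast
  then show False using Y(3) by simp
qed

section \<open>Arcs and collisions in drawings\<close>

text \<open>The two terms are added, so \<open>u = v\<close> gives the constant path
  \<open>vertex_point u\<close>, and collapsed spines remain paths.\<close>

definition edge_param :: "'a \<Rightarrow> 'a \<Rightarrow> real \<Rightarrow> 'a \<Rightarrow> real" where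
  "edge_param u v t = (\<lambda>w. (if w = u then 1 - t else 0) + (if w = v then t else 0))"

lemma edge_param_0 [simp]: "edge_param u v 0 = vertex_point u"
  and edge_param_1 [simp]: "edge_param u v 1 = vertex_point v"
  by (auto simp: edge_param_def vertex_point_def)

lemma continuous_on_edge_param: "continuous_on S (edge_param u v)"
proof (rule continuous_on_coordinatewise_then_product)
  show "continuous_on S (\<lambda>t. edge_param u v t w)" for w
    by (cases "w = u"; cases "w = v") (auto simp: edge_param_def intro!: continuous_intros)
qed

lemma closed_cell_edge: "closed_cell {u, v} = edge_param u v ` {0..1}"
proof (intro set_eqI iffI)
  fix x assume x: "x \<in> closed_cell {u, v}"
  have x01: "\<And>w. 0 \<le> x w" and x0: "\<And>w. w \<noteq> u \<Longrightarrow> w \<noteq> v \<Longrightarrow> x w = 0"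
    using x by (auto simp: closed_cell_def)
  have "x v \<in> {0..1} \<and> x = edge_param u v (x v)"
  proof (cases "u = v")
    case True
    then have "x v = 1" using x by (simp add: closed_cell_def)
    then show ?thesis using True x0 by (auto simp: edge_param_def fun_eq_iff)
  next
    case False
    then have "x u + x v = 1" using x by (simp add: closed_cell_def)
    then show ?thesis
      using False x0 x01[of u] x01[of v] by (auto simp: edge_param_def fun_eq_iff)
  qed
  then show "x \<in> edge_param u v ` {0..1}" by blast
next
  fix x assume "x \<in> edge_param u v ` {0..1}"
  then show "x \<in> closed_cell {u, v}"
    by (cases "u = v") (auto simp: closed_cell_def edge_param_def)
qed

lemma vertex_point_nonzero [simp]: "vertex_point v w \<noteq> 0 \<longleftrightarrow> w = v"
  by (simp add: vertex_point_def)

lemma vertex_point_in_closed_cell: "finite s \<Longrightarrow> v \<in> s \<Longrightarrow> vertex_point v \<in> closed_cell s"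
  by (auto simp: closed_cell_def vertex_point_def)

lemma support_closed_cell: "x \<in> closed_cell s \<Longrightarrow> {v. x v \<noteq> 0} \<subseteq> s"
  by (auto simp: closed_cell_def)

lemma support_open_cell: "x \<in> open_cell s \<Longrightarrow> {v. x v \<noteq> 0} = s"
  by (force simp: open_cell_def closed_cell_def)

lemma open_cell_subset: "open_cell s \<subseteq> closed_cell s"
  by (auto simp: open_cell_def)

lemma closed_cell_eq_vertex_point:
  assumes "x \<in> closed_cell s" "{w. x w \<noteq> 0} \<subseteq> {v}"
  shows "x = vertex_point v"
proof -
  \<comment> \<open>A sum over an infinite set is 0 by convention, but the coordinates add up to
    1.\<close>
  have s: "finite s"
    using assms(1) by (auto simp: closed_cell_def intro: ccontr)
  have "x w = 0" if "w \<noteq> v" for w using assms(2) that by auto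
  moreover have "x v = 1"
  proof -
    have "1 = (\<Sum>w\<in>s. x w)" using assms(1) by (simp add: closed_cell_def)
    also have "\<dots> = (\<Sum>w\<in>s. if w = v then x v else 0)"
      using \<open>\<And>w. w \<noteq> v \<Longrightarrow> x w = 0\<close> by (intro sum.cong) auto
    also have "\<dots> = (if v \<in> s then x v else 0)" using s by simp
    finally show ?thesis by (auto split: if_splits)
  qed
  ultimately show ?thesis by (auto simp: vertex_point_def)
qed

lemma edge_param_inj: "u \<noteq> v \<Longrightarrow> inj_on (edge_param u v) S"
  by (rule inj_onI) (drule fun_cong[of _ _ v], simp add: edge_param_def)

lemma realization_closed_cell: "e \<in> edges G \<Longrightarrow> closed_cell e \<subseteq> realization G"
  by (auto simp: realization_def)

lemma vertex_point_realization: "v \<in> verts G \<Longrightarrow> vertex_point v \<in> realization G"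
  by (auto simp: realization_def)

lemma realization_mono: "subgraph H G \<Longrightarrow> realization H \<subseteq> realization G"
  by (auto simp: realization_def subgraph_def)

lemma support_realization:
  "simple_graph G \<Longrightarrow> x \<in> realization G \<Longrightarrow> {v. x v \<noteq> 0} \<subseteq> verts G"
  by (auto simp: realization_def simple_graph_def dest!: support_closed_cell)

lemma simple_graph_edgeE:
  assumes "simple_graph G" "e \<in> edges G"
  obtains u v where "e = {u, v}" "u \<noteq> v" "u \<in> verts G" "v \<in> verts G"
  using assms unfolding simple_graph_def by (metis card_2_iff insert_subset)

lemma compact_realization:
  assumes "simple_graph G"
  shows "compact (realization G)"
proof -
  have "finite (edges G)"
    by (rule finite_subset[of _ "Pow (verts G)"]) (use assms in \<open>auto simp: simple_graph_def\<close>)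
  moreover have [intro]: "compact (closed_cell e)" if e: "e \<in> edges G" for e
  proof -
    obtain u v where "e = {u, v}" using assms e by (rule simple_graph_edgeE)
    then show ?thesis
      by (simp add: closed_cell_edge compact_continuous_image continuous_on_edge_param)
  qed
  ultimately show ?thesis
    using assms unfolding realization_def simple_graph_def
    by (intro compact_Un compact_UN finite_imp_compact[OF finite_imageI]) auto
qed

text \<open>The definition of a drawing describes a crossing by its image and leaves the two
  preimages unordered; this assigns the two edges to a given pair of points.\<close>

lemma drawing_collision:
  assumes "drawing G \<phi>" "x \<in> realization G" "y \<in> realization G" "x \<noteq> y" "\<phi> x = \<phi> y"
  obtains e f where "e \<in> edges G" "f \<in> edges G" "e \<noteq> f" "x \<in> open_cell e" "y \<in> open_cell f"
    "{z \<in> realization G. \<phi> z = \<phi> x} = {x, y}"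
proof -
  have "\<phi> x \<in> crossings G \<phi>"
    using assms by (auto simp: crossings_def drawing_def)
  moreover have "\<forall>p\<in>crossings G \<phi>. \<exists>e\<in>edges G. \<exists>f\<in>edges G. e \<noteq> f \<and>
          (\<exists>x\<in>open_cell e. \<exists>y\<in>open_cell f. {z \<in> realization G. \<phi> z = p} = {x, y}) \<and>
          transversal_at \<phi> e f p"
    using assms(1) unfolding drawing_def by (elim conjE)
  ultimately obtain e f x' y' where ef: "e \<in> edges G" "f \<in> edges G" "e \<noteq> f" "x' \<in> open_cell e" "y' \<in> open_cell f"
    and pre: "{z \<in> realization G. \<phi> z = \<phi> x} = {x', y'}"
    by (elim ballE[of _ _ "\<phi> x"] bexE conjE) auto
  have "x \<in> {x', y'}" "y \<in> {x', y'}" using pre assms by auto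
  then consider "x = x'" "y = y'" | "x = y'" "y = x'" using assms(4) by auto
  then show ?thesis
  proof cases
    case 1 then show ?thesis using that ef pre by metis
  next
    case 2 then show ?thesis using that[of f e] ef pre by (metis insert_commute)
  qed
qed

text \<open>Phrased by images of open cells, since this is what a collision of two tripods provides.
  In a drawing the common point is a crossing in which both edges are involved.\<close>

definition crosses :: "'a graph \<Rightarrow> (('a \<Rightarrow> real) \<Rightarrow> real ^ 3) \<Rightarrow> 'a set \<Rightarrow> 'a set \<Rightarrow> bool" where
  "crosses G \<phi> e f \<longleftrightarrow> e \<in> edges G \<and> f \<in> edges G \<and> e \<noteq> f \<and> \<phi> ` open_cell e \<inter> \<phi> ` open_cell f \<noteq> {}"

lemma crosses_sym: "crosses G \<phi> e f \<Longrightarrow> crosses G \<phi> f e"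
  by (auto simp: crosses_def)

lemma crosses_involved:
  assumes "drawing G \<phi>" "crosses G \<phi> e f"
  obtains x y where "x \<in> open_cell e" "y \<in> open_cell f" "x \<noteq> y" "\<phi> x = \<phi> y"
    "x \<in> realization G" "y \<in> realization G"
    "involved G \<phi> e (\<phi> x)" "involved G \<phi> f (\<phi> x)"
proof -
  obtain x y where xy: "x \<in> open_cell e" "y \<in> open_cell f" "\<phi> x = \<phi> y" "e \<in> edges G" "f \<in> edges G" "e \<noteq> f"
    using assms(2) by (auto simp: crosses_def)
  have "x \<noteq> y" using xy support_open_cell by metis
  moreover have re: "x \<in> realization G" "y \<in> realization G"
    using xy open_cell_subset realization_closed_cell by blast+
  moreover have "\<phi> x \<in> crossings G \<phi>"
    using re xy \<open>x \<noteq> y\<close> assms(1) by (auto simp: crossings_def drawing_def)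
  then have "involved G \<phi> e (\<phi> x)" "involved G \<phi> f (\<phi> x)"
    using xy(1,2) imageI[OF xy(1), of \<phi>] imageI[OF xy(2), of \<phi>] xy(3) by (simp_all add: involved_def)
  ultimately show ?thesis using that xy by blast
qed

text \<open>Both crossings of \<open>e\<close> are the same point of the sphere. It has only two
  preimages, so the two partners share an inner point.\<close>

lemma crosses_unique:
  assumes "one_drawing G \<phi>" "crosses G \<phi> e f" "crosses G \<phi> e g"
  shows "f = g"
proof -
  have d: "drawing G \<phi>" using assms(1) by (simp add: one_drawing_def)
  obtain x y where xy: "x \<in> open_cell e" "y \<in> open_cell f" "x \<noteq> y" "\<phi> x = \<phi> y"
    "x \<in> realization G" "y \<in> realization G" "involved G \<phi> e (\<phi> x)"
    using crosses_involved[OF d assms(2)] by metis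
  obtain x' z where xz: "x' \<in> open_cell e" "z \<in> open_cell g" "\<phi> x' = \<phi> z"
    "z \<in> realization G" "involved G \<phi> e (\<phi> x')"
    using crosses_involved[OF d assms(3)] by metis
  have "e \<in> edges G" using assms(2) by (simp add: crosses_def)
  then have "\<phi> x' = \<phi> x" using assms(1) xy(7) xz(5) unfolding one_drawing_def by blast
  moreover have "{z \<in> realization G. \<phi> z = \<phi> x} = {x, y}"
    using drawing_collision[OF d xy(5,6,3,4)] by metis
  ultimately have "z \<in> {x, y}" using xz by auto
  moreover have "z \<noteq> x"
    using support_open_cell[OF xy(1)] support_open_cell[OF xz(2)] assms(3) by (auto simp: crosses_def)
  ultimately show ?thesis using support_open_cell[OF xy(2)] support_open_cell[OF xz(2)] by auto
qed

lemma crosses_disjoint: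
  assumes "simple_drawing G \<phi>" "crosses G \<phi> e f"
  shows "e \<inter> f = {}"
proof -
  have d: "drawing G \<phi>" using assms(1) by (simp add: simple_drawing_def)
  have "edges_cross G \<phi> e f"
    using crosses_involved[OF d assms(2)] assms(2) unfolding edges_cross_def crosses_def by metis
  then show ?thesis using assms by (auto simp: simple_drawing_def crosses_def)
qed

text \<open>Inner points of \<open>f\<close> have support \<open>f\<close>, which fills a cell on at
  most two vertices. The bound for \<open>e\<close> admits collapsed spines, for which it is not
  known in advance that they are edges.\<close>

lemma open_cell_support:
  assumes "x \<in> closed_cell e" "x \<in> open_cell f" "card f = 2" "card e \<le> 2" "finite e"
  shows "e = f"
  using support_closed_cell[OF assms(1)] support_open_cell[OF assms(2)] assms(3-5)
  by (metis card_seteq)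

text \<open>\<open>f1\<close>, \<open>f2\<close>, \<open>f3\<close> are legs, run from the spine
  towards the corners and stripped of their last points; \<open>f4\<close> and \<open>f5\<close>
  form the spine. The conclusions are the topological hypotheses of
  \<open>no_disjoint_tripods\<close>.\<close>

lemma tripod_union:
  fixes f1 f2 f3 f4 f5 :: "real \<Rightarrow> 'b::t2_space"
  assumes cont: "continuous_on {0..1} f1" "continuous_on {0..1} f2" "continuous_on {0..1} f3"
      "continuous_on {0..1} f4" "continuous_on {0..1} f5"
    and ends: "f4 0 = f1 0" "f4 1 = f2 0" "f5 0 = f2 0" "f5 1 = f3 0"
    and X: "X = f1 ` {0..<1} \<union> f2 ` {0..<1} \<union> f3 ` {0..<1} \<union> f4 ` {0..1} \<union> f5 ` {0..1}"
  shows "path_connected (X \<union> {f1 1, f2 1})" "path_connected (X \<union> {f3 1})" "connected X"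
    "{f1 1, f2 1, f3 1} \<subseteq> closure X"
proof -
  have half: "path_connected (f ` {0..<1})" if "continuous_on {0..1} f" for f :: "real \<Rightarrow> 'b"
    by (rule path_connected_continuous_image)
      (use that in \<open>auto intro: continuous_on_subset convex_imp_path_connected\<close>)
  have full: "path_connected (f ` {0..1})" if "continuous_on {0..1} f" for f :: "real \<Rightarrow> 'b"
    by (rule path_connected_continuous_image)
      (use that in \<open>auto intro: convex_imp_path_connected\<close>)
  have split: "f ` {0..1} = insert (f 1) (f ` {0..<1})" for f :: "real \<Rightarrow> 'b"
    by (auto simp: image_iff) (metis atLeastLessThan_iff less_eq_real_def)
  have join: "path_connected (A1 \<union> A2 \<union> A3 \<union> f4 ` {0..1} \<union> f5 ` {0..1})"
    if "path_connected A1" "path_connected A2" "path_connected A3" "f1 0 \<in> A1" "f2 0 \<in> A2" "f3 0 \<in> A3"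
    for A1 A2 A3
  proof -
    have "f4 0 \<in> f4 ` {0..1}" "f4 1 \<in> f4 ` {0..1}" "f5 0 \<in> f5 ` {0..1}" "f5 1 \<in> f5 ` {0..1}"
      by auto
    then have "f1 0 \<in> f4 ` {0..1}" "f2 0 \<in> f4 ` {0..1}" "f2 0 \<in> f5 ` {0..1}" "f3 0 \<in> f5 ` {0..1}"
      using ends by simp_all
    then have "path_connected (A1 \<union> f4 ` {0..1} \<union> A2 \<union> f5 ` {0..1} \<union> A3)"
      using that by (intro path_connected_Un full cont) blast+
    then show ?thesis by (simp add: Un_ac)
  qed
  have "f1 0 \<in> f1 ` {0..<1}" "f2 0 \<in> f2 ` {0..<1}" "f3 0 \<in> f3 ` {0..<1}" by auto
  then have "path_connected X"
    unfolding X by (intro join half cont)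
  then show "connected X" by (rule path_connected_imp_connected)
  have "path_connected (f1 ` {0..1} \<union> f2 ` {0..1} \<union> f3 ` {0..<1} \<union> f4 ` {0..1} \<union> f5 ` {0..1})"
    by (intro join half full cont) auto
  moreover have "path_connected (f1 ` {0..<1} \<union> f2 ` {0..<1} \<union> f3 ` {0..1} \<union> f4 ` {0..1} \<union> f5 ` {0..1})"
    by (intro join half full cont) auto
  moreover have "f1 ` {0..1} \<union> f2 ` {0..1} \<union> f3 ` {0..<1} \<union> f4 ` {0..1} \<union> f5 ` {0..1} = X \<union> {f1 1, f2 1}"
    "f1 ` {0..<1} \<union> f2 ` {0..<1} \<union> f3 ` {0..1} \<union> f4 ` {0..1} \<union> f5 ` {0..1} = X \<union> {f3 1}"
    unfolding X split[of f1] split[of f2] split[of f3] by auto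
  ultimately show "path_connected (X \<union> {f1 1, f2 1})" "path_connected (X \<union> {f3 1})" by simp_all
  have "f 1 \<in> closure (f ` {0..<1})" if "continuous_on {0..1} f" for f :: "real \<Rightarrow> 'b"
  proof -
    have "f ` closure {0..<1} \<subseteq> closure (f ` {0..<1})"
      by (rule image_closure_subset) (use that closure_subset[of "f ` {0..<1}"] in auto)
    then show ?thesis by auto
  qed
  then have "f1 1 \<in> closure (f1 ` {0..<1})" "f2 1 \<in> closure (f2 ` {0..<1})" "f3 1 \<in> closure (f3 ` {0..<1})"
    using cont by blast+
  moreover have "f1 ` {0..<1} \<subseteq> X" "f2 ` {0..<1} \<subseteq> X" "f3 ` {0..<1} \<subseteq> X" unfolding X by auto
  ultimately show "{f1 1, f2 1, f3 1} \<subseteq> closure X" using closure_mono by blast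
qed

text \<open>Puncturing the sphere in a point of a face \<open>F\<close> puts everything beyond the
  boundary inside the image of \<open>K\<close>. Relative to the complement of \<open>K\<close> the
  set \<open>F\<close> is open and closed, so a connected set through \<open>P\<close> avoiding
  \<open>K\<close> never enters \<open>F\<close>. The component of \<open>h P\<close> thus pulls
  back into a compact set without \<open>q\<close> and is bounded.\<close>

lemma image_in_inside:
  fixes h :: "real ^ 3 \<Rightarrow> complex"
  assumes hom: "homeomorphism (S2 - {q}) UNIV h g"
    and F: "q \<in> F" "openin (top_of_set S2) F" "closure F \<subseteq> F \<union> K"
    and K: "K \<subseteq> S2" "F \<inter> K = {}"
    and P: "P \<in> S2" "P \<notin> K" "P \<notin> F"
  shows "h P \<in> inside (h ` K)"
proof -
  have gh: "\<And>x. x \<in> S2 - {q} \<Longrightarrow> g (h x) = x" "\<And>y. h (g y) = y" "range g = S2 - {q}"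
    "continuous_on UNIV g" "continuous_on (S2 - {q}) h"
    using hom by (auto simp: homeomorphism_def)
  have Pq: "P \<noteq> q" using P F by auto
  have "q \<notin> K" using F K by auto
  have hP: "h P \<notin> h ` K"
  proof
    assume "h P \<in> h ` K"
    then obtain x where "x \<in> K" "h P = h x" by auto
    moreover have "x \<in> S2 - {q}" using \<open>x \<in> K\<close> K(1) \<open>q \<notin> K\<close> by auto
    ultimately have "P = x" using gh(1)[of P] gh(1)[of x] P(1) Pq by simp
    then show False using P \<open>x \<in> K\<close> by simp
  qed
  define C where "C = connected_component_set (- h ` K) (h P)"
  have C: "connected C" "C \<subseteq> - h ` K" "h P \<in> C"
    using hP by (auto simp: C_def connected_component_subset)
  define C' where "C' = g ` C"
  have C': "connected C'" "P \<in> C'" "C' \<subseteq> S2 - {q}" "C' \<inter> K = {}" "C = h ` C'"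
  proof -
    show "connected C'" unfolding C'_def
      using C(1) gh(4) continuous_on_subset connected_continuous_image by blast
    show "P \<in> C'" using C(3) gh(1)[of P] P(1) Pq by (force simp: C'_def)
    show "C' \<subseteq> S2 - {q}" using gh(3) by (auto simp: C'_def)
    show "C = h ` C'" using gh(2) by (auto simp: C'_def image_image)
    then show "C' \<inter> K = {}" using C(2) by auto
  qed
  obtain U where U: "open U" "F = S2 \<inter> U"
    using F(2) by (auto simp: openin_open)
  have "U \<inter> C' = {} \<or> - closure F \<inter> C' = {}"
  proof (rule connectedD[OF C'(1) U(1)])
    show "open (- closure F)" by (rule open_Compl) (rule closed_closure)
    show "U \<inter> - closure F \<inter> C' = {}" using C'(3) U closure_subset[of F] by blast
    show "C' \<subseteq> U \<union> - closure F" using C'(4) U F(3) by blast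
  qed
  moreover have "P \<in> - closure F" using P F(3) by auto
  ultimately have "U \<inter> C' = {}" using C'(2) by auto
  then have "C' \<subseteq> S2 - U" using C'(3) by auto
  moreover have "compact (h ` (S2 - U))"
    using gh(5) U F(1) by (intro compact_continuous_image continuous_on_subset[OF gh(5)] compact_diff) auto
  ultimately have "bounded C" using C'(5) compact_imp_bounded bounded_subset image_mono by metis
  then show ?thesis using hP by (simp add: inside_def C_def)
qed

lemma face_properties:
  assumes G: "simple_graph G" "continuous_on (realization G) \<phi>" and F: "F \<in> regions G \<phi>"
  shows "openin (top_of_set S2) F" "F \<noteq> {}" "F \<inter> \<phi> ` realization G = {}" "F \<subseteq> S2"
proof -
  have "compact (\<phi> ` realization G)"
    using G compact_realization by (blast intro: compact_continuous_image)
  then have "openin (top_of_set S2) (S2 - \<phi> ` realization G)"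
    by (metis Diff_Int_distrib Int_absorb openin_open_Int open_Compl compact_imp_closed Diff_eq)
  then show "openin (top_of_set S2) F"
    using F locally_connected_sphere locally_connected_open_component unfolding regions_def by blast
  show "F \<noteq> {}" "F \<inter> \<phi> ` realization G = {}" "F \<subseteq> S2"
    using F in_components_subset in_components_nonempty unfolding regions_def by blast+
qed

lemma triangleE:
  assumes "is_triangle T"
  obtains a b c where "distinct [a, b, c]" "verts T = {a, b, c}" "edges T = {{a, b}, {b, c}, {c, a}}"
proof -
  obtain f where T: "simple_graph T" and f: "bij_betw f (verts T) {..<3::nat}"
    and adj: "\<And>u v. u \<in> verts T \<Longrightarrow> v \<in> verts T \<Longrightarrow> {u, v} \<in> edges T \<longleftrightarrow> {f u, f v} \<in> edges (complete_graph 3)"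
    using assms by (auto simp: is_triangle_def isomorphic_def complete_graph_def)
  have adj': "{u, v} \<in> edges T \<longleftrightarrow> u \<noteq> v" if "u \<in> verts T" "v \<in> verts T" for u v
  proof -
    have "f u < 3" "f v < 3" using f that by (auto simp: bij_betw_def)
    moreover have "f u = f v \<longleftrightarrow> u = v" using f that by (auto simp: bij_betw_def inj_on_def)
    ultimately show ?thesis using adj[OF that] by (auto simp: complete_graph_def doubleton_eq_iff)
  qed
  have "card (verts T) = 3" using bij_betw_same_card[OF f] by simp
  then obtain a b c where abc: "verts T = {a, b, c}" "a \<noteq> b" "b \<noteq> c" "a \<noteq> c"
    by (metis card_3_iff)
  have "edges T = {{a, b}, {b, c}, {c, a}}"
  proof
    show "edges T \<subseteq> {{a, b}, {b, c}, {c, a}}"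
    proof
      fix e assume "e \<in> edges T"
      then obtain u v where "e = {u, v}" "u \<noteq> v" "u \<in> verts T" "v \<in> verts T"
        using simple_graph_edgeE[OF T] by metis
      then show "e \<in> {{a, b}, {b, c}, {c, a}}" using abc by (auto simp: insert_commute)
    qed
    show "{{a, b}, {b, c}, {c, a}} \<subseteq> edges T" using adj' abc by auto
  qed
  then show ?thesis using that abc by auto
qed

section \<open>Tripods at a facial triangle\<close>

lemma edge_verts:
  "simple_graph G \<Longrightarrow> {u, v} \<in> edges G \<Longrightarrow> u \<in> verts G"
  "simple_graph G \<Longrightarrow> {u, v} \<in> edges G \<Longrightarrow> v \<in> verts G"
  by (auto simp: simple_graph_def)

text \<open>The legs omit their ends at the corners, so a tripod whose spine is off the triangle has
  no point in common with it.\<close>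

definition tripod_points :: "'a \<Rightarrow> 'a \<Rightarrow> 'a \<Rightarrow> 'a \<Rightarrow> 'a \<Rightarrow> 'a \<Rightarrow> ('a \<Rightarrow> real) set" where
  "tripod_points a b c p q r =
     edge_param p a ` {0..<1} \<union> edge_param q b ` {0..<1} \<union> edge_param r c ` {0..<1} \<union>
     edge_param p q ` {0..1} \<union> edge_param q r ` {0..1}"

lemma tripod_points_cell:
  assumes "x \<in> tripod_points a b c p q r"
  obtains e where "e \<in> tripod_edges a b c p q r" "x \<in> closed_cell e"
  using assms unfolding tripod_points_def closed_cell_edge[symmetric]
  by (fastforce simp: closed_cell_edge)

lemma tripod_points_off_triangle:
  assumes "x \<in> tripod_points a b c p q r" "{p, q, r} \<inter> {a, b, c} = {}"
  obtains v where "v \<in> {p, q, r}" "x v \<noteq> 0"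
proof -
  have "\<exists>v\<in>{p, q, r}. x v \<noteq> 0"
    using assms unfolding tripod_points_def
  proof (elim UnE imageE)
    fix t :: real assume "t \<in> {0..1}" "x = edge_param p q t"
    then show ?thesis by (cases "t = 1"; cases "p = q") (auto simp: edge_param_def)
  next
    fix t :: real assume "t \<in> {0..1}" "x = edge_param q r t"
    then show ?thesis by (cases "t = 1"; cases "q = r") (auto simp: edge_param_def)
  qed (auto simp: edge_param_def)
  then show ?thesis using that by blast
qed

text \<open>Without a crossing the images of the tripods would be disjoint connected sets in a disc
  bounded by the triangle, and both would reach all corners. A puncture inside the face moves the
  picture to the complex plane. Crossings refer to \<open>G\<close>, the graph of which
  \<open>\<phi>\<close> is assumed to be a drawing.\<close>

lemma facial_triangle_tripods_cross:
  fixes G :: "'a graph"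
  assumes G: "simple_graph G" "drawing G \<phi>" and G1: "subgraph G1 G"
    and T: "facial G1 \<phi> T" "distinct [a, b, c]" "verts T = {a, b, c}" "edges T = {{a, b}, {b, c}, {c, a}}"
    and pqr: "{p, a} \<in> edges G1" "{q, b} \<in> edges G1" "{r, c} \<in> edges G1"
      "p = q \<or> {p, q} \<in> edges G1" "q = r \<or> {q, r} \<in> edges G1"
    and pqr': "{p', a} \<in> edges G1" "{q', b} \<in> edges G1" "{r', c} \<in> edges G1"
      "p' = q' \<or> {p', q'} \<in> edges G1" "q' = r' \<or> {q', r'} \<in> edges G1"
    and disj: "{p, q, r} \<inter> {a, b, c} = {}" "{p', q', r'} \<inter> {a, b, c} = {}"
      "{p, q, r} \<inter> {p', q', r'} = {}"
  shows "\<exists>e\<in>edges G1. \<exists>f\<in>edges G1. e \<in> tripod_edges a b c p q r \<and>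
     f \<in> tripod_edges a b c p' q' r' \<and> crosses G \<phi> e f"
proof (rule ccontr)
  assume no_cross: "\<not> ?thesis"
  have sG1: "simple_graph G1" and E1: "edges G1 \<subseteq> edges G"
    using G1 by (auto simp: subgraph_def)
  have real: "realization T \<subseteq> realization G1" "realization G1 \<subseteq> realization G"
    using T(1) G1 by (auto simp: facial_def intro!: realization_mono)
  have contG: "continuous_on (realization G) \<phi>" and \<phi>S2: "\<phi> ` realization G \<subseteq> S2"
    using G(2) by (auto simp: drawing_def)
  have cont: "continuous_on (realization G1) \<phi>" using contG real(2) continuous_on_subset by blast
  obtain F where F: "F \<in> regions G1 \<phi>" "boundary F \<inter> crossings G1 \<phi> = {}" "boundary F = \<phi> ` realization T"
    using T(1) by (auto simp: facial_def faces_def)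
  note Fp = face_properties[OF sG1 cont F(1)]
  have T_cells: "realization T = closed_cell {a, b} \<union> closed_cell {b, c} \<union> closed_cell {c, a}"
    using vertex_point_in_closed_cell[of "{a, b}" a] vertex_point_in_closed_cell[of "{a, b}" b]
      vertex_point_in_closed_cell[of "{b, c}" c]
    unfolding realization_def T(3,4) by auto
  \<comment> \<open>The boundary of a face contains no crossing, so a point of the triangle collides
    with no other point of \<open>G1\<close>. This makes the image of \<open>T\<close> a Jordan
    curve.\<close>
  have T_inj: "x = y" if "x \<in> realization T" "y \<in> realization G1" "\<phi> x = \<phi> y" for x y
  proof (rule ccontr)
    assume "x \<noteq> y"
    moreover have "\<phi> x \<in> S2" using \<phi>S2 that(1) real by blast
    ultimately have "\<phi> x \<in> crossings G1 \<phi>" using that real by (auto simp: crossings_def)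
    moreover have "\<phi> x \<in> boundary F" using F(3) that(1) by blast
    ultimately show False using F(2) by blast
  qed
  obtain q0 where q0: "q0 \<in> F" using Fp(2) by blast
  have q0S: "q0 \<in> S2" using q0 Fp(4) by blast
  have "(S2 - {q0}) homeomorphic (UNIV :: complex set)"
    by (rule homeomorphic_punctured_sphere_affine) (use q0S in auto)
  then obtain h g where hg: "homeomorphism (S2 - {q0}) (UNIV :: complex set) h g"
    unfolding homeomorphic_def by blast
  define \<psi> where "\<psi> = h \<circ> \<phi>"
  have off: "\<phi> x \<in> S2 - {q0}" if "x \<in> realization G1" for x
    using that q0 Fp(3) \<phi>S2 real(2) by blast
  have \<psi>_cont: "continuous_on (realization G1) \<psi>"
    unfolding \<psi>_def
    by (rule continuous_on_compose[OF cont], rule continuous_on_subset[of "S2 - {q0}"])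
      (use hg off in \<open>auto simp: homeomorphism_def\<close>)
  have \<psi>_eq: "\<phi> x = \<phi> y" if "\<psi> x = \<psi> y" "x \<in> realization G1" "y \<in> realization G1" for x y
  proof -
    have "g (h (\<phi> x)) = \<phi> x" "g (h (\<phi> y)) = \<phi> y"
      using hg off[OF that(2)] off[OF that(3)] by (simp_all add: homeomorphism_def)
    moreover have "h (\<phi> x) = h (\<phi> y)" using that(1) by (simp add: \<psi>_def)
    ultimately show ?thesis by metis
  qed
  have \<psi>_inj: "x = y" if "\<psi> x = \<psi> y" "x \<in> realization T" "y \<in> realization G1" for x y
    using T_inj[OF that(2,3)] \<psi>_eq[OF that(1) _ that(3)] that(2) real(1) by auto
  define J where "J = \<psi> ` realization T"
  have inside: "\<psi> x \<in> inside J" if "x \<in> realization G1" "x \<notin> realization T" for x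
  proof -
    have "closure F \<subseteq> F \<union> \<phi> ` realization T" using F(3) by (auto simp: boundary_def)
    moreover have "\<phi> x \<notin> \<phi> ` realization T" using T_inj[OF _ that(1)] that(2) by fastforce
    moreover have "\<phi> ` realization T \<subseteq> S2" "F \<inter> \<phi> ` realization T = {}" "\<phi> x \<notin> F" "\<phi> x \<in> S2"
      using \<phi>S2 real Fp(3) that(1) by blast+
    ultimately have "h (\<phi> x) \<in> inside (h ` \<phi> ` realization T)"
      using image_in_inside[OF hg q0 Fp(1)] by blast
    then show ?thesis by (simp add: \<psi>_def J_def image_comp)
  qed
  have arc: "arc (\<psi> \<circ> edge_param u v)" "path_image (\<psi> \<circ> edge_param u v) = \<psi> ` closed_cell {u, v}"
    "pathstart (\<psi> \<circ> edge_param u v) = \<psi> (vertex_point u)" "pathfinish (\<psi> \<circ> edge_param u v) = \<psi> (vertex_point v)"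
    if "{u, v} \<in> edges T" "u \<noteq> v" for u v
  proof -
    have sub: "edge_param u v ` {0..1} \<subseteq> realization T"
      using realization_closed_cell[OF that(1)] by (simp add: closed_cell_edge)
    have "continuous_on {0..1} (\<psi> \<circ> edge_param u v)"
      using sub real(1) by (intro continuous_on_compose continuous_on_edge_param)
        (blast intro: continuous_on_subset[OF \<psi>_cont])
    moreover have "inj_on (\<psi> \<circ> edge_param u v) {0..1}"
      using sub real(1) \<psi>_inj
      by (intro comp_inj_on edge_param_inj[OF that(2)] inj_onI) blast
    ultimately show "arc (\<psi> \<circ> edge_param u v)" by (simp add: arc_def path_def)
  qed (auto simp: path_image_def closed_cell_edge image_comp pathstart_def pathfinish_def)
  have meet: "\<psi> ` closed_cell {u, v} \<inter> \<psi> ` closed_cell {v, w} = {\<psi> (vertex_point v)}"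
    if "{u, v} \<in> edges T" "{v, w} \<in> edges T" "distinct [u, v, w]" for u v w
  proof -
    have "\<psi> ` closed_cell {u, v} \<inter> \<psi> ` closed_cell {v, w} \<subseteq> {\<psi> (vertex_point v)}"
    proof
      fix z assume "z \<in> \<psi> ` closed_cell {u, v} \<inter> \<psi> ` closed_cell {v, w}"
      then obtain x y where xy: "x \<in> closed_cell {u, v}" "y \<in> closed_cell {v, w}" "z = \<psi> x" "z = \<psi> y" by auto
      then have "x = y"
        using \<psi>_inj realization_closed_cell[OF that(1)] realization_closed_cell[OF that(2)] real(1) by blast
      then have "{w. x w \<noteq> 0} \<subseteq> {v}"
        using support_closed_cell[OF xy(1)] support_closed_cell[OF xy(2)] that(3) by auto
      then show "z \<in> {\<psi> (vertex_point v)}" using closed_cell_eq_vertex_point[OF xy(1)] xy(3) by simp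
    qed
    moreover have "vertex_point v \<in> closed_cell {u, v}" "vertex_point v \<in> closed_cell {v, w}"
      by (auto intro: vertex_point_in_closed_cell)
    ultimately show ?thesis by blast
  qed
  have inG1: "tripod_points a b c p q r \<subseteq> realization G1"
    if "{p, a} \<in> edges G1" "{q, b} \<in> edges G1" "{r, c} \<in> edges G1"
      "p = q \<or> {p, q} \<in> edges G1" "q = r \<or> {q, r} \<in> edges G1" for p q r
  proof
    fix x assume "x \<in> tripod_points a b c p q r"
    then obtain e where e: "e \<in> tripod_edges a b c p q r" "x \<in> closed_cell e"
      by (rule tripod_points_cell)
    have v: "vertex_point v \<in> realization G1" "edge_param v v t = vertex_point v" if "v \<in> {p, q, r}" for v t
    proof -
      have "{p, q, r} \<subseteq> verts G1"
        using edge_verts[OF sG1 \<open>{p, a} \<in> _\<close>] edge_verts[OF sG1 \<open>{q, b} \<in> _\<close>]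
          edge_verts[OF sG1 \<open>{r, c} \<in> _\<close>] by simp
      then have "v \<in> verts G1" using that by blast
      then show "vertex_point v \<in> realization G1" by (rule vertex_point_realization)
    qed (auto simp: edge_param_def vertex_point_def)
    show "x \<in> realization G1"
    proof (cases "e \<in> edges G1")
      case True then show ?thesis using e realization_closed_cell by blast
    next
      case False
      \<comment> \<open>A member of \<open>tripod_edges\<close> that is not an edge is a collapsed
        spine, and its cell is a single vertex point.\<close>
      then have "e = {p, q} \<or> e = {q, r}" using e(1) that(1-3) by blast
      then have "(p = q \<and> e = {p, q}) \<or> (q = r \<and> e = {q, r})" using that(4,5) False by blast
      then obtain v where "v \<in> {p, q, r}" "e = {v, v}" by blast
      then show ?thesis using e(2) v by (auto simp: closed_cell_edge simp del: insert_absorb2)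
    qed
  qed
  have tri: "X \<subseteq> inside J" "path_connected (X \<union> {\<psi> (vertex_point a), \<psi> (vertex_point b)})"
      "path_connected (X \<union> {\<psi> (vertex_point c)})" "X \<noteq> {}" "connected X"
      "{\<psi> (vertex_point a), \<psi> (vertex_point b), \<psi> (vertex_point c)} \<subseteq> closure X"
    if X: "X = \<psi> ` tripod_points a b c p q r" and pqr: "{p, a} \<in> edges G1" "{q, b} \<in> edges G1" "{r, c} \<in> edges G1"
      "p = q \<or> {p, q} \<in> edges G1" "q = r \<or> {q, r} \<in> edges G1" "{p, q, r} \<inter> {a, b, c} = {}" for p q r X
  proof -
    note in1 = inG1[OF pqr(1-5)]
    show "X \<subseteq> inside J"
    proof
      fix z assume "z \<in> X"
      then obtain x where x: "x \<in> tripod_points a b c p q r" "z = \<psi> x" using X by auto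
      obtain v where v: "v \<in> {p, q, r}" "x v \<noteq> 0" using tripod_points_off_triangle[OF x(1) pqr(6)] .
      have "x \<notin> realization T"
        using support_closed_cell[of x] v pqr(6) unfolding T_cells by blast
      then show "z \<in> inside J" using inside x in1 by blast
    qed
    have full: "edge_param u v ` {0..1} \<subseteq> realization G1" if "u \<in> {p, q, r}"
      "edge_param u v ` {0..<1} \<subseteq> tripod_points a b c p q r" "v \<in> verts G1" for u v
    proof
      fix x assume "x \<in> edge_param u v ` {0..1}"
      then obtain t where t: "x = edge_param u v t" "0 \<le> t" "t \<le> 1" by auto
      show "x \<in> realization G1"
      proof (cases "t = 1")
        case True then show ?thesis using t that vertex_point_realization by simp
      next
        case False
        then have "x \<in> edge_param u v ` {0..<1}" using t by simp
        then show ?thesis using that(2) in1 by blast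
      qed
    qed
    have vs: "{a, b, c, q, r} \<subseteq> verts G1"
      using edge_verts[OF sG1 pqr(1)] edge_verts[OF sG1 pqr(2)] edge_verts[OF sG1 pqr(3)] by simp
    have c: "continuous_on {0..1} (\<psi> \<circ> edge_param u v)"
      if "edge_param u v ` {0..1} \<subseteq> realization G1" for u v
      using that by (intro continuous_on_compose continuous_on_edge_param) (blast intro: continuous_on_subset[OF \<psi>_cont])
    have cs: "continuous_on {0..1} (\<psi> \<circ> edge_param p a)" "continuous_on {0..1} (\<psi> \<circ> edge_param q b)"
      "continuous_on {0..1} (\<psi> \<circ> edge_param r c)" "continuous_on {0..1} (\<psi> \<circ> edge_param p q)"
      "continuous_on {0..1} (\<psi> \<circ> edge_param q r)"
      by (intro c full; use vs in \<open>force simp: tripod_points_def\<close>)+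
    have X': "X = (\<psi> \<circ> edge_param p a) ` {0..<1} \<union> (\<psi> \<circ> edge_param q b) ` {0..<1} \<union>
      (\<psi> \<circ> edge_param r c) ` {0..<1} \<union> (\<psi> \<circ> edge_param p q) ` {0..1} \<union> (\<psi> \<circ> edge_param q r) ` {0..1}"
      unfolding X tripod_points_def image_Un image_comp ..
    note tu = tripod_union[OF cs _ _ _ _ X', simplified]
    show "path_connected (X \<union> {\<psi> (vertex_point a), \<psi> (vertex_point b)})"
      "path_connected (X \<union> {\<psi> (vertex_point c)})" "connected X"
      "{\<psi> (vertex_point a), \<psi> (vertex_point b), \<psi> (vertex_point c)} \<subseteq> closure X"
      using tu by auto
    show "X \<noteq> {}" unfolding X' by auto
  qed
  have ne: "a \<noteq> b" "b \<noteq> c" "c \<noteq> a" using T(2) by auto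
  have eT: "{a, b} \<in> edges T" "{b, c} \<in> edges T" "{c, a} \<in> edges T" using T(4) by auto
  define X where "X = \<psi> ` tripod_points a b c p q r"
  define Y where "Y = \<psi> ` tripod_points a b c p' q' r'"
  have "X \<inter> Y = {}"
  proof (rule ccontr)
    assume "X \<inter> Y \<noteq> {}"
    then obtain x y where xy: "x \<in> tripod_points a b c p q r" "y \<in> tripod_points a b c p' q' r'" "\<psi> x = \<psi> y"
      unfolding X_def Y_def by blast
    have re: "x \<in> realization G1" "y \<in> realization G1" using xy inG1 pqr pqr' by blast+
    then have \<phi>: "\<phi> x = \<phi> y" using \<psi>_eq xy(3) by blast
    obtain e' where e': "e' \<in> tripod_edges a b c p q r" "x \<in> closed_cell e'"
      using xy(1) by (rule tripod_points_cell)
    obtain f' where f': "f' \<in> tripod_edges a b c p' q' r'" "y \<in> closed_cell f'"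
      using xy(2) by (rule tripod_points_cell)
    have "x \<noteq> y"
    proof
      assume "x = y"
      obtain v where "v \<in> {p, q, r}" "x v \<noteq> 0" using tripod_points_off_triangle[OF xy(1) disj(1)] .
      then have "v \<in> f'" using support_closed_cell[OF f'(2)] \<open>x = y\<close> by auto
      then show False using f'(1) disj \<open>v \<in> {p, q, r}\<close> by auto
    qed
    have "x \<in> realization G" "y \<in> realization G" using re real(2) by auto
    then obtain e f where ef: "e \<in> edges G" "f \<in> edges G" "e \<noteq> f" "x \<in> open_cell e" "y \<in> open_cell f"
      "{z \<in> realization G. \<phi> z = \<phi> x} = {x, y}"
      by (rule drawing_collision[OF G(2) _ _ \<open>x \<noteq> y\<close> \<phi>])
    have card2: "card e = 2" "card f = 2" using ef G(1) by (auto simp: simple_graph_def)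
    have "card e' \<le> 2" "card f' \<le> 2" "finite e'" "finite f'" using e'(1) f'(1) by (auto simp: card_insert_if)
    then have "e' = e" "f' = f" using open_cell_support e'(2) f'(2) ef card2 by blast+
    moreover have "e \<in> edges G1" "f \<in> edges G1"
      using e'(1) f'(1) \<open>e' = e\<close> \<open>f' = f\<close> card2 pqr pqr' by auto
    moreover have "crosses G \<phi> e f"
      using ef \<phi> unfolding crosses_def by blast
    ultimately show False using no_cross e'(1) f'(1) by blast
  qed
  moreover have "J = path_image (\<psi> \<circ> edge_param a b) \<union> path_image (\<psi> \<circ> edge_param b c) \<union> path_image (\<psi> \<circ> edge_param c a)"
    by (simp add: J_def T_cells image_Un arc eT ne)
  ultimately show False
    using no_disjoint_tripods[OF arc(1,3,4)[OF eT(1) ne(1)] arc(1,3,4)[OF eT(2) ne(2)] arc(1,3,4)[OF eT(3) ne(3)],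
        of J X Y]
      tri[OF X_def pqr disj(1)] tri[OF Y_def pqr' disj(2)] meet[OF eT(1,2)] meet[OF eT(2,3)] meet[OF eT(3,1)] ne
    by (simp add: arc eT ne)
qed

lemma facial_triangle_tripod_crossings:
  assumes G: "one_drawing G \<phi>" "simple_drawing G \<phi>" "simple_graph G" and G1: "subgraph G1 G"
    and T: "facial G1 \<phi> T" "distinct [a, b, c]" "verts T = {a, b, c}" "edges T = {{a, b}, {b, c}, {c, a}}"
  shows "tripod_crossings (\<lambda>e f. e \<in> edges G1 \<and> f \<in> edges G1 \<and> crosses G \<phi> e f) (edges G1) a b c"
proof unfold_locales
  have d: "drawing G \<phi>" using G(1) by (simp add: one_drawing_def)
  fix p q r p' q' r'
  assume "{p, a} \<in> edges G1" "{q, b} \<in> edges G1" "{r, c} \<in> edges G1"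
      "p = q \<or> {p, q} \<in> edges G1" "q = r \<or> {q, r} \<in> edges G1"
      "{p', a} \<in> edges G1" "{q', b} \<in> edges G1" "{r', c} \<in> edges G1"
      "p' = q' \<or> {p', q'} \<in> edges G1" "q' = r' \<or> {q', r'} \<in> edges G1"
      "{p, q, r} \<inter> {a, b, c} = {}" "{p', q', r'} \<inter> {a, b, c} = {}"
      "{p, q, r} \<inter> {p', q', r'} = {}"
  from facial_triangle_tripods_cross[OF G(3) d G1 T this]
  show "\<exists>e\<in>tripod_edges a b c p q r. \<exists>f\<in>tripod_edges a b c p' q' r'.
    e \<in> edges G1 \<and> f \<in> edges G1 \<and> crosses G \<phi> e f" by blast
next
  show "card e = 2" if "e \<in> edges G1" for e
    using that G1 by (auto simp: subgraph_def simple_graph_def)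
next
  show "distinct [a, b, c]" by (rule T(2))
qed (use crosses_sym crosses_unique[OF G(1)] crosses_disjoint[OF G(2)] in blast)+

section \<open>Triangle chains\<close>

text \<open>What remains of an isomorphism to the strong product when the triangle coordinate is
  forgotten: adjacency of distinct vertices depends on their layers alone. Reversing, cutting and
  gluing chains only changes \<open>lay\<close>.\<close>

definition chain_graph :: "nat \<Rightarrow> ('a \<Rightarrow> nat) \<Rightarrow> 'a graph \<Rightarrow> bool" where
  "chain_graph k lay G \<longleftrightarrow> simple_graph G \<and> lay ` verts G \<subseteq> {..<k} \<and>
     (\<forall>i<k. card {v \<in> verts G. lay v = i} = 3) \<and>
     (\<forall>u\<in>verts G. \<forall>v\<in>verts G.
        {u, v} \<in> edges G \<longleftrightarrow> u \<noteq> v \<and> lay u \<le> lay v + 1 \<and> lay v \<le> lay u + 1)"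

lemma chain_graphI:
  assumes "simple_graph G" "\<And>v. v \<in> verts G \<Longrightarrow> lay v < k"
    and "\<And>i. i < k \<Longrightarrow> card {v \<in> verts G. lay v = i} = 3"
    and "\<And>u v. u \<in> verts G \<Longrightarrow> v \<in> verts G \<Longrightarrow>
      {u, v} \<in> edges G \<longleftrightarrow> u \<noteq> v \<and> lay u \<le> lay v + 1 \<and> lay v \<le> lay u + 1"
  shows "chain_graph k lay G"
  using assms unfolding chain_graph_def by blast

section \<open>Layer functions and the strong product\<close>

lemma complete_graph_adj: "{u, v} \<in> edges (complete_graph n) \<longleftrightarrow> u < n \<and> v < n \<and> u \<noteq> v"
  by (auto simp: complete_graph_def doubleton_eq_iff)

lemma path_graph_adj:
  "{u, v} \<in> edges (path_graph k) \<longleftrightarrow> u < k \<and> v < k \<and> u \<noteq> v \<and> u \<le> v + 1 \<and> v \<le> u + 1"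
proof
  assume *: "u < k \<and> v < k \<and> u \<noteq> v \<and> u \<le> v + 1 \<and> v \<le> u + 1"
  then have "v = Suc u \<or> u = Suc v" by auto
  then show "{u, v} \<in> edges (path_graph k)"
    using * by (auto simp: path_graph_def insert_commute)
qed (auto simp: path_graph_def doubleton_eq_iff)

lemma strong_product_adj:
  assumes "p \<in> verts (strong_product (complete_graph n) (path_graph k))"
    "q \<in> verts (strong_product (complete_graph n) (path_graph k))"
  shows "{p, q} \<in> edges (strong_product (complete_graph n) (path_graph k)) \<longleftrightarrow>
    p \<noteq> q \<and> snd p \<le> snd q + 1 \<and> snd q \<le> snd p + 1"
proof -
  obtain v w v' w' where pq: "p = (v, w)" "q = (v', w')" by fastforce
  have b: "v < n" "v' < n" "w < k" "w' < k"
    using assms pq by (auto simp: strong_product_def complete_graph_def path_graph_def)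
  define P where "P = (\<lambda>v w v' w'. v \<in> verts (complete_graph n) \<and> v' \<in> verts (complete_graph n) \<and>
      w \<in> verts (path_graph k) \<and> w' \<in> verts (path_graph k) \<and>
                 (v = v' \<and> {w, w'} \<in> edges (path_graph k) \<or>
                  {v, v'} \<in> edges (complete_graph n) \<and> w = w' \<or>
                  {v, v'} \<in> edges (complete_graph n) \<and> {w, w'} \<in> edges (path_graph k)))"
  have "{p, q} \<in> edges (strong_product (complete_graph n) (path_graph k)) \<longleftrightarrow> P v w v' w' \<or> P v' w' v w"
    unfolding pq P_def strong_product_def by (auto simp: doubleton_eq_iff)
  also have "\<dots> \<longleftrightarrow> P v w v' w'"
    unfolding P_def by (auto simp: insert_commute)
  also have "\<dots> \<longleftrightarrow> p \<noteq> q \<and> snd p \<le> snd q + 1 \<and> snd q \<le> snd p + 1"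
    unfolding P_def complete_graph_adj path_graph_adj pq using b
    by (auto simp: complete_graph_def path_graph_def)
  finally show ?thesis .
qed

text \<open>The path coordinate is a layer function. Conversely each layer may be numbered
  arbitrarily, because by \<open>strong_product_adj\<close> the triangle coordinate matters only for
  distinctness.\<close>

lemma isomorphic_chain:
  assumes "simple_graph G"
  shows "isomorphic G (strong_product (complete_graph 3) (path_graph k)) \<longleftrightarrow> (\<exists>lay. chain_graph k lay G)"
proof
  let ?P = "strong_product (complete_graph 3) (path_graph k)"
  have vP: "verts ?P = {..<3} \<times> {..<k}"
    by (simp add: strong_product_def complete_graph_def path_graph_def)
  {
    assume "isomorphic G ?P"
    then obtain f where f: "bij_betw f (verts G) (verts ?P)"
      and adj: "\<And>u v. u \<in> verts G \<Longrightarrow> v \<in> verts G \<Longrightarrow> {u, v} \<in> edges G \<longleftrightarrow> {f u, f v} \<in> edges ?P"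
      unfolding isomorphic_def by blast
    have fP: "f v \<in> verts ?P" if "v \<in> verts G" for v using f that by (auto simp: bij_betw_def)
    have c1: "card {v \<in> verts G. snd (f v) = i} = 3" if "i < k" for i
    proof -
      have "bij_betw f {v \<in> verts G. snd (f v) = i} ({..<3} \<times> {i})"
      proof (rule bij_betw_subset[OF f])
        have "f ` verts G = {..<3} \<times> {..<k}" using f vP by (simp add: bij_betw_def)
        then show "f ` {v \<in> verts G. snd (f v) = i} = {..<3} \<times> {i}"
          using that by (auto simp: set_eq_iff image_iff) (metis snd_conv lessThan_iff)+
      qed auto
      then show ?thesis by (simp add: bij_betw_same_card)
    qed
    have c2: "snd (f v) < k" if "v \<in> verts G" for v
      using fP[OF that] unfolding vP by (simp add: mem_Times_iff)
    have c3: "f u = f v \<longleftrightarrow> u = v" if "u \<in> verts G" "v \<in> verts G" for u v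
      using f that by (auto simp: bij_betw_def inj_on_def)
    have "{u, v} \<in> edges G \<longleftrightarrow> u \<noteq> v \<and> snd (f u) \<le> snd (f v) + 1 \<and> snd (f v) \<le> snd (f u) + 1"
      if "u \<in> verts G" "v \<in> verts G" for u v
      using adj[OF that] strong_product_adj[OF fP[OF that(1)] fP[OF that(2)]] c3[OF that] by simp
    with assms c1 c2 have "chain_graph k (\<lambda>v. snd (f v)) G" by (intro chain_graphI) simp_all
    then show "\<exists>lay. chain_graph k lay G" by blast
  }
  {
    assume "\<exists>lay. chain_graph k lay G"
    then obtain lay where ch: "chain_graph k lay G" ..
    have "\<exists>c. bij_betw c {v \<in> verts G. lay v = i} {..<3::nat}" if "i < k" for i
      using ch that by (intro finite_same_card_bij) (auto simp: chain_graph_def simple_graph_def)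
    then obtain c where c: "\<And>i. i < k \<Longrightarrow> bij_betw (c i) {v \<in> verts G. lay v = i} {..<3::nat}" by metis
    define f where "f v = (c (lay v) v, lay v)" for v
    have lay: "lay v < k" if "v \<in> verts G" for v using ch that by (auto simp: chain_graph_def)
    have bij: "bij_betw f (verts G) (verts ?P)"
    proof (rule bij_betw_imageI)
      show "inj_on f (verts G)"
      proof (rule inj_onI)
        fix u v assume uv: "u \<in> verts G" "v \<in> verts G" "f u = f v"
        then have "lay u = lay v" "c (lay v) u = c (lay v) v" by (auto simp: f_def)
        moreover have "inj_on (c (lay v)) {w \<in> verts G. lay w = lay v}"
          using c[OF lay[OF uv(2)]] by (simp add: bij_betw_def)
        ultimately show "u = v" using uv by (auto simp: inj_on_def)
      qed
      show "f ` verts G = verts ?P"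
      proof (intro equalityI subsetI)
        fix p assume "p \<in> f ` verts G"
        then show "p \<in> verts ?P" 
          using c[OF lay] lay unfolding f_def vP bij_betw_def by auto
      next
        fix p assume "p \<in> verts ?P"
        then obtain j i where p: "p = (j, i)" "j < 3" "i < k" using vP by auto
        then have "j \<in> c i ` {v \<in> verts G. lay v = i}" using c by (auto simp: bij_betw_def)
        then show "p \<in> f ` verts G" using p by (auto simp: f_def)
      qed
    qed
    moreover have "{u, v} \<in> edges G \<longleftrightarrow> {f u, f v} \<in> edges ?P" if "u \<in> verts G" "v \<in> verts G" for u v
    proof -
      have "f u \<in> verts ?P" "f v \<in> verts ?P" "f u = f v \<longleftrightarrow> u = v"
        using bij that by (auto simp: bij_betw_def inj_on_def)
      then show ?thesis
        using strong_product_adj[of "f u" 3 k "f v"] ch that by (auto simp: chain_graph_def f_def)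
    qed
    ultimately show "isomorphic G ?P" unfolding isomorphic_def by blast
  }
qed

lemma chain_graph_reverse:
  assumes "chain_graph k lay G"
  shows "chain_graph k (\<lambda>v. k - 1 - lay v) G"
proof -
  have lay: "lay v < k" if "v \<in> verts G" for v using assms that by (auto simp: chain_graph_def)
  have "{v \<in> verts G. k - 1 - lay v = i} = {v \<in> verts G. lay v = k - 1 - i}" if "i < k" for i
    using lay that by fastforce
  then have "card {v \<in> verts G. k - 1 - lay v = i} = 3" if "i < k" for i
    using assms that by (simp add: chain_graph_def)
  moreover have "(k - 1 - lay u \<le> k - 1 - lay v + 1 \<and> k - 1 - lay v \<le> k - 1 - lay u + 1) \<longleftrightarrow>
      lay u \<le> lay v + 1 \<and> lay v \<le> lay u + 1" if "u \<in> verts G" "v \<in> verts G" for u v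
    using lay[OF that(1)] lay[OF that(2)] by auto
  ultimately show ?thesis using assms lay by (fastforce simp: chain_graph_def)
qed

lemma card_chain:
  assumes "chain_graph k lay G"
  shows "card (verts G) = 3 * k"
proof -
  have "finite (verts G)" using assms by (simp add: chain_graph_def simple_graph_def)
  then have "card (verts G) = (\<Sum>i<k. card {v \<in> verts G. lay v = i})"
    using assms sum.group[of "verts G" "{..<k}" lay "\<lambda>_. 1 :: nat"] by (simp add: chain_graph_def)
  also have "\<dots> = 3 * k" using assms by (simp add: chain_graph_def)
  finally show ?thesis .
qed

text \<open>Vertices private to \<open>G1\<close> lie strictly below the shared layer and those
  private to \<open>G2\<close> strictly above it. Their layers differ by at least two, so the union
  lacks no edge between them.\<close>

lemma glue_chains:
  assumes G1: "chain_graph k1 lay1 G1" and G2: "chain_graph k2 lay2 G2" and "k1 \<ge> 1" "k2 \<ge> 1"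
    and T1: "{v \<in> verts G1. lay1 v = k1 - 1} = verts G1 \<inter> verts G2"
    and T2: "{v \<in> verts G2. lay2 v = 0} = verts G1 \<inter> verts G2"
  shows "\<exists>lay. chain_graph (k1 + k2 - 1) lay (graph_union G1 G2)"
proof -
  \<comment> \<open>Layer 0 of \<open>G2\<close> is layer \<open>k1 - 1\<close> of
    \<open>G1\<close>; with this shift both descriptions agree on the overlap.\<close>
  define lay where "lay v = (if v \<in> verts G1 then lay1 v else lay2 v + (k1 - 1))" for v
  have l1: "lay v = lay1 v" "lay1 v \<le> k1 - 1" if "v \<in> verts G1" for v
    using that G1 by (auto simp: lay_def chain_graph_def)
  have l2: "lay v = lay2 v + (k1 - 1)" "lay2 v < k2" if "v \<in> verts G2" for v
  proof -
    show "lay2 v < k2" using that G2 by (auto simp: chain_graph_def)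
    have "v \<in> verts G1 \<Longrightarrow> lay1 v = k1 - 1 \<and> lay2 v = 0" using that T1 T2 by blast
    then show "lay v = lay2 v + (k1 - 1)" by (auto simp: lay_def)
  qed
  have only1: "lay v < k1 - 1" if "v \<in> verts G1" "v \<notin> verts G2" for v
  proof -
    have "lay1 v \<noteq> k1 - 1" using that T1 by blast
    then show ?thesis using l1[OF that(1)] by simp
  qed
  have only2: "lay v > k1 - 1" if "v \<in> verts G2" "v \<notin> verts G1" for v
  proof -
    have "lay2 v \<noteq> 0"
    proof
      assume "lay2 v = 0"
      then have "v \<in> {v \<in> verts G2. lay2 v = 0}" using that(1) by simp
      then show False unfolding T2 using that(2) by simp
    qed
    then show ?thesis using l2[OF that(1)] by simp
  qed
  have s: "simple_graph G1" "simple_graph G2" using G1 G2 by (auto simp: chain_graph_def)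
  have a1: "{u, v} \<in> edges G1 \<longleftrightarrow> u \<noteq> v \<and> lay u \<le> lay v + 1 \<and> lay v \<le> lay u + 1"
    if "u \<in> verts G1" "v \<in> verts G1" for u v
    using that G1 l1 by (simp add: chain_graph_def)
  have a2: "{u, v} \<in> edges G2 \<longleftrightarrow> u \<noteq> v \<and> lay u \<le> lay v + 1 \<and> lay v \<le> lay u + 1"
    if "u \<in> verts G2" "v \<in> verts G2" for u v
    using that G2 l2 by (simp add: chain_graph_def)
  have e: "u \<in> verts G1 \<and> v \<in> verts G1" if "{u, v} \<in> edges G1" for u v
    using that s(1) by (auto simp: simple_graph_def)
  have e': "u \<in> verts G2 \<and> v \<in> verts G2" if "{u, v} \<in> edges G2" for u v
    using that s(2) by (auto simp: simple_graph_def)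
  have adj: "{u, v} \<in> edges G1 \<union> edges G2 \<longleftrightarrow> u \<noteq> v \<and> lay u \<le> lay v + 1 \<and> lay v \<le> lay u + 1"
    if uv: "u \<in> verts G1 \<union> verts G2" "v \<in> verts G1 \<union> verts G2" for u v
  proof -
    consider "u \<in> verts G1" "v \<in> verts G1" | "u \<in> verts G2" "v \<in> verts G2"
      | "u \<in> verts G1" "u \<notin> verts G2" "v \<in> verts G2" "v \<notin> verts G1"
      | "v \<in> verts G1" "v \<notin> verts G2" "u \<in> verts G2" "u \<notin> verts G1"
      using uv by blast
    then show ?thesis
    proof cases
      case 1 then show ?thesis using a1 a2 e' by blast
    next
      case 2 then show ?thesis using a1 a2 e by blast
    next
      case 3 then show ?thesis using only1[of u] only2[of v] e[of u v] e'[of u v] by auto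
    next
      case 4 then show ?thesis using only1[of v] only2[of u] e[of u v] e'[of u v] by auto
    qed
  qed
  have fib: "card {v \<in> verts G1 \<union> verts G2. lay v = i} = 3" if "i < k1 + k2 - 1" for i
  proof (cases "i < k1 - 1")
    case True
    then have "{v \<in> verts G1 \<union> verts G2. lay v = i} = {v \<in> verts G1. lay1 v = i}"
      using l1 l2 by force
    then show ?thesis using G1 True by (simp add: chain_graph_def)
  next
    case False
    have "{v \<in> verts G1 \<union> verts G2. lay v = i} = {v \<in> verts G2. lay2 v = i - (k1 - 1)}"
    proof (intro set_eqI iffI)
      fix v assume v: "v \<in> {v \<in> verts G1 \<union> verts G2. lay v = i}"
      then have "v \<in> verts G2" using only1[of v] False by auto
      then show "v \<in> {v \<in> verts G2. lay2 v = i - (k1 - 1)}" using v l2 by auto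
    qed (use l2 False in auto)
    then show ?thesis using G2 False that \<open>k1 \<ge> 1\<close> by (simp add: chain_graph_def)
  qed
  have "lay v < k1 + k2 - 1" if "v \<in> verts G1 \<union> verts G2" for v
    using that l1[of v] l2[of v] \<open>k1 \<ge> 1\<close> \<open>k2 \<ge> 1\<close> by auto
  moreover have "simple_graph (graph_union G1 G2)"
    using s by (auto simp: simple_graph_def graph_union_def)
  ultimately have "chain_graph (k1 + k2 - 1) lay (graph_union G1 G2)"
    using adj fib unfolding chain_graph_def by (auto simp: graph_union_def)
  then show ?thesis by blast
qed

section \<open>Position of a facial triangle in a chain\<close>

lemma chain_layerE:
  assumes "chain_graph k lay G" "i < k" "S \<subseteq> {v \<in> verts G. lay v = i}"
  shows "card S = 3 \<Longrightarrow> {v \<in> verts G. lay v = i} = S"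
    and "S = {x, y} \<Longrightarrow> x \<noteq> y \<Longrightarrow> \<exists>d. d \<notin> {x, y} \<and> {v \<in> verts G. lay v = i} = {x, y, d}"
    and "S = {x} \<Longrightarrow> \<exists>d e. distinct [x, d, e] \<and> {v \<in> verts G. lay v = i} = {x, d, e}"
    and "\<exists>x d e. distinct [x, d, e] \<and> {v \<in> verts G. lay v = i} = {x, d, e}"
proof -
  let ?L = "{v \<in> verts G. lay v = i}"
  have c: "card ?L = 3" using assms by (simp add: chain_graph_def)
  have f: "finite ?L" using c by (metis card.infinite zero_neq_numeral)
  show "card S = 3 \<Longrightarrow> ?L = S" using assms(3) c f by (metis card_subset_eq)
  have three: "\<exists>x d e. distinct [x, d, e] \<and> A = {x, d, e}" if "card A = 3" for A :: "'a set"
    using that card_3_iff[of A] by auto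
  show "\<exists>x d e. distinct [x, d, e] \<and> ?L = {x, d, e}" using three[OF c] .
  then obtain p q r where pqr: "distinct [p, q, r]" "?L = {p, q, r}" by blast
  show "\<exists>d e. distinct [x, d, e] \<and> ?L = {x, d, e}" if "S = {x}"
  proof -
    have "x \<in> {p, q, r}" using assms(3) that pqr by blast
    then consider "x = p" | "x = q" | "x = r" by blast
    then show ?thesis
    proof cases
      case 1 then show ?thesis using pqr by blast
    next
      case 2 then show ?thesis using pqr by (intro exI[of _ p] exI[of _ r]) auto
    next
      case 3 then show ?thesis using pqr by (intro exI[of _ p] exI[of _ q]) auto
    qed
  qed
  show "\<exists>d. d \<notin> {x, y} \<and> ?L = {x, y, d}" if "S = {x, y}" "x \<noteq> y"
  proof -
    have "card (?L - {x, y}) = 1" using c f assms(3) that by (simp add: card_Diff_subset)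
    then obtain d where "?L - {x, y} = {d}" by (auto simp: card_1_singleton_iff)
    then show ?thesis using assms(3) that by (intro exI[of _ d]) blast
  qed
qed

text \<open>The corners are pairwise adjacent, so they occupy one layer or two consecutive ones. The
  vertices of an inner layer have six common neighbours outside it, which is too many. With two
  layers, a third one is next to one of them and a \<open>no_attachment\<close> lemma applies; these
  lemmas distinguish the corners, which is why \<open>trip\<close> covers all orders.\<close>

lemma tripod_triangle_is_end_layer:
  assumes ch: "chain_graph k lay G" and "k \<ge> 2"
    and T: "distinct [a, b, c]" "{a, b} \<in> edges G" "{b, c} \<in> edges G" "{c, a} \<in> edges G"
    and trip: "\<And>x y z. {x, y, z} = {a, b, c} \<Longrightarrow> distinct [x, y, z] \<Longrightarrow> tripod_crossings cr (edges G) x y z"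
  shows "\<exists>lay. chain_graph k lay G \<and> {v \<in> verts G. lay v = 0} = {a, b, c}"
proof -
  have sG: "simple_graph G" using ch by (simp add: chain_graph_def)
  have V: "a \<in> verts G" "b \<in> verts G" "c \<in> verts G" using T sG by (auto simp: simple_graph_def)
  have lay: "lay v < k" if "v \<in> verts G" for v using ch that by (auto simp: chain_graph_def)
  have adj: "{u, v} \<in> edges G \<longleftrightarrow> u \<noteq> v \<and> lay u \<le> lay v + 1 \<and> lay v \<le> lay u + 1"
    if "u \<in> verts G" "v \<in> verts G" for u v using ch that by (simp add: chain_graph_def)
  show ?thesis
  proof (cases "k = 2")
    case True
    \<comment> \<open>With two layers the graph is complete, so the given triangle can be declared
      layer 0.\<close>
    define l where "l v = (if v \<in> {a, b, c} then 0 else 1 :: nat)" for v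
    have lv: "lay v < 2" if "v \<in> verts G" for v using lay[OF that] True by simp
    have c6: "card (verts G) = 6" using card_chain[OF ch] True by simp
    have l0: "{v \<in> verts G. l v = 0} = {a, b, c}" using V by (auto simp: l_def)
    have "{v \<in> verts G. l v = 1} = verts G - {a, b, c}" by (auto simp: l_def)
    then have "card {v \<in> verts G. l v = 1} = 3"
      using c6 V T(1) by (simp add: card_Diff_subset)
    moreover have "card {a, b, c} = 3" using T(1) by simp
    ultimately have "card {v \<in> verts G. l v = i} = 3" if "i < 2" for i
      using that l0 by (cases i) (auto simp: less_Suc_eq numeral_2_eq_2)
    moreover have "l u \<le> l v + 1 \<and> l v \<le> l u + 1" for u v by (simp add: l_def)
    moreover have "{u, v} \<in> edges G \<longleftrightarrow> u \<noteq> v" if "u \<in> verts G" "v \<in> verts G" for u v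
      using adj[OF that] lv[OF that(1)] lv[OF that(2)] by auto
    ultimately have "chain_graph k l G"
      using sG True by (auto simp: chain_graph_def l_def)
    then show ?thesis using l0 by blast
  next
    case False
    then have k3: "k \<ge> 3" using assms(2) by simp
    have lays: "lay a \<le> lay b + 1" "lay b \<le> lay a + 1" "lay b \<le> lay c + 1" "lay c \<le> lay b + 1"
      "lay a \<le> lay c + 1" "lay c \<le> lay a + 1"
      using adj T V by auto
    show ?thesis
    proof (cases "lay a = lay b \<and> lay b = lay c")
      case True
      define i where "i = lay a"
      have Li: "{v \<in> verts G. lay v = i} = {a, b, c}"
        using True V T(1) by (intro chain_layerE(1)[OF ch]) (auto simp: i_def lay)
      have "i < k" using lay V by (simp add: i_def)
      then consider "i = 0" | "i = k - 1" | "0 < i" "i + 1 < k" by linarith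
      then show ?thesis
      proof cases
        case 1 then show ?thesis using ch Li by blast
      next
        case 2
        have "{v \<in> verts G. k - 1 - lay v = 0} = {v \<in> verts G. lay v = i}"
          using lay 2 by fastforce
        then show ?thesis using chain_graph_reverse[OF ch] Li by metis
      next
        case 3
        interpret tripod_crossings cr "edges G" a b c using trip T(1) by blast
        obtain v v1 v2 where v: "distinct [v, v1, v2]" "{v \<in> verts G. lay v = i + 1} = {v, v1, v2}"
          using chain_layerE(4)[OF ch 3(2) empty_subsetI] by blast
        obtain w w1 w2 where w: "distinct [w, w1, w2]" "{v \<in> verts G. lay v = i - 1} = {w, w1, w2}"
          using chain_layerE(4)[OF ch less_imp_diff_less[OF \<open>i < k\<close>] empty_subsetI] by blast
        have lv: "u \<in> verts G \<and> lay u = i + 1" if "u \<in> {v, v1, v2}" for u using v(2) that by blast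
        have lw: "u \<in> verts G \<and> lay u = i - 1" if "u \<in> {w, w1, w2}" for u using w(2) that by blast
        have la: "u \<in> verts G \<and> lay u = i" if "u \<in> {a, b, c}" for u using Li that by blast
        have d: "v1 \<noteq> w" "v1 \<noteq> w1" "v1 \<noteq> w2" using lv lw 3 by fastforce+
        \<comment> \<open>Next to \<open>v\<close>, four of the remaining five common neighbours
          already exceed the bound.\<close>
        have "card {v1, w, w1, w2} \<le> 3"
        proof (rule common_neighbours)
          show "distinct [a, b, c, v]" using T(1) lv[of v] la[of a] la[of b] la[of c] by auto
          show "{v1, w, w1, w2} \<inter> {a, b, c, v} = {}"
            using lv[of v] lv[of v1] lw[of w] lw[of w1] lw[of w2] la[of a] la[of b] la[of c] v(1) 3 by auto
          have near: "{u, t} \<in> edges G" if "u \<in> {v, v1, v2} \<union> {w, w1, w2}" "t \<in> {a, b, c}" for u t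
          proof -
            have "u \<in> verts G" "lay u = i + 1 \<or> lay u = i - 1" using that(1) lv lw by blast+
            then show ?thesis using adj[of u t] la[OF that(2)] 3 by auto
          qed
          show "{v, a} \<in> edges G" "{v, b} \<in> edges G" "{v, c} \<in> edges G" using near by auto
          show "{u, a} \<in> edges G \<and> {u, b} \<in> edges G \<and> {u, c} \<in> edges G" if "u \<in> {v1, w, w1, w2}" for u
            using near that by auto
        qed
        then show ?thesis using d w(1) by simp
      qed
    next
      case False
      then obtain x y z where xyz: "{x, y, z} = {a, b, c}" "distinct [x, y, z]" "lay x = lay y" "lay z \<noteq> lay x"
      proof -
        have "lay a = lay b \<or> lay b = lay c \<or> lay a = lay c" using lays by linarith
        then consider "lay a = lay b" "lay c \<noteq> lay a" | "lay b = lay c" "lay a \<noteq> lay b"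
          | "lay a = lay c" "lay b \<noteq> lay a" using False by auto
        then show ?thesis
          by cases (use that[of a b c] that[of b c a] that[of a c b] T(1) in auto)
      qed
      interpret tripod_crossings cr "edges G" x y z using trip xyz by blast
      define i j where "i = lay x" and "j = lay z"
      have "{x, y, z} \<subseteq> verts G" unfolding xyz(1) using V by simp
      then have xV: "x \<in> verts G" "y \<in> verts G" "z \<in> verts G" by simp_all
      have "{x, z} \<in> edges G"
      proof -
        have "x \<in> {a, b, c}" "z \<in> {a, b, c}" "x \<noteq> z" using xyz by auto
        then show ?thesis using T by (auto simp: insert_commute)
      qed
      then have ij: "i \<noteq> j" "i \<le> j + 1" "j \<le> i + 1" "i < k" "j < k"
        using adj xV xyz(4) lay by (auto simp: i_def j_def)
      obtain d where d: "d \<notin> {x, y}" "{v \<in> verts G. lay v = i} = {x, y, d}"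
      proof -
        have "{x, y} \<subseteq> {v \<in> verts G. lay v = i}" "x \<noteq> y" using xV xyz by (auto simp: i_def)
        from chain_layerE(2)[OF ch ij(4) this(1) refl this(2)] that show ?thesis by blast
      qed
      obtain e f where ef: "distinct [z, e, f]" "{v \<in> verts G. lay v = j} = {z, e, f}"
      proof -
        have "{z} \<subseteq> {v \<in> verts G. lay v = j}" using xV by (auto simp: j_def)
        from chain_layerE(3)[OF ch ij(5) this refl] that show ?thesis by blast
      qed
      \<comment> \<open>Since \<open>i\<close> and \<open>j\<close> are consecutive and
        \<open>k \<ge> 3\<close>, a layer exists beyond one of them.\<close>
      obtain l where l: "l < k" "l \<noteq> i" "l \<noteq> j" "(l \<le> i + 1 \<and> i \<le> l + 1) \<or> (l \<le> j + 1 \<and> j \<le> l + 1)"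
      proof -
        have "j = i + 1 \<or> i = j + 1" using ij by linarith
        then consider "j = i + 1" "j + 1 < k" | "j = i + 1" "i \<ge> 1" | "i = j + 1" "i + 1 < k" | "i = j + 1" "j \<ge> 1"
          using k3 by linarith
        then show ?thesis
        proof cases
          case 1 then show ?thesis by (intro that[of "j + 1"]) auto
        next
          case 2 then show ?thesis using ij by (intro that[of "i - 1"]) auto
        next
          case 3 then show ?thesis by (intro that[of "i + 1"]) auto
        next
          case 4 then show ?thesis using ij by (intro that[of "j - 1"]) auto
        qed
      qed
      obtain u v w where uvw: "distinct [u, v, w]" "{v \<in> verts G. lay v = l} = {u, v, w}"
        using chain_layerE(4)[OF ch l(1) empty_subsetI] by blast
      have li: "s \<in> verts G \<and> lay s = i" if "s \<in> {x, y, d}" for s using d(2) that by blast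
      have lj: "s \<in> verts G \<and> lay s = j" if "s \<in> {z, e, f}" for s using ef(2) that by blast
      have ll: "s \<in> verts G \<and> lay s = l" if "s \<in> {u, v, w}" for s using uvw(2) that by blast
      have dist: "distinct [x, y, z, d, e, f, u, v, w]"
      proof -
        have "{x, y, d} \<inter> {z, e, f} = {}" "{x, y, d} \<inter> {u, v, w} = {}" "{z, e, f} \<inter> {u, v, w} = {}"
          using li lj ll ij(1) l(2,3) by (metis disjoint_iff)+
        then show ?thesis using d(1) ef(1) uvw(1) xyz(2) by auto
      qed
      have adj_same: "{s, t} \<in> edges G" if "s \<in> A" "t \<in> A" "s \<noteq> t" "A \<in> {{x, y, d}, {z, e, f}}" for s t A
        using that(4) adj[of s t] li[of s] li[of t] lj[of s] lj[of t] that(1-3) by auto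
      have adj_ij: "{s, t} \<in> edges G" if "s \<in> {x, y, d}" "t \<in> {z, e, f}" for s t
        using adj[of s t] li[OF that(1)] lj[OF that(2)] ij by auto
      from l(4) show ?thesis
      proof
        assume l': "l \<le> i + 1 \<and> i \<le> l + 1"
        have adj_il: "{s, t} \<in> edges G" if "s \<in> {x, y, d}" "t \<in> {u, v, w}" for s t
          using adj[of s t] li[OF that(1)] ll[OF that(2)] l l' by auto
        have "{s, t} \<in> edges G" if st: "s \<in> {x, y, d}" "t \<in> {d, e, f, z, u, v, w}" "s \<noteq> t" for s t
        proof -
          consider "t = d" | "t \<in> {z, e, f}" | "t \<in> {u, v, w}" using st(2) by blast
          then show ?thesis
            using adj_same[of s "{x, y, d}" t] adj_ij[of s t] adj_il[of s t] st by cases auto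
        qed
        moreover have "{e, z} \<in> edges G" "{f, z} \<in> edges G"
          using adj_same[of e "{z, e, f}" z] adj_same[of f "{z, e, f}" z] ef(1) by auto
        ultimately have False using no_attachment_two[OF dist] by blast
        then show ?thesis ..
      next
        assume l': "l \<le> j + 1 \<and> j \<le> l + 1"
        have adj_jl: "{s, t} \<in> edges G" if "s \<in> {z, e, f}" "t \<in> {u, v, w}" for s t
          using adj[of s t] lj[OF that(1)] ll[OF that(2)] l l' by auto
        have "{s, t} \<in> edges G" if st: "s \<in> {z, e, f}" "t \<in> {x, y, z, d, e, f, u, v, w}" "s \<noteq> t" for s t
        proof -
          consider "t \<in> {x, y, d}" | "t \<in> {z, e, f}" | "t \<in> {u, v, w}" using st(2) by blast
          then show ?thesis
            using adj_same[of s "{z, e, f}" t] adj_ij[of t s] adj_jl[of s t] st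
            by cases (auto simp: insert_commute)
        qed
        moreover have "{d, x} \<in> edges G" "{d, y} \<in> edges G"
          using adj_same[of d "{x, y, d}" x] adj_same[of d "{x, y, d}" y] d(1) by auto
        ultimately have False using no_attachment_one[OF dist] by blast
        then show ?thesis ..
      qed
    qed
  qed
qed

section \<open>Regions bounded by a layer\<close>

text \<open>\<open>\<l>\<close> is a local equation for the image of \<open>e\<close> and changes
  its sign along \<open>f\<close> at the parameter \<open>s\<close>. Every neighbourhood of
  \<open>p\<close> contains points of \<open>f\<close> from both sides, and a connected set
  containing both would contain a zero of \<open>\<l>\<close>, hence a point of
  \<open>e\<close>.\<close>

lemma transversal_atI:
  fixes \<phi> :: "('a \<Rightarrow> real) \<Rightarrow> real ^ 3" and \<l> :: "real ^ 3 \<Rightarrow> real"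
    and \<gamma> :: "real \<Rightarrow> real ^ 3"
  assumes D: "openin (top_of_set S2) D" "p \<in> D"
    and \<l>: "continuous_on UNIV \<l>" "{P \<in> D. \<l> P = 0} \<subseteq> \<phi> ` closed_cell e" "\<And>x. x \<in> closed_cell e \<Longrightarrow> \<l> (\<phi> x) = 0"
    and \<gamma>: "continuous_on {0..1} \<gamma>" "\<gamma> ` {0..1} \<subseteq> \<phi> ` closed_cell f" "\<phi> ` closed_cell f \<subseteq> S2"
    and s: "0 < s" "s < 1" "\<gamma> s = p" "\<And>t. 0 \<le> t \<Longrightarrow> t < s \<Longrightarrow> \<l> (\<gamma> t) > 0" "\<And>t. s < t \<Longrightarrow> t \<le> 1 \<Longrightarrow> \<l> (\<gamma> t) < 0"
  shows "transversal_at \<phi> e f p"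
  unfolding transversal_at_def
proof (intro exI conjI allI impI)
  show "openin (top_of_set S2) D" "p \<in> D" by (fact D)+
  fix D' assume D': "openin (top_of_set S2) D' \<and> D' \<subseteq> D \<and> p \<in> D'"
  obtain U where U: "open U" "D' = S2 \<inter> U" using D' by (auto simp: openin_open)
  have "(\<gamma> \<longlongrightarrow> p) (at s)"
    using continuous_on_interior[OF \<gamma>(1), of s] s(1-3) by (simp add: isCont_def)
  then have "\<forall>\<^sub>F t in at s. \<gamma> t \<in> U" using U D' topological_tendstoD by blast
  then obtain d where d: "d > 0" "\<And>t. t \<noteq> s \<Longrightarrow> dist t s < d \<Longrightarrow> \<gamma> t \<in> U"
    by (auto simp: eventually_at)
  define \<delta> where "\<delta> = min (d / 2) (min s (1 - s))"
  have \<delta>: "0 < \<delta>" "\<delta> < d" "\<delta> \<le> s" "\<delta> \<le> 1 - s" using d s by (auto simp: \<delta>_def)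
  define y z where "y = \<gamma> (s - \<delta>)" and "z = \<gamma> (s + \<delta>)"
  have "y \<in> U" "z \<in> U" using d(2)[of "s - \<delta>"] d(2)[of "s + \<delta>"] \<delta> by (auto simp: y_def z_def dist_real_def)
  moreover have yz: "y \<in> \<phi> ` closed_cell f" "z \<in> \<phi> ` closed_cell f" "\<l> y > 0" "\<l> z < 0"
    using \<gamma>(2) s(4)[of "s - \<delta>"] s(5)[of "s + \<delta>"] \<delta> by (auto simp: y_def z_def image_subset_iff)
  ultimately have yzD: "y \<in> D'" "z \<in> D'" using U \<gamma>(3) by auto
  let ?S = "D' - \<phi> ` closed_cell e"
  have "y \<in> ?S" "z \<in> ?S" using yzD yz(3,4) \<l>(3) by fastforce+
  define A B where "A = connected_component_set ?S y" and "B = connected_component_set ?S z"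
  have AB: "A \<in> components ?S" "B \<in> components ?S" "y \<in> A" "z \<in> B"
    using \<open>y \<in> ?S\<close> \<open>z \<in> ?S\<close> by (auto simp: A_def B_def componentsI)
  have "A \<noteq> B"
  proof
    assume "A = B"
    have conn: "connected A" "A \<subseteq> ?S" using AB in_components_connected in_components_subset by blast+
    have "\<l> P \<noteq> 0" if "P \<in> A" for P using that conn(2) D' \<l>(2) by blast
    moreover have "connected (\<l> ` A)"
      using conn(1) \<l>(1) by (meson connected_continuous_image continuous_on_subset subset_UNIV)
    then have "{\<l> z..\<l> y} \<subseteq> \<l> ` A"
      using AB(3,4) \<open>A = B\<close> by (intro connected_contains_Icc) auto
    then have "0 \<in> \<l> ` A" using yz(3,4) by (simp add: subset_eq)
    ultimately show False by auto
  qed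
  then show "\<exists>(g, h)\<in>{(e, f), (f, e)}.
              \<exists>A\<in>components (D' - \<phi> ` closed_cell g). \<exists>B\<in>components (D' - \<phi> ` closed_cell g).
                A \<noteq> B \<and> A \<inter> \<phi> ` closed_cell h \<noteq> {} \<and> B \<inter> \<phi> ` closed_cell h \<noteq> {}"
    using AB yz(1,2) by blast
qed

text \<open>By the intermediate value theorem a connected set that avoids the image of
  \<open>T\<close> cannot leave the set where \<open>g\<close> is positive, so \<open>F\<close> is a
  whole component. Its closure adds only zeros of \<open>g\<close>, and by \<open>limit\<close> all
  of them.\<close>

lemma region_of_level_set:
  fixes \<phi> :: "('a \<Rightarrow> real) \<Rightarrow> real ^ 3" and g :: "real ^ 3 \<Rightarrow> real"
  assumes cont: "continuous_on UNIV g"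
    and F: "F = {P \<in> S2. g P > 0}" "connected F" "F \<noteq> {}"
    and G: "\<And>x. x \<in> realization G \<Longrightarrow> g (\<phi> x) \<le> 0"
    and T: "{P \<in> S2. g P = 0} = \<phi> ` realization T" "realization T \<subseteq> realization G"
    and limit: "\<And>P. P \<in> S2 \<Longrightarrow> g P = 0 \<Longrightarrow> P \<in> closure F"
  shows "F \<in> regions G \<phi>" "boundary F = \<phi> ` realization T"
proof -
  have "F \<subseteq> S2 - \<phi> ` realization G" using F(1) G by fastforce
  moreover have "D = F" if D: "F \<subseteq> D" "D \<subseteq> S2 - \<phi> ` realization G" "connected D" for D
  proof -
    have "connected (g ` D)"
      using D(3) cont by (meson connected_continuous_image continuous_on_subset subset_UNIV)
    moreover obtain P where "P \<in> D" "g P > 0" using F D(1) by blast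
    moreover have "g Q \<noteq> 0" if "Q \<in> D" for Q using that D(2) T by blast
    moreover have "0 \<in> g ` D" if "Q \<in> D" "g Q \<le> 0" for Q
    proof -
      have "{g Q..g P} \<subseteq> g ` D"
        using \<open>connected (g ` D)\<close> \<open>P \<in> D\<close> that(1) by (intro connected_contains_Icc) auto
      then show ?thesis using that(2) \<open>g P > 0\<close> by (simp add: subset_eq)
    qed
    ultimately have "g Q > 0" if "Q \<in> D" for Q using that by force
    then show ?thesis using D(1,2) F(1) by blast
  qed
  ultimately show "F \<in> regions G \<phi>"
    using F(2,3) unfolding regions_def in_components_maximal by blast
  have "closed {P. g P \<ge> 0}"
    using cont by (intro closed_Collect_le continuous_on_const) 
  then have "closed (S2 \<inter> {P. g P \<ge> 0})" by (intro closed_Int) auto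
  moreover have "F \<subseteq> S2 \<inter> {P. g P \<ge> 0}" using F(1) by auto
  ultimately have "closure F \<subseteq> S2 \<inter> {P. g P \<ge> 0}" using closure_minimal by blast
  then have "closure F - F = {P \<in> S2. g P = 0}" using F(1) limit by force
  then show "boundary F = \<phi> ` realization T" using T(1) by (simp add: boundary_def)
qed

text \<open>\<open>level r\<close> vanishes on the cone over the triangle with the vertices \<open>(1, 1, 1) + r e\<^sub>j\<close>.\<close>

definition min3 :: "real ^ 3 \<Rightarrow> real" where
  "min3 P = min (P $ 1) (min (P $ 2) (P $ 3))"

definition level :: "real \<Rightarrow> real ^ 3 \<Rightarrow> real" where
  "level r P = P $ 1 + P $ 2 + P $ 3 - (3 + r) * min3 P"

section \<open>The two sides of the zero set of \<open>level\<close>\<close>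

lemma continuous_on_level [continuous_intros]: "continuous_on S (level r)"
  unfolding level_def min3_def by (intro continuous_intros)

lemma min3_le: "min3 P \<le> P $ j"
  using exhaust_3[of j] by (auto simp: min3_def)

lemma min3_attained: "\<exists>k. min3 P = P $ k"
  by (auto simp: min3_def min_def)

lemma min3_scaleR: "c \<ge> 0 \<Longrightarrow> min3 (c *\<^sub>R P) = c * min3 P"
  by (simp add: min3_def min_mult_distrib_left)

lemma level_scaleR: "c \<ge> 0 \<Longrightarrow> level r (c *\<^sub>R P) = c * level r P"
  by (simp add: level_def min3_scaleR algebra_simps)

text \<open>Moving along the diagonal changes \<open>level\<close> linearly. Both the star shape of
  the positive side and the approximation of zeros from either side come from this.\<close>

lemma level_add_ones: "level r (P + vec c) = level r P - r * c"
  by (simp add: level_def min3_def min_add_distrib_right[symmetric] algebra_simps)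

lemma level_sgn: "level r (sgn P) = level r P / norm P"
  by (simp add: sgn_div_norm level_scaleR divide_inverse_commute)

lemma level_0 [simp]: "level r 0 = 0"
  by (simp add: level_def min3_def)

text \<open>The minimum is concave and enters with a negative coefficient.\<close>

lemma level_convex:
  assumes "r > 0" "0 \<le> s" "s \<le> 1"
  shows "level r ((1 - s) *\<^sub>R P + s *\<^sub>R Q) \<le> (1 - s) * level r P + s * level r Q"
proof -
  have "(1 - s) * min3 P + s * min3 Q \<le> min3 ((1 - s) *\<^sub>R P + s *\<^sub>R Q)"
    using assms unfolding min3_def
    by (simp add: min_mult_distrib_left[symmetric] del: min_less_iff_conj)
      (intro conjI add_mono mult_left_mono; simp)
  then have "(3 + r) * ((1 - s) * min3 P + s * min3 Q) \<le> (3 + r) * min3 ((1 - s) *\<^sub>R P + s *\<^sub>R Q)"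
    using assms by (intro mult_left_mono) auto
  then show ?thesis by (simp add: level_def algebra_simps)
qed

text \<open>Sign conditions on the positively homogeneous \<open>level\<close> describe cones.
  Connectedness is proved for the cone and carried to the sphere by \<open>sgn\<close>, which is
  continuous away from the origin.\<close>

lemma sphere_level_sgn:
  assumes "\<And>a x. a > 0 \<Longrightarrow> R (a * x) \<longleftrightarrow> R (x::real)" "\<not> R 0"
  shows "{P \<in> S2. R (level r P)} = sgn ` {P. R (level r P)}"
proof (intro set_eqI iffI)
  fix P assume "P \<in> {P \<in> S2. R (level r P)}"
  then show "P \<in> sgn ` {P. R (level r P)}"
    by (auto simp: image_iff sgn_div_norm intro!: bexI[of _ P])
next
  fix P assume "P \<in> sgn ` {P. R (level r P)}"
  then obtain Q where Q: "P = sgn Q" "R (level r Q)" by auto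
  then have "Q \<noteq> 0" using assms(2) by auto
  then show "P \<in> {P \<in> S2. R (level r P)}"
    using Q assms(1)[of "inverse (norm Q)" "level r Q"]
    by (simp add: level_sgn divide_inverse_commute norm_sgn)
qed

lemma sgn_continuous_on_nonzero: "0 \<notin> S \<Longrightarrow> continuous_on S (sgn :: real ^ 3 \<Rightarrow> real ^ 3)"
  by (intro continuous_on_sgn continuous_on_id) auto

lemma connected_level_neg:
  assumes "r > 0"
  shows "connected {P \<in> S2. - level r P > 0}" "{P \<in> S2. - level r P > 0} \<noteq> {}"
proof -
  have eq: "{P \<in> S2. - level r P > 0} = sgn ` {P. - level r P > 0}"
    by (rule sphere_level_sgn[of "\<lambda>x. - x > 0"]) (auto simp: zero_less_mult_iff mult_less_0_iff)
  have "convex {P. - level r P > 0}"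
  proof (rule convexI)
    fix P Q :: "real ^ 3" and u v :: real
    assume "P \<in> {P. - level r P > 0}" "Q \<in> {P. - level r P > 0}" "0 \<le> u" "0 \<le> v" "u + v = 1"
    moreover from this have "u = 1 - v" by simp
    ultimately have "level r (u *\<^sub>R P + v *\<^sub>R Q) \<le> u * level r P + v * level r Q" "level r P < 0" "level r Q < 0"
      using level_convex[OF assms, of v P Q] by simp_all
    moreover have "u * level r P + v * level r Q < 0"
      using \<open>level r P < 0\<close> \<open>level r Q < 0\<close> \<open>0 \<le> u\<close> \<open>0 \<le> v\<close> \<open>u + v = 1\<close>
      by (metis add_neg_nonpos add_nonpos_neg add_cancel_left_left less_eq_real_def mult_eq_0_iff mult_pos_neg mult_nonneg_nonpos zero_neq_one)
    ultimately show "u *\<^sub>R P + v *\<^sub>R Q \<in> {P. - level r P > 0}" by auto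
  qed
  then have "connected {P. - level r P > 0}" by (rule convex_connected)
  then show "connected {P \<in> S2. - level r P > 0}" unfolding eq
    by (rule connected_continuous_image[rotated]) (auto intro: sgn_continuous_on_nonzero)
  have "level r (vec 1) < 0" using assms by (simp add: level_def min3_def)
  then show "{P \<in> S2. - level r P > 0} \<noteq> {}" unfolding eq by auto
qed

text \<open>This cone is not convex but star-shaped around \<open>vec (- 1)\<close>, because steps
  in the direction of negative diagonal vectors raise \<open>level\<close>.\<close>

lemma connected_level_pos:
  assumes "r > 0"
  shows "connected {P \<in> S2. level r P > 0}" "{P \<in> S2. level r P > 0} \<noteq> {}"
proof -
  have eq: "{P \<in> S2. level r P > 0} = sgn ` {P. level r P > 0}"
    by (rule sphere_level_sgn[of "\<lambda>x. x > 0"]) (auto simp: zero_less_mult_iff)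
  have in1: "vec (- 1) \<in> {P. level r P > 0}" using assms by (simp add: level_def min3_def)
  have "starlike {P. level r P > 0}"
    unfolding starlike_def
  proof (intro bexI[OF _ in1] ballI subsetI)
    fix P Q assume P: "P \<in> {P. level r P > 0}" and Q: "Q \<in> closed_segment (vec (- 1)) P"
    then obtain u where u: "0 \<le> u" "u \<le> 1" "Q = (1 - u) *\<^sub>R vec (- 1) + u *\<^sub>R P"
      by (auto simp: in_segment)
    have "Q = u *\<^sub>R P + vec (- (1 - u))" using u(3) by (simp add: vec_eq_iff)
    then have "level r Q = u * level r P + r * (1 - u)" using u(1)
      by (simp add: level_add_ones level_scaleR algebra_simps)
    moreover have "u * level r P + r * (1 - u) > 0"
    proof (cases "u = 0")
      case False
      then show ?thesis using P u assms by (intro add_pos_nonneg) auto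
    qed (use assms in auto)
    ultimately show "Q \<in> {P. level r P > 0}" by simp
  qed
  then have "connected {P. level r P > 0}" by (rule starlike_imp_connected)
  then show "connected {P \<in> S2. level r P > 0}" unfolding eq
    by (rule connected_continuous_image[rotated]) (auto intro: sgn_continuous_on_nonzero)
  show "{P \<in> S2. level r P > 0} \<noteq> {}" unfolding eq using in1 by blast
qed

text \<open>Moving \<open>P\<close> by \<open>- \<sigma> * t\<close> along the diagonal adds
  \<open>r * \<sigma> * t\<close> to \<open>level\<close>, which has the sign of
  \<open>\<sigma>\<close>.\<close>

lemma level_zero_in_closure:
  assumes "r > 0" "P \<in> S2" "level r P = 0" "\<sigma> \<noteq> 0"
  shows "P \<in> closure {P \<in> S2. \<sigma> * level r P > 0}"
proof (rule Lim_in_closed_set)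
  define Q where "Q t = P + vec (- \<sigma> * t)" for t
  have "(Q \<longlongrightarrow> P + vec (- \<sigma> * 0)) (at_right 0)"
    unfolding Q_def vec_def by (intro tendsto_intros)
  then have "((\<lambda>t. sgn (Q t)) \<longlongrightarrow> sgn (P + vec (- \<sigma> * 0))) (at_right 0)"
    using assms(2) by (intro tendsto_sgn) auto
  then show "((\<lambda>t. sgn (Q t)) \<longlongrightarrow> P) (at_right 0)"
    using assms(2) by (simp add: sgn_div_norm)
  have "\<forall>\<^sub>F t in at_right 0. (0::real) < t" by (simp add: eventually_at_right_less)
  then show "\<forall>\<^sub>F t in at_right 0. sgn (Q t) \<in> closure {P \<in> S2. \<sigma> * level r P > 0}"
  proof (rule eventually_mono)
    fix t :: real assume "0 < t"
    have level: "level r (Q t) = r * \<sigma> * t" using assms(3) by (simp add: Q_def level_add_ones)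
    then have "Q t \<noteq> 0" using assms \<open>0 < t\<close> by auto
    moreover have "\<sigma> * level r (Q t) > 0"
    proof -
      have "\<sigma> * \<sigma> > 0" using assms(4) not_real_square_gt_zero by blast
      then have "r * t * (\<sigma> * \<sigma>) > 0" using assms(1) \<open>0 < t\<close> by simp
      then show ?thesis unfolding level by (simp only: ac_simps)
    qed
    ultimately have "sgn (Q t) \<in> {P \<in> S2. \<sigma> * level r P > 0}"
      by (simp add: norm_sgn level_sgn)
    then show "sgn (Q t) \<in> closure {P \<in> S2. \<sigma> * level r P > 0}" by (rule subsetD[OF closure_subset])
  qed
qed auto

section \<open>Nested triangles\<close>

lemma edge_param_swap: "edge_param u v t = edge_param v u (1 - t)"
  by (auto simp: edge_param_def fun_eq_iff)

lemma exists_third: "\<exists>k::3. k \<noteq> i \<and> k \<noteq> j"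
proof -
  have "card {i, j} < card (UNIV :: 3 set)" by (simp add: card_insert_if)
  then have "{i, j} \<noteq> UNIV" by force
  then show ?thesis by blast
qed

lemma three_indices:
  fixes i j k :: 3
  assumes "i \<noteq> j" "j \<noteq> k" "i \<noteq> k"
  shows "l \<in> {i, j, k}" "(\<Sum>l\<in>UNIV. f l) = f i + f j + (f k :: real)"
proof -
  have "{i, j, k} = (UNIV :: 3 set)"
    using assms by (intro card_subset_eq) auto
  then show "l \<in> {i, j, k}" by blast
  show "(\<Sum>l\<in>UNIV. f l) = f i + f j + f k"
    unfolding \<open>{i, j, k} = UNIV\<close>[symmetric] using assms by simp
qed

text \<open>The vertex in column \<open>j\<close> of layer \<open>i\<close> is drawn in the direction \<open>(1, 1, 1) + (i + 1) e\<^sub>j\<close>, and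
  edges are great circle arcs. A point is thus described by the vector \<open>wt\<close> of its coordinates
  in excess of \<open>(1, 1, 1)\<close>, one of which vanishes; the layers are nested triangles.\<close>

locale layered_drawing =
  fixes V :: "'a set" and lay :: "'a \<Rightarrow> nat" and col :: "'a \<Rightarrow> 3"
  assumes finite_V: "finite V"
    and lay_col_inj: "u \<in> V \<Longrightarrow> v \<in> V \<Longrightarrow> col u = col v \<Longrightarrow> lay u = lay v \<Longrightarrow> u = v"
begin

text \<open>The shift by 1 keeps layer 0 a proper triangle; radius 0 would send all its vertices to
  the direction (1, 1, 1).\<close>

definition rad :: "'a \<Rightarrow> real" where
  "rad v = real (lay v) + 1"

definition wt :: "('a \<Rightarrow> real) \<Rightarrow> real ^ 3" where
  "wt x = (\<chi> j. \<Sum>v\<in>{v \<in> V. col v = j}. x v * rad v)"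

definition draw :: "('a \<Rightarrow> real) \<Rightarrow> real ^ 3" where
  "draw x = sgn (vec 1 + wt x)"

definition layered :: "'a graph \<Rightarrow> bool" where
  "layered G \<longleftrightarrow> simple_graph G \<and> verts G \<subseteq> V \<and> (\<forall>u v. {u, v} \<in> edges G \<longrightarrow> lay u \<le> lay v + 1)"

text \<open>With \<open>rad u = R\<close> and \<open>rad v = R + 1\<close>, the points
  \<open>((1 - t) R, t (R + 1))\<close> and \<open>((1 - s) (R + 1), s R)\<close> of the two
  diagonals agree for \<open>t = R / (2 R + 1)\<close> and \<open>s = (R + 1) / (2 R + 1)\<close>.
  Both parameters have this form in terms of their own edge.\<close>

definition cross_point :: "'a \<Rightarrow> 'a \<Rightarrow> 'a \<Rightarrow> real" where
  "cross_point u v = edge_param u v (rad u / (rad u + rad v))"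

text \<open>The diagonals of the quadrangle between two columns and two consecutive layers, both
  oriented from the same column to the other: \<open>{u, v}\<close> rises by a layer and
  \<open>{u', v'}\<close> falls.\<close>

definition crossing_pair :: "'a graph \<Rightarrow> 'a \<Rightarrow> 'a \<Rightarrow> 'a \<Rightarrow> 'a \<Rightarrow> bool" where
  "crossing_pair G u v u' v' \<longleftrightarrow> {u, v} \<in> edges G \<and> {u', v'} \<in> edges G \<and>
     col u = col u' \<and> col v = col v' \<and> col u \<noteq> col v \<and>
     lay v = lay u + 1 \<and> lay u' = lay u + 1 \<and> lay v' = lay u"

section \<open>Collisions in the layered picture\<close>

lemma rad_pos [simp]: "rad v > 0" "rad v \<ge> 0" "rad v \<noteq> 0"
  by (simp_all add: rad_def)

lemma wt_edge:
  assumes "u \<in> V" "v \<in> V"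
  shows "wt (edge_param u v t) $ j = (if col u = j then (1 - t) * rad u else 0) + (if col v = j then t * rad v else 0)"
proof -
  have "edge_param u v t w * rad w = (if w = u then (1 - t) * rad u else 0) + (if w = v then t * rad v else 0)" for w
    by (simp add: edge_param_def algebra_simps)
  then show ?thesis
    using assms finite_V by (simp add: wt_def sum.distrib)
qed

text \<open>Separates points for which \<open>wt\<close> has one nonzero coordinate from those with
  two. In the case \<open>axis\<close>, the orientation towards the higher layer and
  \<open>t < 1\<close> make \<open>u\<close> and \<open>t\<close> unique; \<open>t = 0\<close>
  stands for a vertex.\<close>

lemma realization_cases:
  assumes "layered G" "x \<in> realization G"
  obtains (axis) u v t where "u \<in> verts G" "v \<in> verts G" "0 \<le> t" "t < 1" "x = edge_param u v t"
      "t \<noteq> 0 \<longrightarrow> {u, v} \<in> edges G \<and> col v = col u \<and> lay v = lay u + 1"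
    | (skew) u v t where "u \<in> verts G" "v \<in> verts G" "0 < t" "t < 1" "x = edge_param u v t"
      "{u, v} \<in> edges G" "col u \<noteq> col v"
proof -
  have G: "simple_graph G" "verts G \<subseteq> V" using assms(1) by (auto simp: layered_def)
  have vertex: thesis if "v \<in> verts G" "x = vertex_point v" for v
    using that by (intro axis[of v v 0]) auto
  show thesis
  proof (cases "x \<in> vertex_point ` verts G")
    case True then show thesis using vertex by blast
  next
    case False
    then obtain e where e: "e \<in> edges G" "x \<in> closed_cell e" using assms(2) by (auto simp: realization_def)
    obtain u v where uv: "e = {u, v}" "u \<noteq> v" "u \<in> verts G" "v \<in> verts G"
      using G(1) e(1) by (rule simple_graph_edgeE)
    obtain t where t: "0 \<le> t" "t \<le> 1" "x = edge_param u v t"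
      using e(2) uv(1) by (auto simp: closed_cell_edge)
    have t01: "0 < t" "t < 1"
      using t False uv(3,4) by (auto simp: less_le)
    have lay: "lay u \<le> lay v + 1" "lay v \<le> lay u + 1"
      using assms(1) e(1) uv(1) by (auto simp: layered_def insert_commute)
    consider "col u \<noteq> col v" | "col u = col v" "lay v = lay u + 1" | "col u = col v" "lay u = lay v + 1"
    proof -
      have "lay u \<noteq> lay v" if "col u = col v" using lay_col_inj that uv G(2) by blast
      then show ?thesis using that lay by linarith
    qed
    then show thesis
    proof cases
      case 1 then show thesis using skew t t01 uv e by blast
    next
      case 2 then show thesis using t t01 uv e by (intro axis[of u v t]) auto
    next
      case 3
      then show thesis
        using axis[of v u "1 - t"] t t01 uv e by (auto simp: edge_param_swap[of u v] insert_commute)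
    qed
  qed
qed

lemma wt_axis:
  assumes "u \<in> V" "v \<in> V" "t \<noteq> 0 \<longrightarrow> col v = col u \<and> lay v = lay u + 1"
  shows "wt (edge_param u v t) $ j = (if col u = j then rad u + t else 0)"
  unfolding wt_edge[OF assms(1,2)] using assms(3)
  by (cases "t = 0") (auto simp: rad_def algebra_simps)

lemma wt_nonneg:
  assumes "layered G" "x \<in> realization G"
  shows "wt x $ j \<ge> 0" "\<exists>j. wt x $ j = 0"
proof -
  have V: "verts G \<subseteq> V" using assms(1) by (simp add: layered_def)
  have "wt x $ j \<ge> 0 \<and> (\<exists>j. wt x $ j = 0)"
    using assms
  proof (cases rule: realization_cases)
    case (axis u v t)
    have "u \<in> V" "v \<in> V" using axis V by auto
    then have "wt x $ j = (if col u = j then rad u + t else 0)" for j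
      using axis wt_axis by simp
    moreover obtain k where "k \<noteq> col u" using exists_third by blast
    ultimately have "wt x $ j \<ge> 0" "wt x $ k = 0" using axis(3) by (simp_all add: add_nonneg_nonneg)
    then show ?thesis by blast
  next
    case (skew u v t)
    have "u \<in> V" "v \<in> V" using skew V by auto
    then have "wt x $ j = (if col u = j then (1 - t) * rad u else 0) + (if col v = j then t * rad v else 0)" for j
      using skew wt_edge by simp
    moreover obtain k where "k \<noteq> col u" "k \<noteq> col v" using exists_third by blast
    ultimately have "wt x $ j \<ge> 0" "wt x $ k = 0" using skew(3,4) by simp_all
    then show ?thesis by blast
  qed
  then show "wt x $ j \<ge> 0" "\<exists>j. wt x $ j = 0" by auto
qed

lemma ray_nonzero:
  assumes "layered G" "x \<in> realization G"
  shows "vec 1 + wt x \<noteq> 0"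
proof
  assume "vec 1 + wt x = 0"
  then have "(vec 1 + wt x) $ 1 = 0" by simp
  then show False using wt_nonneg(1)[OF assms, of 1] by simp
qed

lemma draw_in_sphere: "layered G \<Longrightarrow> x \<in> realization G \<Longrightarrow> draw x \<in> S2"
  using ray_nonzero by (simp add: draw_def norm_sgn)

lemma draw_scale:
  assumes "layered G" "x \<in> realization G"
  obtains c where "c > 0" "draw x = c *\<^sub>R (vec 1 + wt x)"
  using that[of "inverse (norm (vec 1 + wt x))"] ray_nonzero[OF assms]
  by (simp add: draw_def sgn_div_norm)

text \<open>The smallest coordinate of \<open>vec 1 + wt x\<close> is 1, as some coordinate of
  \<open>wt x\<close> vanishes. This normalizes the vector on its ray, so the scaling factors of two
  equal image points coincide.\<close>

lemma draw_eq_wt: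
  assumes "layered G" "x \<in> realization G" "y \<in> realization G" "draw x = draw y"
  shows "wt x = wt y"
proof -
  obtain c where c: "c > 0" "draw x = c *\<^sub>R (vec 1 + wt x)" using draw_scale[OF assms(1,2)] .
  obtain d where d: "d > 0" "draw y = d *\<^sub>R (vec 1 + wt y)" using draw_scale[OF assms(1,3)] .
  have eq: "c * (1 + wt x $ j) = d * (1 + wt y $ j)" for j
    using c(2) d(2) assms(4) by (metis vec_component vector_add_component vector_scaleR_component real_scaleR_def)
  obtain j k where jk: "wt x $ j = 0" "wt y $ k = 0" using wt_nonneg(2) assms by metis
  have "d * 1 \<le> d * (1 + wt y $ j)" "c * 1 \<le> c * (1 + wt x $ k)"
    using wt_nonneg(1)[OF assms(1,3), of j] wt_nonneg(1)[OF assms(1,2), of k] c(1) d(1)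
    by (intro mult_left_mono; simp)+
  then have "c = d" using eq[of j] eq[of k] jk by simp
  then show ?thesis using eq c(1) by (simp add: vec_eq_iff)
qed

text \<open>The equations force \<open>t < s\<close> and then \<open>lay v' < lay v\<close>. As
  edges join layers at distance at most one, the chain
  \<open>lay u < lay u' \<le> lay v' + 1 \<le> lay v \<le> lay u + 1\<close> leaves only the
  diagonals of a quadrangle, whose parameters the equations determine.\<close>

lemma skew_collision:
  assumes "layered G" and uv: "{u, v} \<in> edges G" "u \<in> V" "v \<in> V" and uv': "{u', v'} \<in> edges G" "u' \<in> V" "v' \<in> V"
    and col: "col u = col u'" "col v = col v'" "col u \<noteq> col v"
    and t: "0 < t" "t < 1" and s: "0 < s" "s < 1"
    and eq: "(1 - t) * rad u = (1 - s) * rad u'" "t * rad v = s * rad v'"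
    and less: "lay u < lay u'"
  shows "crossing_pair G u v u' v'" "edge_param u v t = cross_point u v" "edge_param u' v' s = cross_point u' v'"
proof -
  have near: "lay v \<le> lay u + 1" "lay u' \<le> lay v' + 1"
    using assms(1) uv(1) uv'(1) by (auto simp: layered_def insert_commute)
  have "t < s"
  proof (rule ccontr)
    assume "\<not> t < s"
    then have "(1 - t) * rad u \<le> (1 - s) * rad u" by (intro mult_right_mono) auto
    also have "\<dots> < (1 - s) * rad u'" using less s by (simp add: rad_def)
    finally show False using eq(1) by simp
  qed
  have "rad v' < rad v"
  proof (rule ccontr)
    assume "\<not> rad v' < rad v"
    then have "t * rad v \<le> t * rad v'" using t by (intro mult_left_mono) auto
    also have "\<dots> < s * rad v'" using \<open>t < s\<close> by simp
    finally show False using eq(2) by simp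
  qed
  then have "lay v' < lay v" by (simp add: rad_def)
  then have l: "lay v = lay u + 1" "lay u' = lay u + 1" "lay v' = lay u" using near less by linarith+
  then show "crossing_pair G u v u' v'" using col uv uv' by (simp add: crossing_pair_def)
  define i where "i = rad u"
  have r: "rad u = i" "rad v = i + 1" "rad u' = i + 1" "rad v' = i" using l by (simp_all add: i_def rad_def)
  have i: "i > 0" by (simp add: i_def)
  have "(1 - t) * i = (1 - s) * (i + 1)" "t * (i + 1) = s * i" using eq r by simp_all
  \<comment> \<open>Multiplying by \<open>i\<close> turns \<open>s\<close> into
    \<open>s * i\<close>, which the second equation expresses by \<open>t\<close>.\<close>
  then have "i * ((1 - t) * i) = (i - s * i) * (i + 1)" "s * i = t * (i + 1)" by (simp_all add: algebra_simps)
  then have "i * ((1 - t) * i) = (i - t * (i + 1)) * (i + 1)" by simp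
  then have t': "t * (2 * i + 1) = i" by (simp add: algebra_simps)
  have "(s * (2 * i + 1)) * i = (s * i) * (2 * i + 1)" by (simp add: algebra_simps)
  also have "\<dots> = (t * (2 * i + 1)) * (i + 1)"
    unfolding \<open>s * i = t * (i + 1)\<close> by (simp add: algebra_simps)
  also have "\<dots> = (i + 1) * i" unfolding t' by simp
  finally have "(s * (2 * i + 1)) * i = (i + 1) * i" .
  then have s': "s * (2 * i + 1) = i + 1" using i by simp
  have "t = i / (i + (i + 1))" "s = (i + 1) / ((i + 1) + i)"
    using t' s' i by (simp_all add: eq_divide_eq algebra_simps)
  then show "edge_param u v t = cross_point u v" "edge_param u' v' s = cross_point u' v'"
    unfolding cross_point_def r by simp_all
qed

lemma rad_sum_nonzero [simp]: "rad u + rad v > 0" "rad u + rad v \<noteq> 0"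
  using add_pos_pos[OF rad_pos(1)[of u] rad_pos(1)[of v]] by simp_all

lemma cross_point_commute: "cross_point u v = cross_point v u"
proof -
  have "1 - rad u / (rad u + rad v) = rad v / (rad v + rad u)"
    using rad_sum_nonzero(2)[of u v] rad_sum_nonzero(2)[of v u] by (simp add: field_simps del: rad_sum_nonzero)
  then show ?thesis by (simp add: cross_point_def edge_param_swap[of u v])
qed

lemma draw_collision:
  assumes G: "layered G" and xy: "x \<in> realization G" "y \<in> realization G" "draw x = draw y" "x \<noteq> y"
  obtains u v u' v' where "crossing_pair G u v u' v'" "x = cross_point u v" "y = cross_point u' v'"
proof -
  have V: "verts G \<subseteq> V" using G by (simp add: layered_def)
  have w: "wt x = wt y" using draw_eq_wt[OF G xy(1-3)] .
  have no_axis: False if "u \<in> verts G" "v \<in> verts G" "0 \<le> t" "x' = edge_param u v t"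
      "t \<noteq> 0 \<longrightarrow> {u, v} \<in> edges G \<and> col v = col u \<and> lay v = lay u + 1"
      "u' \<in> verts G" "v' \<in> verts G" "0 < s" "s < 1" "y' = edge_param u' v' s" "col u' \<noteq> col v'" "wt x' = wt y'"
    for u v t u' v' s x' y'
  proof -
    have in_V: "u \<in> V" "v \<in> V" "u' \<in> V" "v' \<in> V" using that V by auto
    have wy: "wt y' $ col u' > 0" "wt y' $ col v' > 0"
      using that wt_edge[OF in_V(3,4), of s] by simp_all
    have "wt x' $ j = (if col u = j then rad u + t else 0)" for j
      using that wt_axis[OF in_V(1,2)] by blast
    then have "col u = col u'" "col u = col v'" using wy that(12) by (metis less_irrefl)+
    then show False using that(11) by simp
  qed
  show thesis
    using G xy(1)
  proof (cases rule: realization_cases)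
    case x: (axis u v t)
    show thesis
      using G xy(2)
    proof (cases rule: realization_cases)
      case y: (axis u' v' s)
      have in_V: "u \<in> V" "v \<in> V" "u' \<in> V" "v' \<in> V" using x y V by auto
      have wx: "wt x $ j = (if col u = j then rad u + t else 0)" for j
        using wt_axis[OF in_V(1,2)] x by blast
      have wy: "wt y $ j = (if col u' = j then rad u' + s else 0)" for j
        using wt_axis[OF in_V(3,4)] y by blast
      have pos: "rad u + t > 0" using x(3) by (simp add: add_pos_nonneg)
      have "col u' = col u" using wx[of "col u"] wy[of "col u"] w pos by (auto split: if_splits)
      then have "rad u + t = rad u' + s" using wx[of "col u"] wy[of "col u"] w by simp
      then have "lay u = lay u'" using x(3,4) y(3,4) by (simp add: rad_def)
      then have "u = u'" "t = s"
        using \<open>col u' = col u\<close> \<open>rad u + t = _\<close> in_V lay_col_inj by (auto simp: rad_def)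
      moreover have "v = v'" if "t \<noteq> 0" using x(6) y(6) that in_V lay_col_inj \<open>u = u'\<close> \<open>t = s\<close> by simp
      ultimately have "x = y" using x(5) y(5) by (cases "t = 0") auto
      then show thesis using xy(4) by simp
    next
      case (skew u' v' s)
      then show thesis using no_axis[of u v t x u' v' s y] x w by simp
    qed
  next
    case x: (skew u v t)
    show thesis
      using G xy(2)
    proof (cases rule: realization_cases)
      case (axis u' v' s)
      then show thesis using no_axis[of u' v' s y u v t x] x w by simp
    next
      case y: (skew a b s)
      have in_V: "u \<in> V" "v \<in> V" "a \<in> V" "b \<in> V" using x y V by auto
      have wx: "wt x $ j = (if col u = j then (1 - t) * rad u else 0) + (if col v = j then t * rad v else 0)" for j
        using wt_edge[OF in_V(1,2)] x by simp
      have wy: "wt y $ j = (if col a = j then (1 - s) * rad a else 0) + (if col b = j then s * rad b else 0)" for j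
        using wt_edge[OF in_V(3,4)] y by simp
      have "wt x $ col u > 0" "wt x $ col v > 0" using wx x by simp_all
      then have "col u \<in> {col a, col b}" "col v \<in> {col a, col b}"
        using wy w by (auto split: if_splits)
      then have "(col u = col a \<and> col v = col b) \<or> (col u = col b \<and> col v = col a)"
        using x(7) by auto
      then have "\<exists>u' v' s'. {u', v'} \<in> edges G \<and> u' \<in> V \<and> v' \<in> V \<and> 0 < s' \<and> s' < 1 \<and> y = edge_param u' v' s' \<and>
          col u = col u' \<and> col v = col v'"
      proof
        assume "col u = col a \<and> col v = col b"
        then show ?thesis using y in_V by blast
      next
        assume "col u = col b \<and> col v = col a"
        moreover have "{b, a} \<in> edges G" using y(6) by (simp add: insert_commute)
        moreover have "y = edge_param b a (1 - s)" using y(5) edge_param_swap[of a b s] by simp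
        moreover have "0 < 1 - s" "1 - s < 1" using y(3,4) by simp_all
        ultimately show ?thesis using in_V by blast
      qed
      then obtain u' v' s' where y': "{u', v'} \<in> edges G" "u' \<in> V" "v' \<in> V" "0 < s'" "s' < 1" "y = edge_param u' v' s'"
          "col u = col u'" "col v = col v'" by blast
      have eq: "(1 - t) * rad u = (1 - s') * rad u'" "t * rad v = s' * rad v'"
        using wx[of "col u"] wx[of "col v"] wt_edge[OF y'(2,3), of s'] w x(7) y' by (simp_all split: if_splits)
      consider "lay u < lay u'" | "lay u' < lay u" | "lay u = lay u'" by linarith
      then show thesis
      proof cases
        case 1
        then show thesis
          using that skew_collision[OF G x(6) in_V(1,2) y'(1-3) y'(7,8) x(7,3,4) y'(4,5) eq] x(5) y'(6) by blast
      next
        case 2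
        have "col u' \<noteq> col v'" using y' x(7) by simp
        note sk = skew_collision[OF G y'(1-3) x(6) in_V(1,2) y'(7,8)[symmetric] this y'(4,5) x(3,4) eq[symmetric] 2]
        \<comment> \<open>To list the edge of \<open>x\<close> as the first one, the columns are
          exchanged: its lower end is now \<open>v\<close>.\<close>
        have "crossing_pair G v u v' u'"
          using sk(1) by (auto simp: crossing_pair_def insert_commute)
        then show thesis
          using that[of v u v' u'] sk(2,3) x(5) y'(6) by (simp add: cross_point_commute)
      next
        case 3
        then have "u = u'" using lay_col_inj in_V y' by blast
        then have "t = s'" using eq(1) by simp
        then have "rad v = rad v'" using eq(2) x(3) by simp
        then have "v = v'" using lay_col_inj in_V y' by (simp add: rad_def)
        then show thesis using xy(4) x(5) y'(6) \<open>u = u'\<close> \<open>t = s'\<close> by simp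
      qed
    qed
  qed
qed

section \<open>The layered picture is a simple 1-drawing\<close>

lemma crossing_pair_verts:
  assumes "layered G" "crossing_pair G u v u' v'"
  shows "{u, v, u', v'} \<subseteq> V" "distinct [u, v, u', v']"
proof -
  have "\<forall>e\<in>edges G. e \<subseteq> V" using assms(1) by (auto simp: layered_def simple_graph_def)
  then show "{u, v, u', v'} \<subseteq> V" using assms(2) by (auto simp: crossing_pair_def)
  show "distinct [u, v, u', v']" using assms(2) by (auto simp: crossing_pair_def)
qed

lemma cross_param_range: "0 < rad u / (rad u + rad v)" "rad u / (rad u + rad v) < 1"
  by (simp_all add: divide_less_eq)

lemma edge_param_open_cell:
  assumes "u \<noteq> v" "0 < t" "t < 1"
  shows "edge_param u v t \<in> open_cell {u, v}"
proof -
  have "edge_param u v t \<in> closed_cell {u, v}" using assms by (auto simp: closed_cell_edge)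
  then show ?thesis using assms by (auto simp: open_cell_def edge_param_def)
qed

lemma cross_point_open_cell: "u \<noteq> v \<Longrightarrow> cross_point u v \<in> open_cell {u, v}"
  unfolding cross_point_def using cross_param_range by (intro edge_param_open_cell)

lemma cross_point_realization:
  assumes "{u, v} \<in> edges G" "u \<noteq> v"
  shows "cross_point u v \<in> realization G"
  using cross_point_open_cell[OF assms(2)] open_cell_subset realization_closed_cell[OF assms(1)] by blast

lemma cross_point_eq_iff:
  assumes "u \<noteq> v" "p \<noteq> q" "cross_point u v = cross_point p q"
  shows "{u, v} = {p, q}"
  using support_open_cell[OF cross_point_open_cell[OF assms(1)]]
    support_open_cell[OF cross_point_open_cell[OF assms(2)]] assms(3) by simp

text \<open>The first edge rises, which fixes the order of its ends; column and layer then determine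
  the ends of the other diagonal.\<close>

lemma crossing_pair_unique:
  assumes "layered G" "crossing_pair G u v u' v'" "crossing_pair G p q p' q'" "{u, v} = {p, q}"
  shows "p = u" "q = v" "p' = u'" "q' = v'"
proof -
  show pq: "p = u" "q = v"
    using assms(2-4) by (auto simp: crossing_pair_def doubleton_eq_iff)
  have "{u, v, u', v'} \<subseteq> V" "{p, q, p', q'} \<subseteq> V"
    using crossing_pair_verts(1)[OF assms(1)] assms(2,3) by blast+
  moreover have "col p' = col u'" "lay p' = lay u'" "col q' = col v'" "lay q' = lay v'"
    using assms(2,3) pq by (simp_all add: crossing_pair_def)
  ultimately show "p' = u'" "q' = v'" using lay_col_inj by simp_all
qed

lemma continuous_on_draw:
  assumes "layered G"
  shows "continuous_on (realization G) draw"
proof -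
  have "continuous_on (realization G) wt"
    unfolding wt_def
    by (intro continuous_on_vec_lambda continuous_intros)
      (auto intro: continuous_on_subset[OF continuous_on_product_coordinates])
  then show ?thesis
    unfolding draw_def using ray_nonzero[OF assms] by (intro continuous_intros) auto
qed

lemma draw_eqI:
  assumes "P \<in> S2" "m > 0" "\<And>i. P $ i = m * (1 + wt x $ i)"
  shows "draw x = P"
proof -
  have "P = m *\<^sub>R (vec 1 + wt x)" using assms(3) by (simp add: vec_eq_iff)
  then have "sgn P = sgn (vec 1 + wt x)" using assms(2) by (simp add: sgn_scaleR)
  moreover have "sgn P = P" using assms(1) by (simp add: sgn_div_norm)
  ultimately show ?thesis by (simp add: draw_def)
qed

lemma transversal_draw:
  assumes G: "layered G" and pair: "crossing_pair G u v u' v'"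
    and eq: "draw (cross_point u v) = draw (cross_point u' v')"
  shows "transversal_at draw {u, v} {u', v'} (draw (cross_point u v))"
proof -
  have V: "u \<in> V" "v \<in> V" "u' \<in> V" "v' \<in> V" and dist: "distinct [u, v, u', v']"
    using crossing_pair_verts[OF G pair] by auto
  have E: "{u, v} \<in> edges G" "{u', v'} \<in> edges G" using pair by (auto simp: crossing_pair_def)
  define i j where "i = col u" and "j = col v"
  have ij: "i \<noteq> j" "col u' = i" "col v' = j" using pair by (auto simp: crossing_pair_def i_def j_def)
  obtain k where k: "k \<noteq> i" "k \<noteq> j" using exists_third by blast
  define R where "R = rad u"
  have R: "R > 0" "rad v = R + 1" "rad u' = R + 1" "rad v' = R"
    using pair by (auto simp: crossing_pair_def R_def rad_def)
  \<comment> \<open>The intercept form of the line through \<open>R e_i\<close> and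
    \<open>(R + 1) e_j\<close> in the excess coordinates, made homogeneous by means of
    \<open>P $ k\<close>. In \<open>D\<close>, where \<open>P $ k\<close> is the strict minimum, its
    zeros belong to the edge \<open>{u, v}\<close>.\<close>
  define \<l> where "\<l> P = (P $ i - P $ k) / R + (P $ j - P $ k) / (R + 1) - P $ k" for P :: "real ^ 3"
  define D where "D = S2 \<inter> {P. P $ k < P $ i \<and> P $ k < P $ j}"
  have wt1: "wt (edge_param u v t) $ i = (1 - t) * R" "wt (edge_param u v t) $ j = t * (R + 1)"
    "wt (edge_param u v t) $ k = 0" for t
    using wt_edge[OF V(1,2)] ij k R(2) by (simp_all add: i_def j_def R_def)
  have wt2: "wt (edge_param u' v' t) $ i = (1 - t) * (R + 1)" "wt (edge_param u' v' t) $ j = t * R"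
    "wt (edge_param u' v' t) $ k = 0" for t
    using wt_edge[OF V(3,4)] ij k R by simp_all
  have cell: "closed_cell {u, v} \<subseteq> realization G" "closed_cell {u', v'} \<subseteq> realization G"
    using E realization_closed_cell by blast+
  have \<l>_scale: "\<l> P = c * ((w i - w k) / R + (w j - w k) / (R + 1) - 1 - w k)"
    if "\<And>l. P $ l = c * (1 + w l)" for P c w
    using R(1) unfolding \<l>_def that by (simp add: field_simps)
  show ?thesis
  proof (rule transversal_atI[where D = D and \<l> = \<l> and \<gamma> = "\<lambda>t. draw (edge_param u' v' t)"
        and s = "rad u' / (rad u' + rad v')"])
    have "open {P :: real ^ 3. P $ k < P $ i \<and> P $ k < P $ j}"
      by (intro open_Collect_conj open_Collect_less continuous_intros)
    then show "openin (top_of_set S2) D" unfolding D_def by (rule openin_open_Int)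
    show "draw (cross_point u v) \<in> D"
    proof -
      have re: "cross_point u v \<in> realization G" using cross_point_realization[OF E(1)] dist by simp
      obtain c where c: "c > 0" "draw (cross_point u v) = c *\<^sub>R (vec 1 + wt (cross_point u v))"
        using draw_scale[OF G re] .
      define t where "t = rad u / (rad u + rad v)"
      have t: "0 < t" "t < 1" using cross_param_range by (auto simp: t_def)
      have "draw (cross_point u v) $ l = c * (1 + wt (edge_param u v t) $ l)" for l
        by (subst c(2)) (simp add: cross_point_def t_def)
      then show ?thesis
        using draw_in_sphere[OF G re] t c(1) R(1) wt1[of t] by (simp add: D_def)
    qed
    show "continuous_on UNIV \<l>" unfolding \<l>_def by (intro continuous_intros) (use R in auto)
    show "{P \<in> D. \<l> P = 0} \<subseteq> draw ` closed_cell {u, v}"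
    proof
      fix P assume "P \<in> {P \<in> D. \<l> P = 0}"
      then have P: "P \<in> S2" "P $ k < P $ i" "P $ k < P $ j" "\<l> P = 0" by (auto simp: D_def)
      define m where "m = P $ k"
      \<comment> \<open>\<open>A / m\<close> and \<open>B / m\<close> are the barycentric
        coordinates of the preimage of \<open>P\<close>; the equation \<open>\<l> P = 0\<close> says
        that they add up to 1.\<close>
      define A B where "A = (P $ i - m) / R" and "B = (P $ j - m) / (R + 1)"
      have sum: "A + B = m" using P(4) by (simp add: \<l>_def m_def A_def B_def)
      have pos: "A > 0" "B > 0" using P R by (simp_all add: m_def A_def B_def)
      then have m: "m > 0" using sum by linarith
      have Pij: "P $ i = m + A * R" "P $ j = m + B * (R + 1)" using R(1) by (simp_all add: A_def B_def)
      define t where "t = B / m"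
      have "A / m + B / m = 1" using sum m by (simp add: add_divide_distrib[symmetric])
      then have t': "1 - t = A / m" by (simp add: t_def)
      have "0 < A / m" "0 < B / m" using pos m by simp_all
      then have t: "0 \<le> t" "t \<le> 1" using t' unfolding t_def by linarith+
      have "draw (edge_param u v t) = P"
      proof (rule draw_eqI[OF P(1) m])
        fix l
        have "P $ i = m * (1 + wt (edge_param u v t) $ i)" 
          unfolding wt1 t' Pij using m by (simp add: distrib_left)
        moreover have "P $ j = m * (1 + wt (edge_param u v t) $ j)" 
          unfolding wt1 t_def Pij using m by (simp add: distrib_left)
        moreover have "P $ k = m * (1 + wt (edge_param u v t) $ k)" unfolding wt1 by (simp add: m_def)
        moreover have "l \<in> {i, j, k}" by (rule three_indices) (use ij k in auto)
        ultimately show "P $ l = m * (1 + wt (edge_param u v t) $ l)" by blast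
      qed
      then show "P \<in> draw ` closed_cell {u, v}" using t by (auto simp: closed_cell_edge)
    qed
    show "\<l> (draw x) = 0" if x: "x \<in> closed_cell {u, v}" for x
    proof -
      obtain t where t: "x = edge_param u v t" using x by (auto simp: closed_cell_edge)
      obtain c where c: "c > 0" "draw x = c *\<^sub>R (vec 1 + wt x)" using draw_scale[OF G] x cell by blast
      have "\<l> (draw x) = c * ((wt x $ i - wt x $ k) / R + (wt x $ j - wt x $ k) / (R + 1) - 1 - wt x $ k)"
        by (rule \<l>_scale) (simp add: c(2))
      then show ?thesis unfolding t wt1 using R(1) by simp
    qed
    show "continuous_on {0..1} (\<lambda>t. draw (edge_param u' v' t))"
    proof (rule continuous_on_compose2[OF continuous_on_draw[OF G] continuous_on_edge_param])
      show "edge_param u' v' ` {0..1} \<subseteq> realization G" using cell(2) by (simp add: closed_cell_edge)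
    qed
    show "(\<lambda>t. draw (edge_param u' v' t)) ` {0..1} \<subseteq> draw ` closed_cell {u', v'}"
      by (auto simp: closed_cell_edge)
    show "draw ` closed_cell {u', v'} \<subseteq> S2" using cell(2) draw_in_sphere[OF G] by blast
    show "0 < rad u' / (rad u' + rad v')" "rad u' / (rad u' + rad v') < 1" by (rule cross_param_range)+
    show "draw (edge_param u' v' (rad u' / (rad u' + rad v'))) = draw (cross_point u v)"
      using eq by (simp add: cross_point_def)
    have sign: "\<exists>c>0. \<l> (draw (edge_param u' v' t)) = c * (R + 1 - t * (2 * R + 1))" if t: "0 \<le> t" "t \<le> 1" for t
    proof -
      let ?x = "edge_param u' v' t"
      have "?x \<in> realization G" using cell(2) t by (auto simp: closed_cell_edge)
      then obtain c where c: "c > 0" "draw ?x = c *\<^sub>R (vec 1 + wt ?x)" using draw_scale[OF G] by blast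
      have "\<l> (draw ?x) = c * ((wt ?x $ i - wt ?x $ k) / R + (wt ?x $ j - wt ?x $ k) / (R + 1) - 1 - wt ?x $ k)"
        by (rule \<l>_scale) (simp add: c(2))
      also have "(wt ?x $ i - wt ?x $ k) / R + (wt ?x $ j - wt ?x $ k) / (R + 1) - 1 - wt ?x $ k =
          ((1 - t) * (R + 1) * (R + 1) + t * R * R - R * (R + 1)) / (R * (R + 1))"
        unfolding wt2 using R(1) by (simp add: add_divide_distrib diff_divide_distrib)
      also have "(1 - t) * (R + 1) * (R + 1) + t * R * R - R * (R + 1) = R + 1 - t * (2 * R + 1)"
        by (simp add: algebra_simps)
      finally have "\<l> (draw ?x) = c / (R * (R + 1)) * (R + 1 - t * (2 * R + 1))" by simp
      moreover have "c / (R * (R + 1)) > 0" using c(1) R(1) by simp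
      ultimately show ?thesis by blast
    qed
    have s: "rad u' / (rad u' + rad v') = (R + 1) / (2 * R + 1)" unfolding R by simp
    show "\<l> (draw (edge_param u' v' t)) > 0" if t: "0 \<le> t" "t < rad u' / (rad u' + rad v')" for t
    proof -
      have "t < 1" using t(2) cross_param_range(2)[of u' v'] by linarith
      then obtain c where "c > 0" "\<l> (draw (edge_param u' v' t)) = c * (R + 1 - t * (2 * R + 1))"
        using sign[of t] t(1) by auto
      moreover have "t * (2 * R + 1) < R + 1" using t(2) R(1) unfolding s by (simp add: less_divide_eq)
      ultimately show ?thesis by simp
    qed
    show "\<l> (draw (edge_param u' v' t)) < 0" if t: "rad u' / (rad u' + rad v') < t" "t \<le> 1" for t
    proof -
      have "0 < t" using t(1) cross_param_range(1)[of u' v'] by linarith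
      then obtain c where "c > 0" "\<l> (draw (edge_param u' v' t)) = c * (R + 1 - t * (2 * R + 1))"
        using sign[of t] t(2) by auto
      moreover have "R + 1 < t * (2 * R + 1)" using t(1) R(1) unfolding s by (simp add: divide_less_eq)
      ultimately show ?thesis by (simp add: mult_pos_neg)
    qed
  qed
qed

lemma draw_collision_preimages:
  assumes G: "layered G" and xy: "x \<in> realization G" "y \<in> realization G" "draw x = draw y" "x \<noteq> y"
  shows "{z \<in> realization G. draw z = draw x} = {x, y}"
proof -
  obtain u v u' v' where pair: "crossing_pair G u v u' v'" "x = cross_point u v" "y = cross_point u' v'"
    using draw_collision[OF assms] .
  have "z = y" if z: "z \<in> realization G" "draw z = draw x" "z \<noteq> x" for z
  proof -
    obtain p q p' q' where pair': "crossing_pair G p q p' q'" "x = cross_point p q" "z = cross_point p' q'"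
      using draw_collision[OF G xy(1) z(1) z(2)[symmetric] z(3)[symmetric]] .
    have "u \<noteq> v" "p \<noteq> q"
      using crossing_pair_verts(2)[OF G pair(1)] crossing_pair_verts(2)[OF G pair'(1)] by simp_all
    then have "{u, v} = {p, q}"
      by (rule cross_point_eq_iff) (use pair(2) pair'(2) in simp)
    from crossing_pair_unique(3,4)[OF G pair(1) pair'(1) this] show ?thesis using pair(3) pair'(3) by simp
  qed
  then show ?thesis using xy by auto
qed

lemma crossings_draw:
  assumes "layered G" "x \<in> realization G" "draw x \<in> crossings G draw"
  obtains u v u' v' where "crossing_pair G u v u' v'" "x = cross_point u v" "draw x = draw (cross_point u' v')"
proof -
  obtain y z where "y \<in> realization G" "z \<in> realization G" "y \<noteq> z" "draw y = draw x" "draw z = draw x"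
    using assms(3) by (auto simp: crossings_def)
  then obtain y where "y \<in> realization G" "y \<noteq> x" "draw y = draw x" by metis
  then show ?thesis using draw_collision[OF assms(1,2), of y] that by metis
qed

lemma open_cell_cross_point:
  assumes "cross_point u v \<in> open_cell e" "u \<noteq> v"
  shows "e = {u, v}"
  using support_open_cell[OF assms(1)] support_open_cell[OF cross_point_open_cell[OF assms(2)]] by simp

lemma drawing_draw:
  assumes G: "layered G"
  shows "drawing G draw"
  unfolding drawing_def
proof (intro conjI ballI impI)
  show "continuous_on (realization G) draw" by (rule continuous_on_draw[OF G])
  show "draw ` realization G \<subseteq> S2" using draw_in_sphere[OF G] by blast
  show "x = vertex_point v" if v: "v \<in> verts G" "x \<in> realization G" "draw (vertex_point v) = draw x" for v x
  proof (rule ccontr)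
    assume "x \<noteq> vertex_point v"
    then obtain p q p' q' where pair: "crossing_pair G p q p' q'" "vertex_point v = cross_point p q"
      using draw_collision[OF G vertex_point_realization[OF v(1)] v(2,3)] by metis
    have "p \<noteq> q" using crossing_pair_verts(2)[OF G pair(1)] by simp
    then have "{w. vertex_point v w \<noteq> 0} = {p, q}"
      using support_open_cell[OF cross_point_open_cell] pair(2) by metis
    then show False using \<open>p \<noteq> q\<close> by auto
  qed
  have "crossings G draw \<subseteq> (\<lambda>(u, v). draw (cross_point u v)) ` (V \<times> V)"
  proof
    fix p assume p: "p \<in> crossings G draw"
    then obtain x where x: "x \<in> realization G" "p = draw x" by (auto simp: crossings_def)
    obtain u v u' v' where "crossing_pair G u v u' v'" "x = cross_point u v"
      using crossings_draw[OF G x(1)] p x(2) by metis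
    then show "p \<in> (\<lambda>(u, v). draw (cross_point u v)) ` (V \<times> V)"
      using crossing_pair_verts(1)[OF G] x(2) by force
  qed
  then show "finite (crossings G draw)" by (rule finite_subset) (use finite_V in simp)
  fix p assume p: "p \<in> crossings G draw"
  then obtain x y where xy: "x \<in> realization G" "y \<in> realization G" "x \<noteq> y" "draw x = p" "draw y = p"
    by (auto simp: crossings_def)
  then have eq: "draw x = draw y" by simp
  obtain u v u' v' where pair: "crossing_pair G u v u' v'" "x = cross_point u v" "y = cross_point u' v'"
    using draw_collision[OF G xy(1,2) eq xy(3)] .
  have dist: "distinct [u, v, u', v']" by (rule crossing_pair_verts(2)[OF G pair(1)])
  have "{u, v} \<in> edges G" "{u', v'} \<in> edges G" using pair(1) by (auto simp: crossing_pair_def)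
  moreover have "{u, v} \<noteq> {u', v'}" using dist by auto
  moreover have "{z \<in> realization G. draw z = p} = {x, y}"
    using draw_collision_preimages[OF G xy(1,2) eq xy(3)] xy(4) by simp
  moreover have "x \<in> open_cell {u, v}" "y \<in> open_cell {u', v'}" using pair dist cross_point_open_cell by simp_all
  moreover have "transversal_at draw {u, v} {u', v'} p"
    using transversal_draw[OF G pair(1)] eq pair(2,3) xy(4) by simp
  ultimately show "\<exists>e\<in>edges G. \<exists>f\<in>edges G. e \<noteq> f \<and>
          (\<exists>x\<in>open_cell e. \<exists>y\<in>open_cell f. {z \<in> realization G. draw z = p} = {x, y}) \<and>
          transversal_at draw e f p"
    by (intro bexI[of _ "{u, v}"] bexI[of _ "{u', v'}"] bexI[of _ x] bexI[of _ y] conjI) simp_all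
qed

lemma involved_draw:
  assumes G: "layered G" and "e \<in> edges G" "involved G draw e p"
  obtains u v u' v' where "crossing_pair G u v u' v'" "e = {u, v}" "p = draw (cross_point u v)"
proof -
  obtain x where x: "x \<in> open_cell e" "p = draw x" "p \<in> crossings G draw"
    using assms(3) by (auto simp: involved_def)
  have re: "x \<in> realization G" using x(1) open_cell_subset realization_closed_cell[OF assms(2)] by blast
  obtain u v u' v' where uv: "crossing_pair G u v u' v'" "x = cross_point u v"
    using crossings_draw[OF G re] x(2,3) by metis
  have "u \<noteq> v" using crossing_pair_verts(2)[OF G uv(1)] by simp
  then show ?thesis using that uv x open_cell_cross_point by metis
qed

lemma one_drawing_draw:
  assumes G: "layered G"
  shows "one_drawing G draw"
  unfolding one_drawing_def
proof (intro conjI ballI allI impI)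
  fix e p q assume e: "e \<in> edges G" and "involved G draw e p \<and> involved G draw e q"
  then have inv: "involved G draw e p" "involved G draw e q" by auto
  obtain u v u' v' where uv: "crossing_pair G u v u' v'" "e = {u, v}" "p = draw (cross_point u v)"
    using involved_draw[OF G e inv(1)] .
  obtain s t s' t' where st: "crossing_pair G s t s' t'" "e = {s, t}" "q = draw (cross_point s t)"
    using involved_draw[OF G e inv(2)] .
  show "p = q" using crossing_pair_unique[OF G uv(1) st(1)] uv st by simp
qed (rule drawing_draw[OF G])

lemma simple_drawing_draw:
  assumes G: "layered G"
  shows "simple_drawing G draw"
  unfolding simple_drawing_def
proof (intro conjI ballI impI)
  show "drawing G draw" by (rule drawing_draw[OF G])
  fix e f assume ef: "e \<in> edges G" "f \<in> edges G" "e \<noteq> f \<and> e \<inter> f \<noteq> {}"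
  show "\<not> edges_cross G draw e f"
  proof
    assume "edges_cross G draw e f"
    then obtain x y where xy: "x \<in> open_cell e" "y \<in> open_cell f" "draw x = draw y"
      by (auto simp: edges_cross_def involved_def)
    have "x \<noteq> y" using support_open_cell[OF xy(1)] support_open_cell[OF xy(2)] ef(3) by auto
    moreover have "x \<in> realization G" "y \<in> realization G"
      using xy ef open_cell_subset realization_closed_cell by blast+
    ultimately obtain u v u' v' where uv: "crossing_pair G u v u' v'" "x = cross_point u v" "y = cross_point u' v'"
      using draw_collision[OF G _ _ xy(3)] by metis
    have dist: "distinct [u, v, u', v']" by (rule crossing_pair_verts(2)[OF G uv(1)])
    then have "e = {u, v}" "f = {u', v'}" using uv xy open_cell_cross_point by simp_all
    then show False using dist ef(3) by auto
  qed
qed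

section \<open>Layers as facial triangles\<close>

definition layer_triangle :: "nat \<Rightarrow> 'a graph \<Rightarrow> bool" where
  "layer_triangle L T \<longleftrightarrow> simple_graph T \<and> verts T \<subseteq> V \<and> lay ` verts T \<subseteq> {L} \<and> col ` verts T = UNIV \<and>
     (\<forall>u\<in>verts T. \<forall>v\<in>verts T. u \<noteq> v \<longrightarrow> {u, v} \<in> edges T)"

lemma layer_triangle_layered: "layer_triangle L T \<Longrightarrow> layered T"
  unfolding layer_triangle_def layered_def simple_graph_def by (auto simp: image_subset_iff)

text \<open>Before normalization the smallest coordinate is 1, so \<open>level r\<close> is the sum
  of the excess coordinates minus \<open>r\<close>. This sum is the height of a point among the
  layers.\<close>

lemma level_draw:
  assumes G: "layered G" and x: "x \<in> realization G"
  obtains c where "c > 0" "level r (draw x) = c * ((\<Sum>j\<in>UNIV. wt x $ j) - r)"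
proof -
  obtain c where c: "c > 0" "draw x = c *\<^sub>R (vec 1 + wt x)" using draw_scale[OF assms] .
  obtain k where k: "wt x $ k = 0" using wt_nonneg(2)[OF assms] by blast
  obtain l where l: "min3 (vec 1 + wt x) = (vec 1 + wt x) $ l" using min3_attained by blast
  have "min3 (vec 1 + wt x) = 1"
    using min3_le[of "vec 1 + wt x" k] k l wt_nonneg(1)[OF assms, of l] by simp
  then have "level r (vec 1 + wt x) = (\<Sum>j\<in>UNIV. wt x $ j) - r"
    by (simp add: level_def sum_3)
  then show ?thesis using that[OF c(1)] c by (simp add: level_scaleR)
qed

text \<open>Edges interpolate linearly between the radii of their ends, so a graph below or above a
  layer stays on one side of the triangle of that layer.\<close>

lemma wt_sum:
  assumes G: "layered G" and x: "x \<in> realization G"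
  obtains u v t where "u \<in> verts G" "v \<in> verts G" "0 \<le> t" "t \<le> 1"
    "(\<Sum>j\<in>UNIV. wt x $ j) = (1 - t) * rad u + t * rad v"
proof -
  have "\<exists>u\<in>verts G. \<exists>v\<in>verts G. \<exists>t. 0 \<le> t \<and> t \<le> 1 \<and> x = edge_param u v t"
    using assms
  proof (cases rule: realization_cases)
    case (axis u v t)
    then show ?thesis using less_imp_le by blast
  next
    case (skew u v t)
    then show ?thesis using less_imp_le by blast
  qed
  then obtain u v t where *: "u \<in> verts G" "v \<in> verts G" "0 \<le> t" "t \<le> 1" "x = edge_param u v t"
    by blast
  then have "u \<in> V" "v \<in> V" using G by (auto simp: layered_def)
  then have "(\<Sum>j\<in>UNIV. wt x $ j) = (1 - t) * rad u + t * rad v"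
    unfolding *(5) wt_edge[OF \<open>u \<in> V\<close> \<open>v \<in> V\<close>] sum.distrib by simp
  then show ?thesis using that * by blast
qed

lemma wt_sum_le:
  assumes "layered G" "x \<in> realization G" "\<And>v. v \<in> verts G \<Longrightarrow> lay v \<le> L"
  shows "(\<Sum>j\<in>UNIV. wt x $ j) \<le> real L + 1"
proof -
  obtain u v t where *: "u \<in> verts G" "v \<in> verts G" "0 \<le> t" "t \<le> 1"
    "(\<Sum>j\<in>UNIV. wt x $ j) = (1 - t) * rad u + t * rad v" using wt_sum[OF assms(1,2)] .
  have "(1 - t) * rad u + t * rad v \<le> (1 - t) * (real L + 1) + t * (real L + 1)"
    using * assms(3) by (intro add_mono mult_left_mono) (auto simp: rad_def)
  then show ?thesis using * by (simp add: algebra_simps)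
qed

lemma wt_sum_ge:
  assumes "layered G" "x \<in> realization G" "\<And>v. v \<in> verts G \<Longrightarrow> L \<le> lay v"
  shows "real L + 1 \<le> (\<Sum>j\<in>UNIV. wt x $ j)"
proof -
  obtain u v t where *: "u \<in> verts G" "v \<in> verts G" "0 \<le> t" "t \<le> 1"
    "(\<Sum>j\<in>UNIV. wt x $ j) = (1 - t) * rad u + t * rad v" using wt_sum[OF assms(1,2)] .
  have "(1 - t) * (real L + 1) + t * (real L + 1) \<le> (1 - t) * rad u + t * rad v"
    using * assms(3) by (intro add_mono mult_left_mono) (auto simp: rad_def)
  then show ?thesis using * by (simp add: algebra_simps)
qed

text \<open>To find a preimage of \<open>P\<close>, its minimal coordinate \<open>m\<close> serves
  as the scaling factor, and the excesses of the other two coordinates over \<open>m\<close>,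
  divided by \<open>r * m\<close>, are barycentric coordinates.\<close>

lemma level_zero_set:
  assumes T: "layer_triangle L T"
  shows "{P \<in> S2. level (real L + 1) P = 0} = draw ` realization T"
proof (intro equalityI subsetI)
  note lT = layer_triangle_layered[OF T]
  fix P assume "P \<in> draw ` realization T"
  then obtain x where x: "x \<in> realization T" "P = draw x" by auto
  have L: "lay v = L" if "v \<in> verts T" for v using T that by (auto simp: layer_triangle_def)
  obtain c where "level (real L + 1) (draw x) = c * ((\<Sum>j\<in>UNIV. wt x $ j) - (real L + 1))"
    using level_draw[OF lT x(1)] by blast
  moreover have "(\<Sum>j\<in>UNIV. wt x $ j) = real L + 1"
    using wt_sum_le[OF lT x(1), of L] wt_sum_ge[OF lT x(1), of L] L by simp
  ultimately show "P \<in> {P \<in> S2. level (real L + 1) P = 0}" using x draw_in_sphere[OF lT] by simp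
next
  fix P assume "P \<in> {P \<in> S2. level (real L + 1) P = 0}"
  then have P: "P \<in> S2" "level (real L + 1) P = 0" by auto
  define r m where "r = real L + 1" and "m = min3 P"
  have r: "r > 0" by (simp add: r_def)
  obtain k where k: "m = P $ k" using min3_attained unfolding m_def by blast
  obtain i where i: "i \<noteq> k" using exists_third by blast
  obtain j where j: "j \<noteq> k" "j \<noteq> i" using exists_third by blast
  have all: "l \<in> {i, j, k}" for l using three_indices(1)[of i j k] i j by blast
  have ge: "P $ l \<ge> m" for l unfolding m_def by (rule min3_le)
  have P_sum: "P $ 1 + P $ 2 + P $ 3 = P $ i + P $ j + P $ k"
    using three_indices(2)[of i j k "\<lambda>l. P $ l"] i j by (simp add: sum_3)
  then have sum: "(P $ i - m) + (P $ j - m) = r * m"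
  proof -
    have "P $ 1 + P $ 2 + P $ 3 = (3 + r) * m" using P(2) unfolding level_def r_def m_def by simp
    moreover have "(3 + r) * m = 3 * m + r * m" by (rule distrib_right)
    ultimately show ?thesis using P_sum k by linarith
  qed
  \<comment> \<open>For \<open>m \<le> 0\<close> the equation \<open>sum\<close> would force
    \<open>m\<close> and both excesses to vanish, that is \<open>P = 0\<close>.\<close>
  have "m > 0"
  proof (rule ccontr)
    assume "\<not> m > 0"
    moreover have "r * m \<ge> 0" using sum ge[of i] ge[of j] by linarith
    ultimately have "m = 0" using r by (simp add: zero_le_mult_iff)
    then have "P $ i = 0" "P $ j = 0" "P $ k = 0" using sum ge[of i] ge[of j] k by auto
    then have "P = 0" using all by (auto simp: vec_eq_iff) (metis empty_iff insert_iff)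
    then show False using P(1) by simp
  qed
  have "i \<in> col ` verts T" "j \<in> col ` verts T" using T by (auto simp: layer_triangle_def)
  then obtain u v where uv: "u \<in> verts T" "v \<in> verts T" "col u = i" "col v = j" by blast
  have V: "u \<in> V" "v \<in> V" and rad: "rad u = r" "rad v = r"
    using T uv by (auto simp: layer_triangle_def rad_def r_def)
  have "{u, v} \<in> edges T" using T uv j by (auto simp: layer_triangle_def)
  define t where "t = (P $ j - m) / (r * m)"
  have rm: "r * m > 0" using r \<open>m > 0\<close> by simp
  have "(P $ i - m) / (r * m) + (P $ j - m) / (r * m) = 1"
    unfolding add_divide_distrib[symmetric] sum by (rule divide_self) (use r \<open>m > 0\<close> in simp)
  then have t': "1 - t = (P $ i - m) / (r * m)" unfolding t_def by (metis add_diff_cancel_right')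
  have "0 \<le> (P $ i - m) / (r * m)" "0 \<le> (P $ j - m) / (r * m)" using ge rm by simp_all
  then have t: "0 \<le> t" "t \<le> 1" using t' unfolding t_def by linarith+
  have "draw (edge_param u v t) = P"
  proof (rule draw_eqI[OF P(1) \<open>m > 0\<close>])
    fix l
    have wt: "wt (edge_param u v t) $ i = (P $ i - m) / m" "wt (edge_param u v t) $ j = (P $ j - m) / m"
      "wt (edge_param u v t) $ k = 0"
      unfolding wt_edge[OF V] uv rad t' using i j r by (simp_all add: t_def)
    have "P $ i = m * (1 + wt (edge_param u v t) $ i)" "P $ j = m * (1 + wt (edge_param u v t) $ j)"
      "P $ k = m * (1 + wt (edge_param u v t) $ k)"
      unfolding wt using \<open>m > 0\<close> k by (simp_all add: distrib_left)
    then show "P $ l = m * (1 + wt (edge_param u v t) $ l)" using all[of l] by blast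
  qed
  moreover have "edge_param u v t \<in> realization T"
    using realization_closed_cell[OF \<open>{u, v} \<in> edges T\<close>] t by (auto simp: closed_cell_edge)
  ultimately show "P \<in> draw ` realization T" by blast
qed

text \<open>Edges of a crossing pair join different layers, while the support of a point of
  \<open>T\<close> lies in a single one.\<close>

lemma no_crossing_on_layer:
  assumes G: "layered G" and T: "layer_triangle L T" "subgraph T G"
  shows "draw ` realization T \<inter> crossings G draw = {}"
proof (rule ccontr)
  assume "\<not> ?thesis"
  then obtain x where x: "x \<in> realization T" "draw x \<in> crossings G draw" by blast
  have "x \<in> realization G" using x(1) realization_mono[OF T(2)] by blast
  then obtain u v u' v' where uv: "crossing_pair G u v u' v'" "x = cross_point u v"
    using crossings_draw[OF G _ x(2)] by metis
  have "u \<noteq> v" using crossing_pair_verts(2)[OF G uv(1)] by simp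
  then have "{w. x w \<noteq> 0} = {u, v}" using support_open_cell[OF cross_point_open_cell] uv(2) by metis
  moreover have "{w. x w \<noteq> 0} \<subseteq> verts T"
    using T(1) x(1) by (intro support_realization) (auto simp: layer_triangle_def)
  ultimately have "lay u = L" "lay v = L" using T(1) by (auto simp: layer_triangle_def)
  then show False using uv(1) by (simp add: crossing_pair_def)
qed

text \<open>\<open>\<sigma>\<close> selects the side of the triangle that is free of
  \<open>G\<close>: the outer side if \<open>L\<close> is the highest layer, the inner side if it is
  the lowest.\<close>

lemma facial_layer:
  fixes \<sigma> :: real
  assumes G: "layered G" and T: "layer_triangle L T" "subgraph T G" "is_cycle T"
    and L: "(\<sigma> = 1 \<and> (\<forall>v\<in>verts G. lay v \<le> L)) \<or> (\<sigma> = - 1 \<and> (\<forall>v\<in>verts G. L \<le> lay v))"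
  shows "facial G draw T"
proof -
  let ?g = "\<lambda>P. \<sigma> * level (real L + 1) P"
  let ?F = "{P \<in> S2. ?g P > 0}"
  have r: "real L + 1 > 0" by simp
  have neg: "?g (draw x) \<le> 0" if x: "x \<in> realization G" for x
  proof -
    obtain c where "c > 0" "level (real L + 1) (draw x) = c * ((\<Sum>j\<in>UNIV. wt x $ j) - (real L + 1))"
      using level_draw[OF G x] by blast
    then show ?thesis
      using L wt_sum_le[OF G x, of L] wt_sum_ge[OF G x, of L] by (auto simp: mult_nonneg_nonpos)
  qed
  have cont: "continuous_on UNIV ?g" by (intro continuous_intros)
  have zero: "{P \<in> S2. ?g P = 0} = draw ` realization T"
    using level_zero_set[OF T(1)] L by auto
  have clos: "P \<in> closure ?F" if "P \<in> S2" "?g P = 0" for P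
    using level_zero_in_closure[OF r that(1), of \<sigma>] that(2) L by auto
  have conn: "connected ?F" "?F \<noteq> {}"
    using connected_level_neg[OF r] connected_level_pos[OF r] L by auto
  have "?F \<in> regions G draw" "boundary ?F = draw ` realization T"
    by (rule region_of_level_set[where g = ?g and T = T and G = G and \<phi> = draw,
          OF cont refl conn neg zero realization_mono[OF T(2)] clos]; assumption)+
  then show ?thesis
    using T no_crossing_on_layer[OF G T(1,2)] unfolding facial_def faces_def by blast
qed

end

section \<open>Stitches of triangle chains\<close>

lemma isomorphic_refl: "isomorphic G G"
  unfolding isomorphic_def by (intro exI[of _ "\<lambda>v. v"]) (auto simp: bij_betw_def)

lemma isomorphic_trans:
  assumes "isomorphic G H" "isomorphic H K"
  shows "isomorphic G K"
proof -
  obtain f where f: "bij_betw f (verts G) (verts H)"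
    "\<And>u v. u \<in> verts G \<Longrightarrow> v \<in> verts G \<Longrightarrow> {u, v} \<in> edges G \<longleftrightarrow> {f u, f v} \<in> edges H"
    using assms(1) unfolding isomorphic_def by blast
  obtain g where g: "bij_betw g (verts H) (verts K)"
    "\<And>u v. u \<in> verts H \<Longrightarrow> v \<in> verts H \<Longrightarrow> {u, v} \<in> edges H \<longleftrightarrow> {g u, g v} \<in> edges K"
    using assms(2) unfolding isomorphic_def by blast
  have fH: "f v \<in> verts H" if "v \<in> verts G" for v using f(1) that by (auto simp: bij_betw_def)
  show ?thesis unfolding isomorphic_def
    by (rule exI[of _ "g \<circ> f"]) (simp add: bij_betw_trans[OF f(1) g(1)] f(2) g(2) fH)
qed

lemma isomorphic_card: "isomorphic G H \<Longrightarrow> card (verts G) = card (verts H)"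
  unfolding isomorphic_def using bij_betw_same_card by blast

lemma isomorphic_complete_iff:
  assumes "simple_graph G"
  shows "isomorphic G (complete_graph n) \<longleftrightarrow>
    card (verts G) = n \<and> (\<forall>u\<in>verts G. \<forall>v\<in>verts G. u \<noteq> v \<longrightarrow> {u, v} \<in> edges G)"
proof
  assume "isomorphic G (complete_graph n)"
  then obtain f where f: "bij_betw f (verts G) {..<n}"
    "\<And>u v. u \<in> verts G \<Longrightarrow> v \<in> verts G \<Longrightarrow> {u, v} \<in> edges G \<longleftrightarrow> {f u, f v} \<in> edges (complete_graph n)"
    unfolding isomorphic_def by (auto simp: complete_graph_def)
  have "{u, v} \<in> edges G" if "u \<in> verts G" "v \<in> verts G" "u \<noteq> v" for u v
  proof -
    have "f u < n" "f v < n" "f u \<noteq> f v" using f(1) that by (auto simp: bij_betw_def inj_on_def)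
    then show ?thesis using f(2)[OF that(1,2)] by (simp add: complete_graph_adj)
  qed
  then show "card (verts G) = n \<and> (\<forall>u\<in>verts G. \<forall>v\<in>verts G. u \<noteq> v \<longrightarrow> {u, v} \<in> edges G)"
    using bij_betw_same_card[OF f(1)] by simp
next
  assume *: "card (verts G) = n \<and> (\<forall>u\<in>verts G. \<forall>v\<in>verts G. u \<noteq> v \<longrightarrow> {u, v} \<in> edges G)"
  have "finite (verts G)" using assms by (simp add: simple_graph_def)
  then obtain f where f: "bij_betw f (verts G) {..<n}"
    using * finite_same_card_bij[of "verts G" "{..<n}"] by auto
  have "{u, v} \<in> edges G \<longleftrightarrow> {f u, f v} \<in> edges (complete_graph n)" if "u \<in> verts G" "v \<in> verts G" for u v
  proof -
    have "f u < n" "f v < n" "f u = f v \<longleftrightarrow> u = v" using f that by (auto simp: bij_betw_def inj_on_def)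
    moreover have "u \<noteq> v" if "{u, v} \<in> edges G" using that assms by (auto simp: simple_graph_def)
    ultimately show ?thesis using * that by (auto simp: complete_graph_adj)
  qed
  then show "isomorphic G (complete_graph n)"
    using f unfolding isomorphic_def by (intro exI[of _ f]) (simp add: complete_graph_def)
qed

lemma cycle_graph_3: "cycle_graph 3 = complete_graph 3"
proof -
  have "edges (cycle_graph 3) = {{0, 1}, {1, 2}, {2, 0}}"
  proof -
    have "{i :: nat. i < 3} = {0, 1, 2}" by auto
    then have "{{i, Suc i mod 3} |i. i < 3} = (\<lambda>i. {i, Suc i mod 3}) ` {0, 1, 2}" by blast
    then show ?thesis by (simp add: cycle_graph_def numeral_2_eq_2)
  qed
  moreover have "edges (complete_graph 3) = {{0, 1}, {1, 2}, {2, 0}}"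
  proof (intro equalityI subsetI)
    fix e assume "e \<in> edges (complete_graph 3)"
    then obtain i j where e: "e = {i, j}" "i < 3" "j < 3" "i \<noteq> j" by (auto simp: complete_graph_def)
    have "i = 0 \<or> i = 1 \<or> i = 2" "j = 0 \<or> j = 1 \<or> j = 2" using e by linarith+
    then show "e \<in> {{0, 1}, {1, 2}, {2, 0}}" using e(1,4) by (elim disjE) (simp_all add: insert_commute)
  qed (auto simp: complete_graph_adj)
  ultimately show ?thesis by (simp add: cycle_graph_def complete_graph_def)
qed

lemma is_cycle_triangle: "is_triangle T \<Longrightarrow> is_cycle T"
  unfolding is_triangle_def is_cycle_def cycle_graph_3[symmetric] by blast

definition induced :: "'a graph \<Rightarrow> 'a set \<Rightarrow> 'a graph" where
  "induced G W = \<lparr>verts = W, edges = {e \<in> edges G. e \<subseteq> W}\<rparr>"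

lemma induced_simps [simp]:
  "verts (induced G W) = W" "edges (induced G W) = {e \<in> edges G. e \<subseteq> W}"
  by (simp_all add: induced_def)

lemma subgraph_induced: "simple_graph G \<Longrightarrow> W \<subseteq> verts G \<Longrightarrow> subgraph (induced G W) G"
  by (auto simp: subgraph_def simple_graph_def intro: finite_subset)

text \<open>Cut at layer \<open>k - 1\<close>, which is the highest layer of the lower part and the
  lowest of the upper part, so it is facial from both sides. The same map \<open>draw\<close> serves
  all three graphs.\<close>

lemma chain_is_stitch:
  fixes G :: "'a graph"
  assumes ch: "chain_graph (Suc k) lay G" and k: "k \<ge> 2"
  obtains G1 G2 :: "'a graph" and lay1 lay2 where "chain_graph k lay1 G1" "chain_graph 2 lay2 G2" "stitch G1 G2 G"
proof -
  have sG: "simple_graph G" using ch by (simp add: chain_graph_def)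
  have lay: "lay v \<le> k" if "v \<in> verts G" for v using ch that by (auto simp: chain_graph_def)
  have fib: "card {v \<in> verts G. lay v = i} = 3" if "i \<le> k" for i using ch that by (auto simp: chain_graph_def)
  have adj: "{u, v} \<in> edges G \<longleftrightarrow> u \<noteq> v \<and> lay u \<le> lay v + 1 \<and> lay v \<le> lay u + 1"
    if "u \<in> verts G" "v \<in> verts G" for u v using ch that by (simp add: chain_graph_def)
  \<comment> \<open>Columns can be chosen independently in each layer, since layers are complete and
    consecutive ones are completely joined.\<close>
  have "\<exists>c. bij_betw c {v \<in> verts G. lay v = i} (UNIV :: 3 set)" if "i \<le> k" for i
    using fib[OF that] sG by (intro finite_same_card_bij) (auto simp: simple_graph_def)
  then obtain c where c: "\<And>i. i \<le> k \<Longrightarrow> bij_betw (c i) {v \<in> verts G. lay v = i} (UNIV :: 3 set)" by metis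
  define col where "col v = c (lay v) v" for v
  interpret layered_drawing "verts G" lay col
  proof
    show "finite (verts G)" using sG by (simp add: simple_graph_def)
    fix u v assume uv: "u \<in> verts G" "v \<in> verts G" "col u = col v" "lay u = lay v"
    have "inj_on (c (lay v)) {w \<in> verts G. lay w = lay v}" using c[OF lay[OF uv(2)]] by (simp add: bij_betw_def)
    then show "u = v" using uv by (auto simp: col_def inj_on_def)
  qed
  define W1 W2 where "W1 = {v \<in> verts G. lay v \<le> k - 1}" and "W2 = {v \<in> verts G. k - 1 \<le> lay v}"
  define G1 G2 where "G1 = induced G W1" and "G2 = induced G W2"
  have W: "W1 \<subseteq> verts G" "W2 \<subseteq> verts G" by (auto simp: W1_def W2_def)
  have sub: "subgraph G1 G" "subgraph G2 G"
    using subgraph_induced[OF sG] W by (simp_all add: G1_def G2_def)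
  have simple: "simple_graph G1" "simple_graph G2" using sub by (simp_all add: subgraph_def)
  have near: "lay u \<le> lay v + 1" if "{u, v} \<in> edges G" for u v
  proof -
    have "u \<in> verts G" "v \<in> verts G" using edge_verts[OF sG that] by auto
    then show ?thesis using adj that by blast
  qed
  have lG: "layered G" "layered G1" "layered G2"
    using sG simple W near by (auto simp: layered_def G1_def G2_def)
  have ch1: "chain_graph k lay G1"
  proof (rule chain_graphI[OF simple(1)])
    show "lay v < k" if "v \<in> verts G1" for v using that k by (auto simp: G1_def W1_def)
    show "card {v \<in> verts G1. lay v = i} = 3" if "i < k" for i
    proof -
      have "{v \<in> verts G1. lay v = i} = {v \<in> verts G. lay v = i}" using that by (auto simp: G1_def W1_def)
      then show ?thesis using fib that by simp
    qed
    show "{u, v} \<in> edges G1 \<longleftrightarrow> u \<noteq> v \<and> lay u \<le> lay v + 1 \<and> lay v \<le> lay u + 1"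
      if "u \<in> verts G1" "v \<in> verts G1" for u v
      using that adj[of u v] W by (auto simp: G1_def)
  qed
  have ch2: "chain_graph 2 (\<lambda>v. lay v - (k - 1)) G2"
  proof (rule chain_graphI[OF simple(2)])
    show "lay v - (k - 1) < 2" if "v \<in> verts G2" for v using that lay[of v] k by (auto simp: G2_def W2_def)
    show "card {v \<in> verts G2. lay v - (k - 1) = i} = 3" if "i < 2" for i
    proof -
      have "{v \<in> verts G2. lay v - (k - 1) = i} = {v \<in> verts G. lay v = i + (k - 1)}"
        using that by (auto simp: G2_def W2_def)
      then show ?thesis using fib[of "i + (k - 1)"] that k by simp
    qed
    show "{u, v} \<in> edges G2 \<longleftrightarrow>
        u \<noteq> v \<and> lay u - (k - 1) \<le> lay v - (k - 1) + 1 \<and> lay v - (k - 1) \<le> lay u - (k - 1) + 1"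
      if "u \<in> verts G2" "v \<in> verts G2" for u v
    proof -
      have "u \<in> verts G" "v \<in> verts G" "k - 1 \<le> lay u" "k - 1 \<le> lay v" using that by (auto simp: G2_def W2_def)
      then show ?thesis using that adj[of u v] by (auto simp: G2_def)
    qed
  qed
  define T where "T = graph_inter G1 G2"
  have vT: "verts T = {v \<in> verts G. lay v = k - 1}"
    by (auto simp: T_def graph_inter_def G1_def G2_def W1_def W2_def)
  have eT: "edges T = {e \<in> edges G. e \<subseteq> verts T}"
    by (auto simp: T_def graph_inter_def G1_def G2_def)
  have subT: "subgraph T G1" "subgraph T G2"
    using simple by (auto simp: subgraph_def T_def graph_inter_def simple_graph_def)
  then have sT: "simple_graph T" by (simp add: subgraph_def)
  have complete: "{u, v} \<in> edges T" if "u \<in> verts T" "v \<in> verts T" "u \<noteq> v" for u v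
    using that adj[of u v] unfolding eT vT by auto
  have triT: "is_triangle T"
    using sT complete fib[of "k - 1"] isomorphic_complete_iff[OF sT, of 3] by (auto simp: is_triangle_def vT)
  have "col ` verts T = UNIV"
  proof -
    have "c (k - 1) ` verts T = UNIV" using c[of "k - 1"] by (simp add: bij_betw_def vT)
    moreover have "col v = c (k - 1) v" if "v \<in> verts T" for v using that by (simp add: col_def vT)
    ultimately show ?thesis by (metis image_cong)
  qed
  then have layT: "layer_triangle (k - 1) T"
    using sT complete by (auto simp: layer_triangle_def vT)
  have facial: "facial G1 draw T" "facial G2 draw T"
    using facial_layer[OF lG(2) layT subT(1) is_cycle_triangle[OF triT], of 1]
      facial_layer[OF lG(3) layT subT(2) is_cycle_triangle[OF triT], of "- 1"]
    by (auto simp: G1_def G2_def W1_def W2_def)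
  have "edges G \<subseteq> edges G1 \<union> edges G2"
  proof
    fix e assume e: "e \<in> edges G"
    then obtain u v where uv: "e = {u, v}" "u \<noteq> v" "u \<in> verts G" "v \<in> verts G" using simple_graph_edgeE[OF sG] by metis
    then have "lay u \<le> lay v + 1" "lay v \<le> lay u + 1" using adj[of u v] e by auto
    then have "(lay u \<le> k - 1 \<and> lay v \<le> k - 1) \<or> (k - 1 \<le> lay u \<and> k - 1 \<le> lay v)" by linarith
    then show "e \<in> edges G1 \<union> edges G2" using e uv by (auto simp: G1_def G2_def W1_def W2_def)
  qed
  moreover have "W1 \<union> W2 = verts G" by (auto simp: W1_def W2_def)
  ultimately have un: "graph_union G1 G2 = G"
    using sub by (auto simp: graph_union_def subgraph_def G1_def G2_def intro!: graph.equality)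
  have "{v \<in> verts G. lay v = k} \<noteq> {}" "{v \<in> verts G. lay v = 0} \<noteq> {}"
    using fib[of k] fib[of 0] by (metis card.empty le_refl zero_neq_numeral zero_le)+
  then obtain w0 w1 where w: "w1 \<in> verts G" "lay w1 = k" "w0 \<in> verts G" "lay w0 = 0" by blast
  then have "w1 \<notin> W1" "w0 \<notin> W2" using k by (auto simp: W1_def W2_def)
  then have "W1 \<noteq> verts G" "W2 \<noteq> verts G" using w by auto
  then have "G1 \<noteq> G" "G2 \<noteq> G" by (metis G1_def induced_simps(1), metis G2_def induced_simps(1))
  then have proper: "proper_subgraph G1 G" "proper_subgraph G2 G" using sub by (simp_all add: proper_subgraph_def)
  have "stitch G1 G2 G"
    unfolding stitch_def one_planar_def
    using simple sG one_drawing_draw[OF lG(1)] one_drawing_draw[OF lG(2)] one_drawing_draw[OF lG(3)]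
      simple_drawing_draw[OF lG(1)] proper isomorphic_refl un triT facial unfolding T_def by blast
  then show thesis by (rule that[OF ch1 ch2])
qed

section \<open>Stitches of chains are chains\<close>

abbreviation triangle_chain :: "nat \<Rightarrow> (nat \<times> nat) graph" where
  "triangle_chain k \<equiv> strong_product (complete_graph 3) (path_graph k)"

lemma stitchE:
  assumes "stitch H1 H2 G"
  obtains \<phi> G1 G2 a b c where "simple_graph G" "one_drawing G \<phi>" "simple_drawing G \<phi>"
    "subgraph G1 G" "subgraph G2 G" "G1 \<noteq> G" "G2 \<noteq> G" "isomorphic G1 H1" "isomorphic G2 H2" "graph_union G1 G2 = G"
    "facial G1 \<phi> (graph_inter G1 G2)" "facial G2 \<phi> (graph_inter G1 G2)"
    "distinct [a, b, c]" "verts (graph_inter G1 G2) = {a, b, c}"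
    "edges (graph_inter G1 G2) = {{a, b}, {b, c}, {c, a}}"
proof -
  obtain \<phi> G1 G2 where *: "simple_graph G" "one_drawing G \<phi>" "simple_drawing G \<phi>"
    "proper_subgraph G1 G" "proper_subgraph G2 G" "isomorphic G1 H1" "isomorphic G2 H2" "graph_union G1 G2 = G"
    "is_triangle (graph_inter G1 G2)"
    "facial G1 \<phi> (graph_inter G1 G2)" "facial G2 \<phi> (graph_inter G1 G2)"
    using assms unfolding stitch_def by blast
  obtain a b c where "distinct [a, b, c]" "verts (graph_inter G1 G2) = {a, b, c}"
    "edges (graph_inter G1 G2) = {{a, b}, {b, c}, {c, a}}"
    using *(9) by (rule triangleE)
  with * that show thesis unfolding proper_subgraph_def by blast
qed

text \<open>The strict bounds come from properness: a part on three vertices would be the shared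
  triangle, and the other part would be all of \<open>G\<close>. They give
  \<open>k1, k2 \<ge> 2\<close> for parts without remainder even where a class only demands
  \<open>k1, k2 \<ge> 1\<close>.\<close>

lemma stitch_card:
  assumes "stitch H1 H2 G"
  shows "card (verts G) + 3 = card (verts H1) + card (verts H2)"
    and "card (verts H1) > 3" "card (verts H2) > 3"
proof -
  obtain \<phi> G1 G2 a b c where *: "simple_graph G" "subgraph G1 G" "subgraph G2 G" "G1 \<noteq> G" "G2 \<noteq> G"
      "isomorphic G1 H1" "isomorphic G2 H2" "graph_union G1 G2 = G"
    and T: "distinct [a, b, c]" "verts (graph_inter G1 G2) = {a, b, c}"
    "edges (graph_inter G1 G2) = {{a, b}, {b, c}, {c, a}}"
    using assms by (rule stitchE)
  have fin: "finite (verts G1)" "finite (verts G2)" using *(2,3) by (auto simp: subgraph_def simple_graph_def)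
  have V: "verts G = verts G1 \<union> verts G2" using *(8) by (auto simp: graph_union_def)
  have I: "verts G1 \<inter> verts G2 = {a, b, c}" using T(2) by (simp add: graph_inter_def)
  have cI: "card {a, b, c} = 3" using T(1) by simp
  show "card (verts G) + 3 = card (verts H1) + card (verts H2)"
    using card_Un_Int[OF fin] isomorphic_card[OF *(6)] isomorphic_card[OF *(7)] V I cI by simp
  have gt: "card (verts A) > 3"
    if A: "simple_graph A" "finite (verts A)" "{a, b, c} \<subseteq> verts A" "A \<noteq> G" "B \<noteq> G"
      "graph_union A B = G" "{a, b, c} \<subseteq> verts B" "{{a, b}, {b, c}, {c, a}} \<subseteq> edges B" for A B :: "'c graph"
  proof (rule ccontr)
    assume "\<not> card (verts A) > 3"
    then have vA: "verts A = {a, b, c}" using card_seteq[OF A(2,3)] cI by simp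
    have "edges A \<subseteq> {{a, b}, {b, c}, {c, a}}"
    proof
      fix e assume "e \<in> edges A"
      then obtain u v where "e = {u, v}" "u \<noteq> v" "u \<in> verts A" "v \<in> verts A"
        using simple_graph_edgeE[OF A(1)] by metis
      then show "e \<in> {{a, b}, {b, c}, {c, a}}" unfolding vA by (auto simp: insert_commute)
    qed
    then have "graph_union A B = B"
      using A(7,8) vA by (auto simp: graph_union_def intro!: graph.equality)
    then show False using A(5,6) by simp
  qed
  have s: "simple_graph G1" "simple_graph G2" using *(2,3) by (auto simp: subgraph_def)
  have T': "{a, b, c} \<subseteq> verts G1" "{a, b, c} \<subseteq> verts G2"
    "{{a, b}, {b, c}, {c, a}} \<subseteq> edges G1" "{{a, b}, {b, c}, {c, a}} \<subseteq> edges G2"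
    unfolding T(2,3)[symmetric] by (auto simp: graph_inter_def)
  have un: "graph_union G2 G1 = G" using *(8) by (simp add: graph_union_def Un_commute)
  show "card (verts H1) > 3"
    using gt[OF s(1) fin(1) T'(1) *(4,5,8) T'(2,4)] isomorphic_card[OF *(6)] by simp
  show "card (verts H2) > 3"
    using gt[OF s(2) fin(2) T'(2) *(5,4) un T'(1,3)] isomorphic_card[OF *(7)] by simp
qed

text \<open>The shared triangle is an end layer of both parts. One of them is reversed, so that it
  ends where the other begins.\<close>

lemma stitch_of_chains:
  assumes st: "stitch H1 H2 G" and H: "isomorphic H1 (triangle_chain k1)" "isomorphic H2 (triangle_chain k2)"
    and k: "k1 \<ge> 2" "k2 \<ge> 2"
  shows "isomorphic G (triangle_chain (k1 + k2 - 1))"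
proof -
  obtain \<phi> G1 G2 a b c where G: "simple_graph G" "one_drawing G \<phi>" "simple_drawing G \<phi>"
    and sub: "subgraph G1 G" "subgraph G2 G" and iso: "isomorphic G1 H1" "isomorphic G2 H2" and un: "graph_union G1 G2 = G"
    and facial: "facial G1 \<phi> (graph_inter G1 G2)" "facial G2 \<phi> (graph_inter G1 G2)"
    and T: "distinct [a, b, c]" "verts (graph_inter G1 G2) = {a, b, c}"
    "edges (graph_inter G1 G2) = {{a, b}, {b, c}, {c, a}}"
    using st by (rule stitchE)
  have end_layer: "\<exists>lay. chain_graph m lay A \<and> {v \<in> verts A. lay v = 0} = {a, b, c}"
    if A: "subgraph A G" "facial A \<phi> (graph_inter G1 G2)" "isomorphic A (triangle_chain m)" "m \<ge> 2" for A m
  proof -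
    have "simple_graph A" using A(1) by (simp add: subgraph_def)
    then obtain lay where ch: "chain_graph m lay A" using isomorphic_chain A(3) by blast
    have "edges (graph_inter G1 G2) \<subseteq> edges A" using A(2) by (simp add: facial_def subgraph_def)
    then have e: "{a, b} \<in> edges A" "{b, c} \<in> edges A" "{c, a} \<in> edges A" unfolding T(3) by auto
    show ?thesis
    proof (rule tripod_triangle_is_end_layer[OF ch A(4) T(1) e])
      fix x y z assume xyz: "{x, y, z} = {a, b, c}" "distinct [x, y, z]"
      have "x \<in> {a, b, c}" "y \<in> {a, b, c}" "z \<in> {a, b, c}" using xyz(1) by blast+
      then have "{{x, y}, {y, z}, {z, x}} = {{a, b}, {b, c}, {c, a}}"
        using xyz(2) by (auto simp: insert_commute)
      then show "tripod_crossings (\<lambda>e f. e \<in> edges A \<and> f \<in> edges A \<and> crosses G \<phi> e f) (edges A) x y z"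
        using facial_triangle_tripod_crossings[OF G(2,3,1) A(1,2) xyz(2)] T(2,3) xyz(1) by simp
    qed
  qed
  obtain lay1 where lay1: "chain_graph k1 lay1 G1" "{v \<in> verts G1. lay1 v = 0} = {a, b, c}"
    using end_layer[OF sub(1) facial(1) isomorphic_trans[OF iso(1) H(1)] k(1)] by blast
  obtain lay2 where lay2: "chain_graph k2 lay2 G2" "{v \<in> verts G2. lay2 v = 0} = {a, b, c}"
    using end_layer[OF sub(2) facial(2) isomorphic_trans[OF iso(2) H(2)] k(2)] by blast
  have I: "verts G1 \<inter> verts G2 = {a, b, c}" using T(2) by (simp add: graph_inter_def)
  have "{v \<in> verts G1. k1 - 1 - lay1 v = k1 - 1} = {v \<in> verts G1. lay1 v = 0}" using k by auto
  then have "\<exists>lay. chain_graph (k1 + k2 - 1) lay (graph_union G1 G2)"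
    using glue_chains[OF chain_graph_reverse[OF lay1(1)] lay2(1)] k lay1(2) lay2(2) I by simp
  then show ?thesis using isomorphic_chain[OF G(1)] un by simp
qed

text \<open>Two layers never differ by more than one, so any division of the six vertices into two
  triples is a layering.\<close>

lemma isomorphic_K6:
  assumes "simple_graph G"
  shows "isomorphic G (complete_graph 6) \<longleftrightarrow> isomorphic G (triangle_chain 2)"
proof
  assume "isomorphic G (triangle_chain 2)"
  then obtain lay where ch: "chain_graph 2 lay G" using isomorphic_chain[OF assms] by blast
  have "lay v < 2" if "v \<in> verts G" for v using ch that by (auto simp: chain_graph_def)
  then have "lay u \<le> lay v + 1" if "u \<in> verts G" for u v using that by fastforce
  then have "\<forall>u\<in>verts G. \<forall>v\<in>verts G. u \<noteq> v \<longrightarrow> {u, v} \<in> edges G" using ch by (simp add: chain_graph_def)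
  then show "isomorphic G (complete_graph 6)"
    using card_chain[OF ch] isomorphic_complete_iff[OF assms] by simp
next
  assume "isomorphic G (complete_graph 6)"
  then have G: "card (verts G) = 6" "\<And>u v. u \<in> verts G \<Longrightarrow> v \<in> verts G \<Longrightarrow> u \<noteq> v \<Longrightarrow> {u, v} \<in> edges G"
    using isomorphic_complete_iff[OF assms] by auto
  have "3 \<le> card (verts G)" using G(1) by simp
  then obtain A where A: "A \<subseteq> verts G" "card A = 3" and "finite A"
    by (rule obtain_subset_with_card_n)
  define lay where "lay v = (if v \<in> A then 0 else 1 :: nat)" for v
  have "chain_graph 2 lay G"
  proof (rule chain_graphI[OF assms])
    show "lay v < 2" for v by (simp add: lay_def)
    fix i :: nat assume "i < 2"
    then consider "i = 0" | "i = 1" by linarith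
    then show "card {v \<in> verts G. lay v = i} = 3"
    proof cases
      case 1
      then have "{v \<in> verts G. lay v = i} = A" using A(1) by (auto simp: lay_def)
      then show ?thesis using A(2) by simp
    next
      case 2
      then have "{v \<in> verts G. lay v = i} = verts G - A" by (auto simp: lay_def)
      then show ?thesis using A G(1) \<open>finite A\<close> by (simp add: card_Diff_subset)
    qed
  next
    show "{u, v} \<in> edges G \<longleftrightarrow> u \<noteq> v \<and> lay u \<le> lay v + 1 \<and> lay v \<le> lay u + 1"
      if "u \<in> verts G" "v \<in> verts G" for u v
      using G(2)[OF that] assms by (auto simp: lay_def simple_graph_def)
  qed
  then show "isomorphic G (triangle_chain 2)" using isomorphic_chain[OF assms] by blast
qed

lemma clique_case:
  assumes "simple_graph G" "isomorphic G (complete_graph n)" "n \<le> 6" "card (verts G) = 3 * k" "k \<ge> 2"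
  shows "isomorphic G (triangle_chain k)"
proof -
  have "card (verts G) = n" using isomorphic_card[OF assms(2)] by (simp add: complete_graph_def)
  then have "n = 6" "k = 2" using assms(3-5) by linarith+
  then show ?thesis using assms(2) isomorphic_K6[OF assms(1)] by simp
qed

text \<open>The induction step common to all classes. From
  \<open>3 * k + 3 = 3 * (k1 + k2) + (s1 + s2)\<close> the number \<open>s1 + s2\<close> is a
  multiple of 3, and it is at most 2, so both parts are chains by induction.\<close>

lemma stitch_case:
  assumes "stitch H1 H2 G" "card (verts H1) = 3 * k1 + s1" "card (verts H2) = 3 * k2 + s2"
    and "s1 + s2 \<le> 2" "card (verts G) = 3 * k"
    and "\<And>k. card (verts H1) = 3 * k \<Longrightarrow> k \<ge> 2 \<Longrightarrow> isomorphic H1 (triangle_chain k)"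
    and "\<And>k. card (verts H2) = 3 * k \<Longrightarrow> k \<ge> 2 \<Longrightarrow> isomorphic H2 (triangle_chain k)"
  shows "isomorphic G (triangle_chain k)"
proof -
  have eq: "3 * k + 3 = 3 * (k1 + k2) + (s1 + s2)" using stitch_card(1)[OF assms(1)] assms(2,3,5) by simp
  then have "s1 + s2 = 0" using assms(4) by presburger
  then have s: "s1 = 0" "s2 = 0" by auto
  then have k: "k1 \<ge> 2" "k2 \<ge> 2" using stitch_card(2,3)[OF assms(1)] assms(2,3) by auto
  have "isomorphic H1 (triangle_chain k1)" "isomorphic H2 (triangle_chain k2)"
    using assms(2,3,6,7) s k by simp_all
  then have "isomorphic G (triangle_chain (k1 + k2 - 1))" using stitch_of_chains[OF assms(1)] k by blast
  moreover have "k1 + k2 - 1 = k" using eq s by simp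
  ultimately show ?thesis by simp
qed

section \<open>Induction over the five classes\<close>

lemma card_K3_C4: "card (verts (graph_join (complete_graph 3) (cycle_graph 4))) = 7"
  by (simp add: graph_join_def complete_graph_def cycle_graph_def card_Plus)

lemma card_K2222: "card (verts (complete_multipartite 4 2)) = 8"
  by (simp add: complete_multipartite_def)

lemma card_K2_P6: "card (verts (graph_join (complete_graph 2) (complement (path_graph 6)))) = 8"
  by (simp add: graph_join_def complete_graph_def complement_def path_graph_def card_Plus)

lemma class_E3_chain:
  "G \<in> class_E3 \<Longrightarrow> card (verts G) = 3 * k \<Longrightarrow> k \<ge> 2 \<Longrightarrow> isomorphic G (triangle_chain k)"
proof (induction arbitrary: k rule: class_E3.induct)
  case (small G)
  then show ?case by simp
next
  case (clique G n)
  then show ?case by (intro clique_case[of G n]) auto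
next
  case (K3_C4 G)
  then show ?case using isomorphic_card[OF K3_C4(2)] card_K3_C4 by presburger
next
  case (K2222 G)
  then show ?case using isomorphic_card[OF K2222(2)] card_K2222 by presburger
next
  case (stitch H1 H2 k1 s1 k2 s2 G)
  have "isomorphic H (triangle_chain k)"
    if "H \<in> class_E3 \<and> (\<forall>k. card (verts H) = 3 * k \<longrightarrow> 2 \<le> k \<longrightarrow> isomorphic H (triangle_chain k)) \<or>
        isomorphic H (graph_join (complete_graph 2) (complement (path_graph 6)))"
      "card (verts H) = 3 * k" "k \<ge> 2" for H :: "'a graph" and k
    using that(1)
  proof
    assume "isomorphic H (graph_join (complete_graph 2) (complement (path_graph 6)))"
    then have "card (verts H) = 8" using isomorphic_card card_K2_P6 by metis
    then show ?thesis using that(2) by presburger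
  qed (use that in blast)
  with stitch show ?case by (intro stitch_case[of H1 H2 G k1 s1 k2 s2 k]) blast+
qed

lemma class_E4_chain:
  "G \<in> class_E4 \<Longrightarrow> card (verts G) = 3 * k \<Longrightarrow> k \<ge> 2 \<Longrightarrow> isomorphic G (triangle_chain k)"
proof (induction arbitrary: k rule: class_E4.induct)
  case (small G)
  then show ?case by simp
next
  case (clique G n)
  then show ?case by (intro clique_case[of G n]) auto
next
  case (K3_C4 G)
  then show ?case using isomorphic_card[OF K3_C4(2)] card_K3_C4 by presburger
next
  case (stitch H1 H2 k1 s1 k2 s2 G)
  then have "s1 + s2 \<le> 2" by auto
  with stitch show ?case by (intro stitch_case[of H1 H2 G k1 s1 k2 s2 k]) blast+
qed

lemma class_E5_chain:
  "G \<in> class_E5 \<Longrightarrow> card (verts G) = 3 * k \<Longrightarrow> k \<ge> 2 \<Longrightarrow> isomorphic G (triangle_chain k)"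
proof (induction arbitrary: k rule: class_E5.induct)
  case (small G)
  then show ?case by simp
next
  case (clique G n)
  then show ?case by (intro clique_case[of G n]) auto
next
  case (stitch H1 H2 k1 s1 k2 s2 G)
  then have "s1 + s2 \<le> 2" by auto
  with stitch show ?case by (intro stitch_case[of H1 H2 G k1 s1 k2 s2 k]) blast+
qed

lemma class_E6_chain:
  "G \<in> class_E6 \<Longrightarrow> card (verts G) = 3 * k \<Longrightarrow> k \<ge> 2 \<Longrightarrow> isomorphic G (triangle_chain k)"
proof (induction arbitrary: k rule: class_E6.induct)
  case (small G)
  then show ?case by simp
next
  case (clique G)
  then show ?case by (intro clique_case[of G 6]) auto
next
  case (stitch H1 H2 k1 s1 k2 s2 G)
  then show ?case by (intro stitch_case[of H1 H2 G k1 s1 k2 s2 k]) blast+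
qed

lemma class_E_chain:
  "G \<in> class_E \<Longrightarrow> card (verts G) = 3 * k \<Longrightarrow> k \<ge> 2 \<Longrightarrow> isomorphic G (triangle_chain k)"
proof (induction arbitrary: k rule: class_E.induct)
  case (clique G n)
  then show ?case by (intro clique_case[of G n]) auto
next
  case (K3_C4 G)
  then show ?case using isomorphic_card[OF K3_C4(2)] card_K3_C4 by presburger
next
  case (stitch H1 H2 k1 s1 k2 s2 G)
  then have "s1 + s2 \<le> 2" by auto
  with stitch show ?case by (intro stitch_case[of H1 H2 G k1 s1 k2 s2 k]) blast+
qed

text \<open>A chain grows by one layer at a time through a stitch with a copy of K_6. The two
  closure properties hold in all five classes, because both parts have remainder 0 and at least two
  layers.\<close>

lemma chain_in_class:
  fixes C :: "'a graph set"
  assumes K6: "\<And>G. simple_graph G \<Longrightarrow> isomorphic G (complete_graph 6) \<Longrightarrow> G \<in> C"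
    and stitch: "\<And>H1 H2 G m. H1 \<in> C \<Longrightarrow> H2 \<in> C \<Longrightarrow> card (verts H1) = 3 * m \<Longrightarrow> card (verts H2) = 6 \<Longrightarrow>
      m \<ge> 2 \<Longrightarrow> stitch H1 H2 G \<Longrightarrow> G \<in> C"
    and "k \<ge> 2" "chain_graph k lay (G :: 'a graph)"
  shows "G \<in> C"
  using assms(3,4)
proof (induction k arbitrary: G lay rule: dec_induct)
  case base
  then have "simple_graph G" by (simp add: chain_graph_def)
  then show ?case using K6 isomorphic_K6 isomorphic_chain base by blast
next
  case (step m)
  obtain G1 G2 :: "'a graph" and lay1 lay2 where *: "chain_graph m lay1 G1" "chain_graph 2 lay2 G2" "stitch G1 G2 G"
    using chain_is_stitch[OF step.prems step.hyps(1)] .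
  have "simple_graph G2" using *(2) by (simp add: chain_graph_def)
  then have "G2 \<in> C" using K6 isomorphic_K6 isomorphic_chain *(2) by blast
  then show ?case
    using stitch[OF step.IH[OF *(1)] _ _ _ step.hyps(1) *(3)] card_chain[OF *(1)] card_chain[OF *(2)] by simp
qed

theorem corollary7p10:
  fixes C :: "'a graph set" and G :: "'a graph" and k :: nat
  assumes "C \<in> {class_E3, class_E4, class_E5, class_E6, class_E}"
    and "k \<ge> 2"
    and "simple_graph G"
    and "card (verts G) = 3 * k"
  shows "G \<in> C \<longleftrightarrow> isomorphic G (strong_product (complete_graph 3) (path_graph k))"
proof
  assume "G \<in> C"
  then show "isomorphic G (triangle_chain k)"
    using assms class_E3_chain class_E4_chain class_E5_chain class_E6_chain class_E_chain by blast
next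
  assume "isomorphic G (triangle_chain k)"
  then obtain lay where ch: "chain_graph k lay G" using isomorphic_chain[OF assms(3)] by blast
  have "\<And>G. simple_graph G \<Longrightarrow> isomorphic G (complete_graph 6) \<Longrightarrow> G \<in> C"
    using assms(1) class_E3.clique[of _ 6] class_E4.clique[of _ 6] class_E5.clique[of _ 6]
      class_E6.clique class_E.clique[of _ 6] by auto
  moreover have "G \<in> C" if "H1 \<in> C" "H2 \<in> C" "card (verts H1) = 3 * m" "card (verts H2) = 6" "m \<ge> 2" "stitch H1 H2 G"
    for H1 H2 G and m :: nat
    using assms(1) that class_E3.stitch[of H1 H2 m 0 2 0 G] class_E4.stitch[of H1 H2 m 0 2 0 G]
      class_E5.stitch[of H1 H2 m 0 2 0 G] class_E6.stitch[of H1 H2 m 0 2 0 G] class_E.stitch[of H1 H2 m 0 2 0 G]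
    by auto
  ultimately show "G \<in> C" using chain_in_class[of C k lay G] assms(2) ch by blast
qed

end
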